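(* Let $q$ be a prime power, let $S\subseteq\mathbb F_q^n$ be nonempty, and let $a,b\ge1$ be integers with $b+a<n$. For $\tau>0$, set $$E=\frac{|S|}{q^{b+a}},\qquad \gamma=1-\frac{8(1+\tau)}{\tau^2E},$$ and suppose that $\gamma>0$. Then $$\beta_S(b,\tau)\le\frac{8}{\tau^2E}\min\left\{\left(\frac{1+q^{1-a}}{\gamma}\right)^{b+a},\ \frac4\gamma\exp\!\left(\frac{8(b+a)}{\gamma q^{a-1}}\right)\right\},$$ where the second expression is included in the minimum only when $\gamma q^{a-1}\ge8$, and is omitted otherwise (so that the minimum is then just the first expression). Moreover, if in addition $0<\tau\le1$, then the probability that a uniformly random $b\times n$ matrix over $\mathbb F_q$ is $\tau$-unbalanced satisfies the same bound with the leading constant $8$ (in the prefactor $8/(\tau^2E)$) replaced by $9$.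
   Context: Let $S\subseteq\mathbb F_q^n$ be nonempty and $\mu=|S|/q^b$. A linear map $L:\mathbb F_q^n\to\mathbb F_q^b$ (equivalently a $b\times n$ matrix over $\mathbb F_q$, not necessarily of full rank) is called $\tau$-balanced (with respect to $S$) if $(1-\tau)\mu\le|S\cap L^{-1}(y)|\le(1+\tau)\mu$ for every $y\in\mathbb F_q^b$, and $\tau$-unbalanced otherwise. $\beta_S(b,\tau)$ denotes the proportion of $\tau$-unbalanced maps among all surjective linear maps $\mathbb F_q^n\to\mathbb F_q^b$. *)

theory Defs
  imports "HOL-Probability.Probability_Mass_Function" "Jordan_Normal_Form.Matrix"
begin

text \<open>
  \<open>\<bbbF>\<^sub>q\<close> is a type \<open>'f :: {field, finite}\<close> with \<open>q = CARD('f)\<close>, \<open>\<bbbF>\<^sub>q\<^sup>n\<close> is \<^term>\<open>carrier_vec n\<close>,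
  and a linear map from \<open>\<bbbF>\<^sub>q\<^sup>n\<close> to \<open>\<bbbF>\<^sub>q\<^sup>b\<close> is identified with its matrix in \<^term>\<open>carrier_mat b n\<close>.
\<close>

definition balanced :: "nat \<Rightarrow> 'f :: {field, finite} vec set \<Rightarrow> nat \<Rightarrow> real \<Rightarrow> 'f mat \<Rightarrow> bool" where
  "balanced n S b \<tau> L \<longleftrightarrow>
     (let \<mu> = real (card S) / real CARD('f) ^ b in
      \<forall>y \<in> carrier_vec b.
        (1 - \<tau>) * \<mu> \<le> real (card (S \<inter> {x \<in> carrier_vec n. L *\<^sub>v x = y})) \<and>
        real (card (S \<inter> {x \<in> carrier_vec n. L *\<^sub>v x = y})) \<le> (1 + \<tau>) * \<mu>)"

abbreviation unbalanced :: "nat \<Rightarrow> 'f :: {field, finite} vec set \<Rightarrow> nat \<Rightarrow> real \<Rightarrow> 'f mat \<Rightarrow> bool" where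
  "unbalanced n S b \<tau> L \<equiv> \<not> balanced n S b \<tau> L"

definition surjective_maps :: "nat \<Rightarrow> nat \<Rightarrow> 'f :: {field, finite} mat set" where
  "surjective_maps n b =
     {L \<in> carrier_mat b n. (\<lambda>x. L *\<^sub>v x) ` carrier_vec n = carrier_vec b}"

definition beta :: "nat \<Rightarrow> 'f :: {field, finite} vec set \<Rightarrow> nat \<Rightarrow> real \<Rightarrow> real" where
  "beta n S b \<tau> =
     real (card {L \<in> surjective_maps n b. unbalanced n S b \<tau> L}) /
     real (card (surjective_maps n b :: 'f mat set))"

end

theory Submission
  imports Defs
    "HOL-Library.Poly_Mapping"
    "HOL-Library.FuncSet"
    "HOL-Library.Product_Plus"
    "HOL-Library.Function_Algebras"
    "HOL-Computational_Algebra.Polynomial"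
begin

text \<open>
  Write \<open>q\<close> for the size of the field \<open>F\<close> and \<open>k = b + a\<close>.  Extend a random \<open>b \<times> n\<close> matrix \<open>L\<close> by a
  random \<open>a \<times> n\<close> matrix \<open>M\<close>.  The pair \<open>x \<mapsto> (L x, M x)\<close> sorts \<open>S\<close> into the \<open>q\<^sup>k\<close> cells of
  \<open>F\<^sup>b \<times> F\<^sup>a\<close>, on average \<open>E\<close> points to a cell, and two distinct points share a
  cell with probability exactly \<open>1 / q\<^sup>k\<close>.  Call a cell deviating if its count differs from \<open>E\<close> by at least
  \<open>\<tau> E / 2\<close>.  Chebyshev's inequality is used twice.  Globally, the expected proportion of deviating
  cells is at most \<open>4 / (\<tau>\<^sup>2 E)\<close> (\<open>sum_card_deviating_cells\<close>).  Locally, if \<open>L\<close> is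
  unbalanced at \<open>y\<close>, the \<open>q\<^sup>a\<close> cells above \<open>y\<close> have an average that is off by more than \<open>\<tau> E\<close>, so for at
  least half of all \<open>M\<close> a proportion \<open>\<gamma>\<close> of them deviates (\<open>half_of_extensions_rich\<close>).

  Replacing \<open>L\<close> by \<open>L - C M\<close> does not change the distribution of the pair, but it shears the set \<open>D\<close>
  of deviating cells along \<open>C\<close>.  Hence the probability of being unbalanced is at most twice the expected
  proportion \<open>\<theta>\<close> of those \<open>C\<close> for which some translate of the flat \<open>{(C u, u)}\<close> has a proportion
  \<open>\<gamma>\<close> of its points in \<open>D\<close>.  What remains is a Kakeya inequality that bounds \<open>\<theta>\<close> linearly by the
  density of \<open>D\<close>.

  That inequality comes from the polynomial method with multiplicities.  Consider the polynomials
  \<open>P(x, u)\<close> of total degree below \<open>d\<close> that vanish to order \<open>m1\<close> at every point and to order \<open>m2\<close> on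
  \<open>D\<close>.  On a rich flat, the Schwartz--Zippel lemma with multiplicities makes \<open>P\<close> vanish to order \<open>l\<close>,
  so the leading form of \<open>P\<close> vanishes to order \<open>l\<close> along \<open>x = C u\<close> (\<open>flat_vanishing\<close>).  On the
  other hand, no nonzero form of degree below \<open>l q\<^sup>a\<close> does this for every \<open>C\<close>: this is again
  Schwartz--Zippel, now for polynomials in \<open>x\<close> over the ring \<open>F[u]\<close> and for the grid of the \<open>q\<^sup>a\<close>
  linear forms in \<open>u\<close> (\<open>lower_degree_if_all_shears_lower\<close>).  The conditions for different \<open>C\<close> are
  permuted by shears, and codimension is submodular; so a proportion \<open>\<theta>\<close> of the conditions already costs a
  proportion \<open>\<theta>\<close> of the dimension (\<open>fractional_subadditivity\<close>).  Comparing dimensions gives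
  \<open>kakeya_counting\<close>.

  The two expressions in the minimum belong to two choices of multiplicities, taken to infinity in a fixed
  ratio.  With \<open>m1 = 0\<close>, the order on \<open>D\<close> has to make up for the missing points of the
  flat, which costs a factor \<open>1 / \<gamma>\<close> in each of the \<open>k\<close> dimensions (\<open>kakeya_power_bound\<close>).  With a
  large common order \<open>m1\<close> and \<open>m2\<close> only slightly larger, a rich flat gains the proportion \<open>\<gamma>\<close> of
  the increment, whose effect on dimensions is nearly linear; so \<open>1 / \<gamma>\<close> is
  paid once (\<open>kakeya_exponential_bound\<close>).

  All this concerns uniformly random matrices.  The proportion of nonsurjective ones is at most
  \<open>q\<^sup>b / q\<^sup>n\<close>, and both Kakeya bounds are better than needed by a factor
  \<open>1 - q\<^sup>b / q\<^sup>n\<close>, which pays for conditioning on surjectivity.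
\<close>

section \<open>Translation of polynomials and zeros counted with multiplicity\<close>

text \<open>
  A polynomial over a ring is represented by its coefficient function on exponent lists, and
  \<open>translate N z p\<close> has the coefficients of \<open>p(x + z)\<close>, that is, the Hasse derivatives of \<open>p\<close> at \<open>z\<close>.
  Exponents above the cutoff \<open>N\<close> are ignored; it makes the sums finite and is always at least the
  degree in question.  Vanishing of \<open>p\<close> to order \<open>m\<close> at \<open>z\<close> means that the coefficients of degree below
  \<open>m\<close> of this translate are zero.  Recursion on the list singles out one variable, which is how both the
  composition law and the Schwartz--Zippel lemma proceed.
\<close>

fun translate :: "nat \<Rightarrow> 'r::comm_ring_1 list \<Rightarrow> (nat list \<Rightarrow> 'r) \<Rightarrow> nat list \<Rightarrow> 'r" where
  "translate N [] p [] = p []"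
| "translate N [] p (i # ks) = 0"
| "translate N (z # zs) p [] = 0"
| "translate N (z # zs) p (i # ks) =
     (\<Sum>s\<le>N. of_nat (s choose i) * z ^ (s - i) * translate N zs (\<lambda>js. p (s # js)) ks)"

lemma translate_eq_0_length: "length \<beta> \<noteq> length zs \<Longrightarrow> translate N zs p \<beta> = 0"
  by (induction N zs p \<beta> rule: translate.induct) auto

lemma translate_cong:
  assumes "\<And>js. length js = length zs \<Longrightarrow> p js = p' js"
  shows "translate N zs p \<beta> = translate N zs p' \<beta>"
  using assms
proof (induction zs arbitrary: p p' \<beta>)
  case Nil
  then show ?case by (cases \<beta>) auto
next
  case (Cons z zs)
  show ?case
  proof (cases \<beta>)
    case (Cons i ks)
    have "translate N zs (\<lambda>js. p (s # js)) ks = translate N zs (\<lambda>js. p' (s # js)) ks" for s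
      by (rule Cons.IH) (simp add: Cons.prems)
    then show ?thesis by (simp add: Cons)
  qed simp
qed

lemma translate_sum:
  "translate N zs (\<lambda>js. \<Sum>x\<in>A. c x * f x js) ks = (\<Sum>x\<in>A. c x * translate N zs (f x) ks)"
proof (induction zs arbitrary: f ks)
  case Nil
  then show ?case by (cases ks) auto
next
  case (Cons z zs)
  show ?case
  proof (cases ks)
    case (Cons i ks')
    show ?thesis
      unfolding Cons translate.simps Cons.IH sum_distrib_left
      by (subst sum.swap) (simp add: mult_ac)
  qed simp
qed

lemma translate_0_fun [simp]: "translate N zs (\<lambda>_. 0) ks = 0"
  using translate_sum[of N zs "\<lambda>_. 0" "\<lambda>_ _. 0" "{} :: nat set" ks] by simp

lemma translate_diff: "translate N zs (\<lambda>js. f js - g js) ks = translate N zs f ks - translate N zs g ks"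
  using translate_sum[of N zs "\<lambda>x. if x then 1 else -1" "\<lambda>x. if x then f else g" "UNIV :: bool set" ks]
  by (simp add: UNIV_bool)

text \<open>
  This is Taylor expansion of \<open>X\<^sup>s\<close> at \<open>z + w\<close> in two steps, the one-variable case of
  \<open>translate_translate\<close>.
\<close>

lemma binomial_convolution:
  fixes z w :: "'r::comm_ring_1"
  assumes "s \<le> N"
  shows "(\<Sum>i\<le>N. of_nat (i choose h) * z ^ (i - h) * (of_nat (s choose i) * w ^ (s - i)))
       = of_nat (s choose h) * (z + w) ^ (s - h)"
proof (cases "h \<le> s")
  case False
  have "(i choose h) * (s choose i) = 0" for i
    using False by (cases "i < h") (auto simp: binomial_eq_0)
  then have "of_nat (i choose h) * of_nat (s choose i) = (0::'r)" for i
    by (metis of_nat_0 of_nat_mult)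
  then have "of_nat (i choose h) * z ^ (i - h) * (of_nat (s choose i) * w ^ (s - i)) = 0" for i
    by (metis (no_types, lifting) mult.assoc mult.commute mult_zero_left)
  then show ?thesis using False by (simp add: binomial_eq_0)
next
  case True
  let ?f = "\<lambda>i. of_nat (i choose h) * z ^ (i - h) * (of_nat (s choose i) * w ^ (s - i)) :: 'r"
  have "(\<Sum>i\<le>N. ?f i) = (\<Sum>i\<in>{h..s}. ?f i)"
    by (rule sum.mono_neutral_right) (use assms in \<open>auto simp: not_le binomial_eq_0\<close>)
  also have "\<dots> = (\<Sum>j\<le>s-h. ?f (h + j))"
    by (rule sum.reindex_bij_witness[of _ "\<lambda>j. h + j" "\<lambda>i. i - h"]) (use True in auto)
  also have "\<dots> = (\<Sum>j\<le>s-h. of_nat (s choose h) * (of_nat ((s-h) choose j) * z ^ j * w ^ (s - h - j)))"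
  proof (rule sum.cong[OF refl])
    fix j assume "j \<in> {..s-h}"
    then have "(s choose (h+j)) * ((h+j) choose h) = (s choose h) * ((s-h) choose j)"
      using choose_mult[of h "h+j" s] True by simp
    then have "of_nat (s choose (h+j)) * of_nat ((h+j) choose h) = (of_nat (s choose h) * of_nat ((s-h) choose j) :: 'r)"
      by (metis of_nat_mult)
    then show "?f (h + j) = of_nat (s choose h) * (of_nat ((s-h) choose j) * z ^ j * w ^ (s - h - j))"
      by (simp add: mult_ac) (metis (no_types, opaque_lifting) mult.assoc)
  qed
  also have "\<dots> = of_nat (s choose h) * (z + w) ^ (s - h)"
    by (simp add: sum_distrib_left binomial_ring)
  finally show ?thesis .
qed

lemma translate_translate:
  assumes "length zs = length ws"
  shows "translate N zs (translate N ws p) \<beta> = translate N (map2 (+) zs ws) p \<beta>"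
  using assms
proof (induction zs ws arbitrary: p \<beta> rule: list_induct2)
  case Nil
  then show ?case by (cases \<beta>) auto
next
  case (Cons z zs w ws)
  show ?case
  proof (cases \<beta>)
    case (Cons h hs)
    let ?g = "\<lambda>s. translate N zs (translate N ws (\<lambda>js. p (s # js))) hs"
    have "translate N (z # zs) (translate N (w # ws) p) (h # hs) =
       (\<Sum>i\<le>N. of_nat (i choose h) * z ^ (i - h) * (\<Sum>s\<le>N. of_nat (s choose i) * w ^ (s - i) * ?g s))"
      by (simp add: translate_sum)
    also have "\<dots> = (\<Sum>s\<le>N. (\<Sum>i\<le>N. of_nat (i choose h) * z ^ (i - h) * (of_nat (s choose i) * w ^ (s - i))) * ?g s)"
      unfolding sum_distrib_left sum_distrib_right
      by (subst sum.swap) (simp add: mult_ac)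
    also have "\<dots> = (\<Sum>s\<le>N. of_nat (s choose h) * (z + w) ^ (s - h) * ?g s)"
      by (intro sum.cong refl arg_cong2[where f="(*)"] binomial_convolution) auto
    finally show ?thesis by (simp add: Cons Cons.IH)
  qed simp
qed

lemma translate_zero_shift:
  assumes "\<And>\<beta>. length \<beta> = b \<Longrightarrow> p \<beta> \<noteq> 0 \<Longrightarrow> sum_list \<beta> \<le> N" "length \<beta> = b"
  shows "translate N (replicate b 0) p \<beta> = p \<beta>"
  using assms
proof (induction b arbitrary: p \<beta>)
  case 0
  then show ?case by simp
next
  case (Suc b)
  obtain i ks where \<beta>: "\<beta> = i # ks" "length ks = b" using Suc.prems(2) by (cases \<beta>) auto
  have IH: "translate N (replicate b 0) (\<lambda>js. p (s # js)) ks = p (s # ks)" for s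
  proof (rule Suc.IH)
    fix js assume "length js = b" "p (s # js) \<noteq> 0"
    then show "sum_list js \<le> N" using Suc.prems(1)[of "s # js"] by simp
  qed (use \<beta> in simp)
  have "translate N (replicate (Suc b) 0) p \<beta> = (\<Sum>s\<le>N. of_nat (s choose i) * 0 ^ (s - i) * p (s # ks))"
    by (simp add: \<beta> IH)
  also have "\<dots> = (\<Sum>s\<le>N. if s = i then p (s # ks) else 0)"
    by (rule sum.cong) (auto simp: power_0_left binomial_eq_0)
  also have "\<dots> = p \<beta>"
    using Suc.prems(1)[of \<beta>] Suc.prems(2) \<beta> by (cases "i \<le> N") force+
  finally show ?case .
qed

text \<open>
  Translation by \<open>z\<close> is undone by translation by \<open>-z\<close>, so it loses no information.
\<close>

lemma translate_eq_0_imp: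
  assumes "\<And>\<beta>. length \<beta> = length zs \<Longrightarrow> p \<beta> \<noteq> 0 \<Longrightarrow> sum_list \<beta> \<le> N"
    and "\<And>\<beta>. length \<beta> = length zs \<Longrightarrow> translate N zs p \<beta> = 0" and "length \<beta> = length zs"
  shows "p \<beta> = 0"
proof -
  have *: "map2 (+) (map uminus zs) zs = replicate (length zs) 0"
    by (induction zs) auto
  have "p \<beta> = translate N (map uminus zs) (translate N zs p) \<beta>"
    using translate_zero_shift[of "length zs" p N \<beta>] assms * by (simp add: translate_translate)
  also have "\<dots> = translate N (map uminus zs) (\<lambda>_. 0) \<beta>"
    by (rule translate_cong) (simp add: assms)
  finally show ?thesis by simp
qed

lemma coeff_linear_power: "poly.coeff ([:c, 1:] ^ s) i = of_nat (s choose i) * (c::'r::comm_ring_1) ^ (s - i)"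
  by (cases "i \<le> s") (simp_all add: coeff_linear_poly_power coeff_eq_0 degree_linear_power binomial_eq_0)

lemma sum_orders_le_degree:
  fixes Q :: "'r::idom poly"
  assumes "finite G" "Q \<noteq> 0"
  shows "(\<Sum>c\<in>G. order c Q) \<le> degree Q"
proof -
  have "(\<Sum>c\<in>G. order c Q) = (\<Sum>c\<in>G. count (proots Q) c)" using assms by simp
  also have "\<dots> = (\<Sum>c\<in>G \<inter> set_mset (proots Q). count (proots Q) c)"
    by (rule sum.mono_neutral_right) (use assms in \<open>auto simp: order_root\<close>)
  also have "\<dots> \<le> (\<Sum>c\<in>set_mset (proots Q). count (proots Q) c)"
    by (rule sum_mono2) auto
  also have "\<dots> \<le> degree Q" using size_proots_le[of Q] by (simp add: size_multiset_overloaded_eq)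
  finally show ?thesis .
qed

text \<open>
  The sums in the hypothesis are the coefficients of \<open>Q(X + c)\<close>; if the first \<open>n\<close> of them vanish, then
  \<open>X\<^sup>n\<close> divides \<open>Q(X + c)\<close>.
\<close>

lemma order_ge_if_shifted_coeffs_0:
  fixes Q :: "'r::idom poly"
  assumes "Q \<noteq> 0" "degree Q \<le> N"
    and "\<And>i. i < n \<Longrightarrow> (\<Sum>s\<le>N. of_nat (s choose i) * c ^ (s - i) * poly.coeff Q s) = 0"
  shows "n \<le> order c Q"
proof -
  have pow: "pcompose (P ^ k) R = pcompose P R ^ k" for P R :: "'r poly" and k
    by (induction k) (simp_all add: pcompose_mult pcompose_1)
  define Q' where "Q' = pcompose Q [:c, 1:]"
  have Q: "Q = (\<Sum>s\<le>N. monom (poly.coeff Q s) s)"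
    using assms(2) by (simp add: poly_as_sum_of_monoms')
  have "Q' = (\<Sum>s\<le>N. Polynomial.smult (poly.coeff Q s) ([:c, 1:] ^ s))"
    unfolding Q'_def by (subst Q) (simp add: pcompose_sum monom_altdef pcompose_smult pow pcompose_pCons)
  then have "poly.coeff Q' i = (\<Sum>s\<le>N. of_nat (s choose i) * c ^ (s - i) * poly.coeff Q s)" for i
    by (simp add: coeff_sum coeff_linear_power mult_ac)
  then have "monom 1 n dvd Q'" using assms(3) by (simp add: monom_1_dvd_iff')
  then obtain K where "Q' = [:0, 1:] ^ n * K" by (auto simp: dvd_def monom_altdef)
  then have "pcompose Q' [:-c, 1:] = [:-c, 1:] ^ n * pcompose K [:-c, 1:]"
    by (simp add: pcompose_mult pow pcompose_pCons)
  moreover have "pcompose Q' [:-c, 1:] = Q"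
    by (simp add: Q'_def pcompose_pCons flip: pcompose_assoc)
  ultimately have "[:-c, 1:] ^ n dvd Q" by simp
  then show ?thesis using assms(1) by (simp add: order_divides)
qed


lemma lists_length_Suc_eq:
  "{zs. set zs \<subseteq> G \<and> length zs = Suc b} = (\<lambda>(c, zs). c # zs) ` (G \<times> {zs. set zs \<subseteq> G \<and> length zs = b})"
  by (auto simp: length_Suc_conv image_iff)

text \<open>
  The multiplicity version of the Schwartz--Zippel lemma on a grid \<open>G\<^sup>b\<close>, for an arbitrary integral
  domain.  Induct on the number of variables: let \<open>t\<close> be the degree in the first variable and
  \<open>p\<^sub>t\<close> the coefficient of its \<open>t\<close>-th power, a nonzero polynomial of degree at most \<open>d - t\<close> in the
  other variables.  If \<open>p\<^sub>t\<close> vanishes to order exactly \<open>r\<close> at \<open>zs\<close>, some Hasse derivative of order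
  \<open>r\<close> turns \<open>p\<close> into a nonzero polynomial \<open>Q\<close> in one variable, of degree \<open>t\<close>, and the order of \<open>p\<close> at
  \<open>(c, zs)\<close> is at most \<open>r\<close> plus the order of \<open>Q\<close> at \<open>c\<close>.  Summing over \<open>c\<close> contributes at most
  \<open>r |G| + t\<close> on each fibre.
\<close>

theorem schwartz_zippel_multiplicity:
  fixes p :: "nat list \<Rightarrow> 'r::idom"
  assumes "finite G" "d \<le> N"
    and "\<And>\<beta>. length \<beta> = b \<Longrightarrow> p \<beta> \<noteq> 0 \<Longrightarrow> sum_list \<beta> \<le> d"
    and "length \<beta>\<^sub>0 = b" "p \<beta>\<^sub>0 \<noteq> 0"
    and "\<And>zs \<beta>. set zs \<subseteq> G \<Longrightarrow> length zs = b \<Longrightarrow> length \<beta> = b \<Longrightarrow> sum_list \<beta> < m zs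
           \<Longrightarrow> translate N zs p \<beta> = 0"
  shows "(\<Sum>zs\<in>{zs. set zs \<subseteq> G \<and> length zs = b}. m zs) * card G \<le> d * card G ^ b"
  using assms(2-)
proof (induction b arbitrary: p d m \<beta>\<^sub>0)
  case 0
  have "m [] = 0"
    using "0.prems"(3,4) "0.prems"(5)[of "[]" "[]"] by (cases "m []") auto
  moreover have "{zs. set zs \<subseteq> G \<and> length zs = 0} = {[]}" by auto
  ultimately show ?case by simp
next
  case (Suc b)
  define A where "A = {s. \<exists>js. length js = b \<and> p (s # js) \<noteq> 0}"
  have A_le: "s \<le> d" if sA: "s \<in> A" for s
  proof -
    obtain js where "length js = b" "p (s # js) \<noteq> 0" using sA by (auto simp: A_def)
    then show ?thesis using Suc.prems(2)[of "s # js"] by simp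
  qed
  then have "finite A" using finite_nat_set_iff_bounded_le by blast
  moreover have "hd \<beta>\<^sub>0 \<in> A"
    using Suc.prems(3,4) by (cases \<beta>\<^sub>0) (auto simp: A_def)
  ultimately have t: "Max A \<in> A" "\<And>s. s \<in> A \<Longrightarrow> s \<le> Max A"
    by (auto intro: Max_in)
  define t where "t = Max A"
  obtain js\<^sub>0 where js\<^sub>0: "length js\<^sub>0 = b" "p (t # js\<^sub>0) \<noteq> 0" using t(1) by (auto simp: A_def t_def)
  have "t \<le> d" using t A_le by (simp add: t_def)
  have top0: "p (s # js) = 0" if "s > t" "length js = b" for s js
    using t(2)[of s] that unfolding t_def A_def by force
  let ?p\<^sub>t = "\<lambda>js. p (t # js)"
  have deg_t: "sum_list js \<le> d - t" if "length js = b" "?p\<^sub>t js \<noteq> 0" for js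
    using Suc.prems(2)[of "t # js"] that by simp
  \<comment> \<open>\<open>r zs\<close> is the exact order of vanishing of \<open>p\<^sub>t\<close> at \<open>zs\<close>.\<close>
  define R where "R zs r \<longleftrightarrow> (\<exists>ks. length ks = b \<and> sum_list ks = r \<and> translate N zs ?p\<^sub>t ks \<noteq> 0)" for zs r
  define r where "r zs = (LEAST r. R zs r)" for zs
  have "\<exists>r. R zs r" if "length zs = b" for zs
  proof (rule ccontr)
    assume "\<nexists>r. R zs r"
    then have "translate N zs ?p\<^sub>t ks = 0" if "length ks = b" for ks using that by (auto simp: R_def)
    then have "?p\<^sub>t js\<^sub>0 = 0"
      by (intro translate_eq_0_imp[of zs ?p\<^sub>t N]) (use that js\<^sub>0 deg_t Suc.prems(1) in force)+
    with js\<^sub>0 show False by simp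
  qed
  then have r: "R zs (r zs)" if "length zs = b" for zs
    unfolding r_def using that by (metis LeastI)
  have r_least: "translate N zs ?p\<^sub>t ks = 0" if "length ks = b" "sum_list ks < r zs" for zs ks
    using not_less_Least[of "sum_list ks" "R zs"] that unfolding r_def R_def by blast
  have IH: "(\<Sum>zs\<in>{zs. set zs \<subseteq> G \<and> length zs = b}. r zs) * card G \<le> (d - t) * card G ^ b"
    by (rule Suc.IH[of "d - t" ?p\<^sub>t js\<^sub>0 r]) (use Suc.prems(1) deg_t js\<^sub>0 r_least in auto)
  have fibre: "(\<Sum>c\<in>G. m (c # zs)) \<le> r zs * card G + t" if zs: "set zs \<subseteq> G" "length zs = b" for zs
  proof -
    obtain ks where ks: "length ks = b" "sum_list ks = r zs" "translate N zs ?p\<^sub>t ks \<noteq> 0"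
      using r[OF zs(2)] by (auto simp: R_def)
    \<comment> \<open>The exponent \<open>ks\<close> names a Hasse derivative of order \<open>r zs\<close> of \<open>p\<^sub>t\<close> that is nonzero at \<open>zs\<close>.\<close>
    define Q where "Q = (\<Sum>s\<le>N. monom (translate N zs (\<lambda>js. p (s # js)) ks) s)"
    have coeff_Q: "poly.coeff Q s = (if s \<le> N then translate N zs (\<lambda>js. p (s # js)) ks else 0)" for s
      by (simp add: Q_def coeff_sum)
    have "poly.coeff Q t \<noteq> 0" using ks \<open>t \<le> d\<close> Suc.prems(1) by (simp add: coeff_Q)
    then have "Q \<noteq> 0" by auto
    have "poly.coeff Q s = 0" if "s > t" for s
    proof -
      have "translate N zs (\<lambda>js. p (s # js)) ks = translate N zs (\<lambda>_. 0) ks"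
        by (rule translate_cong) (use top0 that zs in simp)
      then show ?thesis by (simp add: coeff_Q)
    qed
    then have degQ: "degree Q \<le> t" by (intro degree_le) auto
    have "m (c # zs) \<le> r zs + order c Q" if "c \<in> G" for c
    proof -
      have "m (c # zs) - r zs \<le> order c Q"
      proof (rule order_ge_if_shifted_coeffs_0[OF \<open>Q \<noteq> 0\<close>])
        show "degree Q \<le> N" using degQ \<open>t \<le> d\<close> Suc.prems(1) by simp
        fix i assume "i < m (c # zs) - r zs"
        then have "translate N (c # zs) p (i # ks) = 0"
          using Suc.prems(5)[of "c # zs" "i # ks"] that zs ks by simp
        then show "(\<Sum>s\<le>N. of_nat (s choose i) * c ^ (s - i) * poly.coeff Q s) = 0"
          by (simp add: coeff_Q)
      qed
      then show ?thesis by simp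
    qed
    then have "(\<Sum>c\<in>G. m (c # zs)) \<le> (\<Sum>c\<in>G. r zs + order c Q)" by (rule sum_mono)
    also have "\<dots> = r zs * card G + (\<Sum>c\<in>G. order c Q)" by (simp add: sum.distrib)
    also have "\<dots> \<le> r zs * card G + t"
      using sum_orders_le_degree[OF \<open>finite G\<close> \<open>Q \<noteq> 0\<close>] degQ by simp
    finally show ?thesis .
  qed
  let ?Z = "{zs. set zs \<subseteq> G \<and> length zs = b}"
  have "(\<Sum>zs\<in>{zs. set zs \<subseteq> G \<and> length zs = Suc b}. m zs) = (\<Sum>(c, zs)\<in>G \<times> ?Z. m (c # zs))"
    unfolding lists_length_Suc_eq by (subst sum.reindex) (auto simp: inj_on_def case_prod_unfold)
  also have "\<dots> = (\<Sum>zs\<in>?Z. \<Sum>c\<in>G. m (c # zs))"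
    by (subst sum.swap) (simp add: sum.cartesian_product)
  also have "\<dots> \<le> (\<Sum>zs\<in>?Z. r zs * card G + t)"
    by (rule sum_mono) (use fibre in auto)
  also have "\<dots> = (\<Sum>zs\<in>?Z. r zs) * card G + t * card G ^ b"
    using \<open>finite G\<close> by (simp add: sum.distrib sum_distrib_right card_lists_length_eq)
  also have "\<dots> \<le> (d - t) * card G ^ b + t * card G ^ b" using IH by simp
  also have "\<dots> = d * card G ^ b" using \<open>t \<le> d\<close> by (simp flip: distrib_right)
  finally show ?case by (simp add: mult.commute mult.left_commute)
qed

section \<open>Submodularity of indices of finite subgroups\<close>

text \<open>
  The spaces of polynomials below are finite, so their dimensions are measured by cardinality and it is
  enough to treat them as additive groups.
\<close>

definition add_subgroup :: "'x::ab_group_add set \<Rightarrow> bool" where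
  "add_subgroup A \<longleftrightarrow> 0 \<in> A \<and> (\<forall>x\<in>A. \<forall>y\<in>A. x - y \<in> A)"

lemma add_subgroup_0: "add_subgroup A \<Longrightarrow> 0 \<in> A"
  and add_subgroup_diff: "add_subgroup A \<Longrightarrow> x \<in> A \<Longrightarrow> y \<in> A \<Longrightarrow> x - y \<in> A"
  by (auto simp: add_subgroup_def)

lemma add_subgroup_add: "add_subgroup A \<Longrightarrow> x \<in> A \<Longrightarrow> y \<in> A \<Longrightarrow> x + y \<in> A"
  using add_subgroup_diff[of A x "0 - y"] add_subgroup_diff[of A 0 y] by (simp add: add_subgroup_0)

lemma add_subgroup_Int: "add_subgroup A \<Longrightarrow> add_subgroup B \<Longrightarrow> add_subgroup (A \<inter> B)"
  by (auto simp: add_subgroup_def)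

lemma add_subgroup_INT: "(\<And>i. i \<in> I \<Longrightarrow> add_subgroup (A i)) \<Longrightarrow> add_subgroup (\<Inter>i\<in>I. A i)"
  by (auto simp: add_subgroup_def)

lemma card_eq_card_fibres:
  assumes "finite A" "\<And>y. y \<in> f ` A \<Longrightarrow> card {x \<in> A. f x = y} = c"
  shows "card A = c * card (f ` A)"
proof -
  have "card A = (\<Sum>y\<in>f ` A. card {x \<in> A. f x = y})"
    using sum.image_gen[OF assms(1), of "\<lambda>_. 1::nat" f] by simp
  then show ?thesis using assms(2) by simp
qed

lemma card_fibre_eq_card_kernel:
  fixes f :: "'x::ab_group_add \<Rightarrow> 'y::ab_group_add"
  assumes "add_subgroup A" "\<And>x y. x \<in> A \<Longrightarrow> y \<in> A \<Longrightarrow> f (x - y) = f x - f y" "w \<in> A"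
  shows "card {x \<in> A. f x = f w} = card {x \<in> A. f x = 0}"
proof -
  have plus: "f (x + y) = f x + f y" if "x \<in> A" "y \<in> A" for x y
    using assms(2)[of "x + y" y] that assms(1) by (simp add: add_subgroup_add)
  have "bij_betw (\<lambda>x. x - w) {x \<in> A. f x = f w} {x \<in> A. f x = 0}"
    by (rule bij_betw_byWitness[where f' = "\<lambda>x. x + w"])
       (use assms plus in \<open>auto simp: add_subgroup_diff add_subgroup_add\<close>)
  then show ?thesis by (rule bij_betw_same_card)
qed

lemma card_kernel_times_card_image:
  fixes f :: "'x::ab_group_add \<Rightarrow> 'y::ab_group_add"
  assumes "finite A" "add_subgroup A" "\<And>x y. x \<in> A \<Longrightarrow> y \<in> A \<Longrightarrow> f (x - y) = f x - f y"
  shows "card A = card {x \<in> A. f x = 0} * card (f ` A)"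
  by (rule card_eq_card_fibres) (use assms card_fibre_eq_card_kernel[of A f] in auto)

text \<open>
  Submodularity: intersecting with \<open>N\<close> cuts the smaller group \<open>A\<close> by a factor that is at most the factor
  by which it cuts \<open>B\<close>.  The difference map \<open>A \<times> (B \<inter> N) \<rightarrow> B\<close> has kernel \<open>A \<inter> N\<close>.
\<close>

lemma card_Int_subgroup_le:
  assumes "finite B" "add_subgroup A" "add_subgroup B" "add_subgroup N" "A \<subseteq> B"
  shows "card A * card (B \<inter> N) \<le> card B * card (A \<inter> N)"
proof -
  let ?P = "A \<times> (B \<inter> N)" and ?f = "\<lambda>(x, y). x - y"
  have fin: "finite A" using assms finite_subset by blast
  have "card ?P = card {z \<in> ?P. ?f z = 0} * card (?f ` ?P)"
    by (rule card_kernel_times_card_image)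
       (use assms fin in \<open>auto simp: add_subgroup_def zero_prod_def minus_prod_def\<close>)
  moreover have "{z \<in> ?P. ?f z = 0} = (\<lambda>x. (x, x)) ` (A \<inter> N)" using assms(5) by auto
  then have "card {z \<in> ?P. ?f z = 0} = card (A \<inter> N)" by (simp add: card_image inj_on_def)
  moreover have "?f ` ?P \<subseteq> B" using assms by (auto simp: add_subgroup_diff)
  then have "card (?f ` ?P) \<le> card B" by (rule card_mono[OF assms(1)])
  ultimately show ?thesis by (simp add: card_cartesian_product mult.commute)
qed

text \<open>
  If every \<open>w\<close> lies in exactly \<open>t\<close> of the sets \<open>\<Theta> j\<close>, then the indices of the partial intersections
  multiply to at least the \<open>t\<close>-th power of the index of the full one.  Build up \<open>\<Omega>\<close> one element at a time:
  by submodularity, the new subgroup cuts each partial intersection in which it takes part at least as much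
  as it cuts the full one.
\<close>

lemma fractional_subadditivity:
  fixes N :: "'w \<Rightarrow> 'x::ab_group_add set" and \<Theta> :: "'j \<Rightarrow> 'w set" and X :: "'x set"
  defines "K \<equiv> \<lambda>W. X \<inter> (\<Inter>w\<in>W. N w)"
  assumes "finite X" "add_subgroup X" "\<And>w. w \<in> \<Omega> \<Longrightarrow> add_subgroup (N w)" "finite \<Omega>" "finite J"
    and "\<And>w. w \<in> \<Omega> \<Longrightarrow> card {j \<in> J. w \<in> \<Theta> j} = t"
  shows "(\<Prod>j\<in>J. card (K (\<Theta> j \<inter> \<Omega>))) * card X ^ t \<le> card X ^ card J * card (K \<Omega>) ^ t"
  using \<open>finite \<Omega>\<close> assms(4,7)
proof (induction \<Omega> rule: finite_induct)
  case empty
  then show ?case by (simp add: K_def)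
next
  case (insert w \<Omega>)
  have sub: "add_subgroup (K W)" if "W \<subseteq> insert w \<Omega>" for W
    unfolding K_def using that insert.prems(1) assms(3) by (intro add_subgroup_Int add_subgroup_INT) auto
  have fin: "finite (K W)" for W using assms(2) by (simp add: K_def)
  let ?J = "{j \<in> J. w \<in> \<Theta> j}"
  have 1: "card (K (\<Theta> j \<inter> insert w \<Omega>)) * (if w \<in> \<Theta> j then card (K \<Omega>) else 1)
      \<le> card (K (\<Theta> j \<inter> \<Omega>)) * (if w \<in> \<Theta> j then card (K (insert w \<Omega>)) else 1)" for j
  proof (cases "w \<in> \<Theta> j")
    case True
    have "card (K \<Omega>) * card (K (\<Theta> j \<inter> \<Omega>) \<inter> N w) \<le> card (K (\<Theta> j \<inter> \<Omega>)) * card (K \<Omega> \<inter> N w)"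
      by (rule card_Int_subgroup_le) (use sub fin insert.prems in \<open>auto simp: K_def\<close>)
    moreover have "K (\<Theta> j \<inter> \<Omega>) \<inter> N w = K (\<Theta> j \<inter> insert w \<Omega>)" "K \<Omega> \<inter> N w = K (insert w \<Omega>)"
      using True by (auto simp: K_def)
    ultimately show ?thesis using True by (simp add: mult.commute)
  qed simp
  have pw: "(\<Prod>j\<in>J. if w \<in> \<Theta> j then c else 1) = c ^ t" for c :: nat
  proof -
    have "(\<Prod>j\<in>J. if w \<in> \<Theta> j then c else 1) = (\<Prod>j\<in>?J. c)"
      by (rule prod.mono_neutral_cong_right) (use assms(6) in auto)
    then show ?thesis using insert.prems(2)[of w] by simp
  qed
  have "(\<Prod>j\<in>J. card (K (\<Theta> j \<inter> insert w \<Omega>)) * (if w \<in> \<Theta> j then card (K \<Omega>) else 1))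
      \<le> (\<Prod>j\<in>J. card (K (\<Theta> j \<inter> \<Omega>)) * (if w \<in> \<Theta> j then card (K (insert w \<Omega>)) else 1))"
    by (rule prod_mono) (use 1 in auto)
  then have 2: "(\<Prod>j\<in>J. card (K (\<Theta> j \<inter> insert w \<Omega>))) * card (K \<Omega>) ^ t
      \<le> (\<Prod>j\<in>J. card (K (\<Theta> j \<inter> \<Omega>))) * card (K (insert w \<Omega>)) ^ t"
    by (simp add: prod.distrib pw)
  have IH: "(\<Prod>j\<in>J. card (K (\<Theta> j \<inter> \<Omega>))) * card X ^ t \<le> card X ^ card J * card (K \<Omega>) ^ t"
    by (rule insert.IH) (use insert.prems in auto)
  have "((\<Prod>j\<in>J. card (K (\<Theta> j \<inter> insert w \<Omega>))) * card X ^ t) * card (K \<Omega>) ^ t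
      \<le> ((\<Prod>j\<in>J. card (K (\<Theta> j \<inter> \<Omega>))) * card X ^ t) * card (K (insert w \<Omega>)) ^ t"
    using mult_right_mono[OF 2, of "card X ^ t"] by (simp add: mult_ac)
  also have "\<dots> \<le> (card X ^ card J * card (K \<Omega>) ^ t) * card (K (insert w \<Omega>)) ^ t"
    by (rule mult_right_mono[OF IH]) simp
  finally have "((\<Prod>j\<in>J. card (K (\<Theta> j \<inter> insert w \<Omega>))) * card X ^ t) * card (K \<Omega>) ^ t
      \<le> (card X ^ card J * card (K (insert w \<Omega>)) ^ t) * card (K \<Omega>) ^ t"
    by (simp add: mult_ac)
  moreover have "0 \<in> K \<Omega>" using sub[of \<Omega>] by (simp add: subset_insertI add_subgroup_0)
  then have "card (K \<Omega>) > 0" using fin card_gt_0_iff by blast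
  ultimately show ?case by simp
qed

section \<open>The coefficient ring of polynomials in u\<close>

text \<open>
  Polynomials in the variables \<open>u\<close> have to form a ring, because the coordinates of a shear are linear
  forms in \<open>u\<close>, and an integral domain, because the Schwartz--Zippel lemma is applied over them.  Finitely
  supported functions on monomials provide this.
\<close>

alias lookup = Poly_Mapping.lookup
alias keys = Poly_Mapping.keys
alias single = Poly_Mapping.single

type_synonym 'f upoly = "(nat \<Rightarrow>\<^sub>0 nat) \<Rightarrow>\<^sub>0 'f"

definition mdeg :: "(nat \<Rightarrow>\<^sub>0 nat) \<Rightarrow> nat" where
  "mdeg \<alpha> = (\<Sum>l\<in>keys \<alpha>. lookup \<alpha> l)"

lemma mdeg_add: "mdeg (\<alpha> + \<beta>) = mdeg \<alpha> + mdeg \<beta>"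
  unfolding mdeg_def by (rule setsum_keys_plus_distrib) auto

text \<open>
  Conditions on degrees, orders and occurring variables are all conditions on the monomials of a
  polynomial, so their closure properties are proved once.
\<close>

definition mon_in :: "('k \<Rightarrow> bool) \<Rightarrow> ('k \<Rightarrow>\<^sub>0 'r::zero) set" where
  "mon_in P = {r. \<forall>\<alpha>\<in>keys r. P \<alpha>}"

lemma mon_inI: "(\<And>\<alpha>. lookup r \<alpha> \<noteq> 0 \<Longrightarrow> P \<alpha>) \<Longrightarrow> r \<in> mon_in P"
  by (auto simp: mon_in_def in_keys_iff)

lemma mon_inD: "r \<in> mon_in P \<Longrightarrow> lookup r \<alpha> \<noteq> 0 \<Longrightarrow> P \<alpha>"
  by (auto simp: mon_in_def in_keys_iff)

lemma mon_in_0 [simp]: "0 \<in> mon_in P" by (simp add: mon_in_def)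

lemma mon_in_mono: "r \<in> mon_in P \<Longrightarrow> (\<And>\<alpha>. P \<alpha> \<Longrightarrow> Q \<alpha>) \<Longrightarrow> r \<in> mon_in Q"
  by (auto simp: mon_in_def)

lemma mon_in_add: "r \<in> mon_in P \<Longrightarrow> s \<in> mon_in P \<Longrightarrow> (r + s :: _ \<Rightarrow>\<^sub>0 _::monoid_add) \<in> mon_in P"
  using keys_add[of r s] by (auto simp: mon_in_def)

lemma mon_in_uminus: "r \<in> mon_in P \<Longrightarrow> (- r :: _ \<Rightarrow>\<^sub>0 _::ab_group_add) \<in> mon_in P"
  by (auto simp: mon_in_def in_keys_iff)

lemma mon_in_diff: "r \<in> mon_in P \<Longrightarrow> s \<in> mon_in P \<Longrightarrow> (r - s :: _ \<Rightarrow>\<^sub>0 _::ab_group_add) \<in> mon_in P"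
  using mon_in_add[of r P "- s"] by (simp add: mon_in_uminus)

lemma mon_in_mult:
  fixes r s :: "'k::monoid_add \<Rightarrow>\<^sub>0 'r::semiring_0"
  assumes "r \<in> mon_in P" "s \<in> mon_in Q" "\<And>\<alpha> \<beta>. P \<alpha> \<Longrightarrow> Q \<beta> \<Longrightarrow> T (\<alpha> + \<beta>)"
  shows "r * s \<in> mon_in T"
  using keys_mult[of r s] assms by (fastforce simp: mon_in_def)

lemma mon_in_single: "(c \<noteq> 0 \<Longrightarrow> P \<alpha>) \<Longrightarrow> single \<alpha> c \<in> mon_in P"
  by (auto simp: mon_in_def)

definition Const :: "'f \<Rightarrow> 'f::comm_ring_1 upoly" where
  "Const c = single 0 c"

definition Var :: "nat \<Rightarrow> 'f::comm_ring_1 upoly" where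
  "Var l = single (single l 1) 1"

lemma Const_0 [simp]: "Const 0 = 0" and Const_1 [simp]: "Const 1 = 1"
  and Const_add: "Const (c + d) = Const c + Const d"
  and Const_mult: "Const (c * d) = Const c * Const d"
  by (simp_all add: Const_def single_add mult_single)

lemma Const_of_nat: "Const (of_nat n) = of_nat n"
  by (simp add: Const_def)

lemma Const_power: "Const (c ^ n) = Const c ^ n"
  by (induction n) (simp_all add: Const_mult)

lemma Const_sum: "Const (\<Sum>x\<in>A. f x) = (\<Sum>x\<in>A. Const (f x))"
  by (induction A rule: infinite_finite_induct) (simp_all add: Const_add)

lemma Var_power: "Var l ^ n = single (single l n) 1"
  by (induction n) (simp_all add: Var_def mult_single flip: single_add)

definition shifted_monomial :: "(nat \<Rightarrow> 'f) \<Rightarrow> (nat \<Rightarrow>\<^sub>0 nat) \<Rightarrow> 'f::comm_ring_1 upoly" where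
  "shifted_monomial v \<alpha> = (\<Prod>l\<in>keys \<alpha>. (Var l + Const (v l)) ^ lookup \<alpha> l)"

text \<open>
  The substitution \<open>u \<mapsto> u + v\<close> for a vector \<open>v\<close> of scalars.  Unlike \<open>translate\<close> it is needed as a ring
  homomorphism, so that it commutes with translations in \<open>x\<close>; \<open>lookup_shift\<close> identifies it with
  \<open>translate\<close> on coefficients.
\<close>

definition shift :: "(nat \<Rightarrow> 'f) \<Rightarrow> 'f upoly \<Rightarrow> 'f::comm_ring_1 upoly" where
  "shift v r = (\<Sum>\<alpha>\<in>keys r. Const (lookup r \<alpha>) * shifted_monomial v \<alpha>)"

lemma shifted_monomial_superset:
  assumes "finite A" "keys \<alpha> \<subseteq> A"
  shows "shifted_monomial v \<alpha> = (\<Prod>l\<in>A. (Var l + Const (v l)) ^ lookup \<alpha> l)"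
  unfolding shifted_monomial_def
  by (rule prod.mono_neutral_left) (use assms in \<open>auto simp: in_keys_iff\<close>)

lemma shifted_monomial_0 [simp]: "shifted_monomial v 0 = 1"
  by (simp add: shifted_monomial_def)

lemma shifted_monomial_add: "shifted_monomial v (\<alpha> + \<beta>) = shifted_monomial v \<alpha> * shifted_monomial v \<beta>"
proof -
  let ?A = "keys \<alpha> \<union> keys \<beta>"
  have "keys (\<alpha> + \<beta>) \<subseteq> ?A" by (rule keys_add)
  then show ?thesis
    by (simp add: shifted_monomial_superset[of ?A] lookup_add power_add prod.distrib)
qed

lemma shift_superset:
  assumes "finite A" "keys r \<subseteq> A"
  shows "shift v r = (\<Sum>\<alpha>\<in>A. Const (lookup r \<alpha>) * shifted_monomial v \<alpha>)"
  unfolding shift_def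
  by (rule sum.mono_neutral_left) (use assms in \<open>auto simp: in_keys_iff\<close>)

lemma shift_add: "shift v (r + s) = shift v r + shift v s"
proof -
  let ?A = "keys r \<union> keys s"
  have "keys (r + s) \<subseteq> ?A" by (rule keys_add)
  then show ?thesis
    by (simp add: shift_superset[of ?A] lookup_add Const_add sum.distrib distrib_right)
qed

lemma shift_0 [simp]: "shift v 0 = 0" by (simp add: shift_def)

lemma shift_diff: "shift v (r - s) = shift v r - shift v s"
  using shift_add[of v "r - s" s] by simp

lemma shift_sum: "shift v (\<Sum>x\<in>A. f x) = (\<Sum>x\<in>A. shift v (f x))"
  by (induction A rule: infinite_finite_induct) (simp_all add: shift_add)

lemma shift_single: "shift v (single \<alpha> c) = Const c * shifted_monomial v \<alpha>"
  by (simp add: shift_superset[of "{\<alpha>}"])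

lemma sum_single_lookup: "(\<Sum>\<alpha>\<in>keys r. single \<alpha> (lookup r \<alpha>)) = r"
proof (rule poly_mapping_eqI)
  fix \<beta>
  have "lookup (\<Sum>\<alpha>\<in>keys r. single \<alpha> (lookup r \<alpha>)) \<beta> = (\<Sum>\<alpha>\<in>keys r. if \<alpha> = \<beta> then lookup r \<beta> else 0)"
    unfolding lookup_sum by (rule sum.cong) (auto simp: lookup_single_eq lookup_single_not_eq)
  then show "lookup (\<Sum>\<alpha>\<in>keys r. single \<alpha> (lookup r \<alpha>)) \<beta> = lookup r \<beta>"
    by (simp add: in_keys_iff)
qed

lemma shift_mult: "shift v (r * s) = shift v r * shift v s"
proof -
  have "r * s = (\<Sum>\<alpha>\<in>keys r. single \<alpha> (lookup r \<alpha>)) * (\<Sum>\<beta>\<in>keys s. single \<beta> (lookup s \<beta>))"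
    by (simp only: sum_single_lookup)
  also have "\<dots> = (\<Sum>\<alpha>\<in>keys r. \<Sum>\<beta>\<in>keys s. single (\<alpha> + \<beta>) (lookup r \<alpha> * lookup s \<beta>))"
    by (simp add: sum_product mult_single)
  finally have "shift v (r * s) =
    (\<Sum>\<alpha>\<in>keys r. \<Sum>\<beta>\<in>keys s. (Const (lookup r \<alpha>) * shifted_monomial v \<alpha>) * (Const (lookup s \<beta>) * shifted_monomial v \<beta>))"
    by (simp add: shift_sum shift_single Const_mult shifted_monomial_add mult_ac)
  then show ?thesis by (simp add: shift_def sum_product)
qed

lemma shift_Const [simp]: "shift v (Const c) = Const c"
  by (simp add: Const_def shift_single)

lemma shift_Var [simp]: "shift v (Var l) = Var l + Const (v l)"
proof -
  have "shift v (Var l) = shifted_monomial v (single l 1)" by (simp add: Var_def shift_single)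
  also have "\<dots> = Var l + Const (v l)" by (simp add: shifted_monomial_superset[of "{l}"])
  finally show ?thesis .
qed

lemma shift_power: "shift v (r ^ n) = shift v r ^ n"
  by (induction n) (simp_all add: shift_mult flip: Const_1)

lemma shift_of_nat: "shift v (of_nat n) = of_nat n"
  using shift_Const[of v "of_nat n"] by (simp add: Const_of_nat)

lemma shift_translate:
  "shift v (translate N zs p \<beta>) = translate N (map (shift v) zs) (\<lambda>\<beta>. shift v (p \<beta>)) \<beta>"
  by (induction N zs p \<beta> rule: translate.induct)
     (simp_all add: shift_sum shift_mult shift_power shift_of_nat)

text \<open>
  Expand every factor \<open>(u\<^sub>l + v\<^sub>l)\<^sup>e\<close> and the product of the resulting sums; exactly one choice of
  exponents yields the monomial \<open>\<kappa>\<close>, unless \<open>\<kappa>\<close> exceeds \<open>\<alpha>\<close> somewhere and a binomial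
  coefficient vanishes.
\<close>

lemma lookup_shifted_monomial:
  assumes "keys \<alpha> \<subseteq> {..<a}" "keys \<kappa> \<subseteq> {..<a}"
  shows "lookup (shifted_monomial v \<alpha>) \<kappa>
    = (\<Prod>l<a. of_nat (lookup \<alpha> l choose lookup \<kappa> l) * v l ^ (lookup \<alpha> l - lookup \<kappa> l))"
proof -
  let ?c = "\<lambda>l i. of_nat (lookup \<alpha> l choose i) * v l ^ (lookup \<alpha> l - i)"
  let ?G = "PiE {..<a} (\<lambda>l. {..lookup \<alpha> l})"
  let ?\<kappa> = "restrict (lookup \<kappa>) {..<a}"
  have pow: "(Var l + Const (v l)) ^ n = (\<Sum>i\<le>n. single (single l i) (of_nat (n choose i) * v l ^ (n - i)))" for l n
  proof -
    have "of_nat m * single x 1 * Const w = single x (of_nat m * w)" for m and x :: "nat \<Rightarrow>\<^sub>0 nat" and w :: 'a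
    proof -
      have "of_nat m * single x 1 * Const w = Const (of_nat m) * single x 1 * Const w"
        by (simp only: Const_of_nat)
      also have "\<dots> = single x (of_nat m * w)"
        by (simp only: Const_def mult_single) simp
      finally show ?thesis .
    qed
    then show ?thesis
      unfolding binomial_ring Var_power Const_power[symmetric] by (simp only:)
  qed
  have "shifted_monomial v \<alpha> = (\<Prod>l<a. \<Sum>i\<le>lookup \<alpha> l. single (single l i) (?c l i))"
    using assms(1) by (simp add: shifted_monomial_superset[of "{..<a}"] pow)
  also have "\<dots> = (\<Sum>g\<in>?G. \<Prod>l<a. single (single l (g l)) (?c l (g l)))"
    by (rule prod_sum_PiE) auto
  also have "\<dots> = (\<Sum>g\<in>?G. single (\<Sum>l<a. single l (g l)) (\<Prod>l<a. ?c l (g l)))"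
  proof (rule sum.cong[OF refl])
    fix g
    have "(\<Prod>l\<in>A. single (single l (g l)) (?c l (g l))) = single (\<Sum>l\<in>A. single l (g l)) (\<Prod>l\<in>A. ?c l (g l))"
      if "finite A" for A
      using that by (induction A rule: finite_induct) (simp_all add: mult_single)
    then show "(\<Prod>l<a. single (single l (g l)) (?c l (g l))) = single (\<Sum>l<a. single l (g l)) (\<Prod>l<a. ?c l (g l))"
      by blast
  qed
  finally have *: "lookup (shifted_monomial v \<alpha>) \<kappa> = (\<Sum>g\<in>?G. lookup (single (\<Sum>l<a. single l (g l)) (\<Prod>l<a. ?c l (g l))) \<kappa>)"
    by (simp add: lookup_sum)
  have eq: "(\<Sum>l<a. single l (g l)) = \<kappa> \<longleftrightarrow> g = ?\<kappa>" if "g \<in> ?G" for g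
  proof -
    have l: "lookup (\<Sum>l<a. single l (g l)) x = (if x < a then g x else 0)" for x
    proof -
      have "lookup (\<Sum>l<a. single l (g l)) x = (\<Sum>l<a. if l = x then g x else 0)"
        unfolding lookup_sum by (rule sum.cong) (auto simp: lookup_single_eq lookup_single_not_eq)
      then show ?thesis by simp
    qed
    have k: "lookup \<kappa> x = 0" if "\<not> x < a" for x using assms(2) that by (auto simp: in_keys_iff)
    show ?thesis
    proof
      assume \<kappa>: "(\<Sum>l<a. single l (g l)) = \<kappa>"
      have "g x = ?\<kappa> x" for x
      proof (cases "x < a")
        case True
        then show ?thesis using l[of x] unfolding \<kappa> by simp
      next
        case False
        then show ?thesis using PiE_arb[OF that, of x] by simp
      qed
      then show "g = ?\<kappa>" by blast
    next
      assume g: "g = ?\<kappa>"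
      show "(\<Sum>l<a. single l (g l)) = \<kappa>"
      proof (rule poly_mapping_eqI)
        show "lookup (\<Sum>l<a. single l (g l)) x = lookup \<kappa> x" for x
          unfolding l using k[of x] by (simp add: g)
      qed
    qed
  qed
  have "lookup (shifted_monomial v \<alpha>) \<kappa> = (\<Sum>g\<in>?G. if g = ?\<kappa> then \<Prod>l<a. ?c l (lookup \<kappa> l) else 0)"
    unfolding *
  proof (rule sum.cong[OF refl])
    fix g assume g: "g \<in> ?G"
    show "lookup (single (\<Sum>l<a. single l (g l)) (\<Prod>l<a. ?c l (g l))) \<kappa> = (if g = ?\<kappa> then \<Prod>l<a. ?c l (lookup \<kappa> l) else 0)"
    proof (cases "g = ?\<kappa>")
      case True
      then have "(\<Sum>l<a. single l (g l)) = \<kappa>" using eq[OF g] by blast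
      moreover have "(\<Prod>l<a. ?c l (g l)) = (\<Prod>l<a. ?c l (lookup \<kappa> l))"
        by (rule prod.cong) (simp_all add: True)
      ultimately show ?thesis by (simp only: lookup_single_eq if_P[OF True])
    next
      case False
      then have "(\<Sum>l<a. single l (g l)) \<noteq> \<kappa>" using eq[OF g] by blast
      then show ?thesis by (simp only: lookup_single_not_eq[OF \<open>_ \<noteq> \<kappa>\<close>] if_not_P[OF False])
    qed
  qed
  also have "\<dots> = (if ?\<kappa> \<in> ?G then \<Prod>l<a. ?c l (lookup \<kappa> l) else 0)"
    by (simp add: finite_PiE)
  also have "\<dots> = (\<Prod>l<a. ?c l (lookup \<kappa> l))"
  proof (cases "?\<kappa> \<in> ?G")
    case False
    then obtain l where "l < a" "lookup \<alpha> l < lookup \<kappa> l" by (auto simp: PiE_iff)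
    then have "?c l (lookup \<kappa> l) = 0" by (simp add: binomial_eq_0)
    with \<open>l < a\<close> have "(\<Prod>l<a. ?c l (lookup \<kappa> l)) = 0" by (intro prod_zero) auto
    with False show ?thesis by simp
  qed simp
  finally show ?thesis .
qed

lemma translate_delta:
  assumes "length ks = length vs" "length \<alpha>s = length vs" "\<And>i. i \<in> set \<alpha>s \<Longrightarrow> i \<le> N"
  shows "translate N vs (\<lambda>js. if js = \<alpha>s then 1 else 0) ks
    = (\<Prod>l<length vs. of_nat (\<alpha>s ! l choose ks ! l) * vs ! l ^ (\<alpha>s ! l - ks ! l))"
  using assms
proof (induction vs arbitrary: ks \<alpha>s)
  case Nil
  then show ?case by simp
next
  case (Cons v vs)
  obtain k ks' i \<alpha>s' where [simp]: "ks = k # ks'" "\<alpha>s = i # \<alpha>s'"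
    using Cons.prems by (cases ks; cases \<alpha>s) auto
  have "translate N vs (\<lambda>js. if s = i \<and> js = \<alpha>s' then 1 else 0) ks'
     = (if s = i then translate N vs (\<lambda>js. if js = \<alpha>s' then 1 else 0) ks' else 0)" for s
    by simp
  then have "translate N (v # vs) (\<lambda>js. if js = \<alpha>s then 1 else 0) ks =
     (\<Sum>s\<le>N. of_nat (s choose k) * v ^ (s - k) * (if s = i then translate N vs (\<lambda>js. if js = \<alpha>s' then 1 else 0) ks' else 0))"
    by simp
  also have "\<dots> = (\<Sum>s\<le>N. if s = i then of_nat (i choose k) * v ^ (i - k) * translate N vs (\<lambda>js. if js = \<alpha>s' then 1 else 0) ks' else 0)"
    by (rule sum.cong) auto
  also have "\<dots> = of_nat (i choose k) * v ^ (i - k) * translate N vs (\<lambda>js. if js = \<alpha>s' then 1 else 0) ks'"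
    using Cons.prems by simp
  also have "translate N vs (\<lambda>js. if js = \<alpha>s' then 1 else 0) ks'
     = (\<Prod>l<length vs. of_nat (\<alpha>s' ! l choose ks' ! l) * vs ! l ^ (\<alpha>s' ! l - ks' ! l))"
    by (rule Cons.IH) (use Cons.prems in auto)
  finally show ?case by (simp add: prod.lessThan_Suc_shift del: prod.lessThan_Suc)
qed

lemma nth_map_lookup: "keys \<alpha> \<subseteq> {..<a} \<Longrightarrow> Poly_Mapping.nth (map (lookup \<alpha>) [0..<a]) = \<alpha>"
  by (intro poly_mapping_eqI) (auto simp: nth_default_def in_keys_iff)

text \<open>
  Exponent lists correspond to monomials through \<open>Poly_Mapping.nth\<close>.  The lemma makes the
  Schwartz--Zippel lemma, which speaks of coefficient functions, applicable to ring elements.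
\<close>

lemma lookup_shift:
  fixes r :: "'f::comm_ring_1 upoly"
  assumes "r \<in> mon_in (\<lambda>\<alpha>. keys \<alpha> \<subseteq> {..<a} \<and> mdeg \<alpha> \<le> N)" "length vs = a" "length ks = a"
  shows "lookup (shift (\<lambda>l. vs ! l) r) (Poly_Mapping.nth ks)
       = translate N vs (\<lambda>\<alpha>s. lookup r (Poly_Mapping.nth \<alpha>s)) ks"
proof -
  have key: "lookup (shifted_monomial (\<lambda>l. vs ! l) \<alpha>) (Poly_Mapping.nth ks)
      = translate N vs (\<lambda>\<alpha>s. if Poly_Mapping.nth \<alpha>s = \<alpha> then 1 else 0) ks"
    if \<alpha>: "\<alpha> \<in> keys r" for \<alpha>
  proof -
    have \<alpha>': "keys \<alpha> \<subseteq> {..<a}" "mdeg \<alpha> \<le> N" using assms(1) \<alpha> by (auto simp: mon_in_def)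
    let ?\<alpha>s = "map (lookup \<alpha>) [0..<a]"
    have nth: "Poly_Mapping.nth js = \<alpha> \<longleftrightarrow> js = ?\<alpha>s" if "length js = a" for js
    proof
      assume "Poly_Mapping.nth js = \<alpha>"
      then have "lookup \<alpha> i = js ! i" if "i < a" for i
        using that \<open>length js = a\<close> by (auto simp: nth_default_nth)
      then show "js = ?\<alpha>s" using that by (auto intro: nth_equalityI)
    next
      assume "js = ?\<alpha>s"
      then show "Poly_Mapping.nth js = \<alpha>" using nth_map_lookup[OF \<alpha>'(1)] by simp
    qed
    have le: "lookup \<alpha> l \<le> N" for l
    proof (cases "l \<in> keys \<alpha>")
      case True
      then have "lookup \<alpha> l \<le> mdeg \<alpha>" unfolding mdeg_def by (intro member_le_sum) auto
      with \<alpha>' show ?thesis by simp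
    qed (simp add: in_keys_iff)
    have ks: "keys (Poly_Mapping.nth ks) \<subseteq> {..<a}"
      using assms(3) by (auto simp: in_keys_iff nth_default_def simp del: keys_nth split: if_splits)
    have "translate N vs (\<lambda>\<alpha>s. if Poly_Mapping.nth \<alpha>s = \<alpha> then 1 else 0) ks
        = translate N vs (\<lambda>\<alpha>s. if \<alpha>s = ?\<alpha>s then 1 else 0) ks"
      by (rule translate_cong) (use nth assms in simp)
    also have "\<dots> = (\<Prod>l<a. of_nat (lookup \<alpha> l choose ks ! l) * vs ! l ^ (lookup \<alpha> l - ks ! l))"
      by (subst translate_delta) (use assms le in auto)
    also have "\<dots> = lookup (shifted_monomial (\<lambda>l. vs ! l) \<alpha>) (Poly_Mapping.nth ks)"
      by (subst lookup_shifted_monomial[where a = a])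
         (use \<alpha>' ks assms in \<open>auto simp: nth_default_nth simp del: keys_nth intro!: prod.cong\<close>)
    finally show ?thesis by simp
  qed
  have c: "lookup (Const c * s) \<alpha> = c * lookup s \<alpha>" for c :: 'f and s \<alpha>
    by (simp add: Const_def flip: mult_map_scale_conv_mult) (transfer, auto simp: when_def)
  have "lookup (shift (\<lambda>l. vs ! l) r) (Poly_Mapping.nth ks)
     = (\<Sum>\<alpha>\<in>keys r. lookup r \<alpha> * translate N vs (\<lambda>\<alpha>s. if Poly_Mapping.nth \<alpha>s = \<alpha> then 1 else 0) ks)"
    unfolding shift_def lookup_sum by (rule sum.cong) (auto simp: c key)
  also have "\<dots> = translate N vs (\<lambda>\<alpha>s. \<Sum>\<alpha>\<in>keys r. lookup r \<alpha> * (if Poly_Mapping.nth \<alpha>s = \<alpha> then 1 else 0)) ks"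
    by (simp add: translate_sum)
  also have "(\<lambda>\<alpha>s. \<Sum>\<alpha>\<in>keys r. lookup r \<alpha> * (if Poly_Mapping.nth \<alpha>s = \<alpha> then 1 else 0)) = (\<lambda>\<alpha>s. lookup r (Poly_Mapping.nth \<alpha>s))"
    by (auto simp: in_keys_iff if_distrib cong: if_cong)
  finally show ?thesis .
qed

section \<open>Filtrations and dimension counts\<close>

text \<open>
  Translation by elements of weight one preserves total weight.  Degree bounds, homogeneity and order of
  vanishing in \<open>u\<close> are instances of the filtration \<open>F\<close>; the weight \<open>c\<close> is the total one in \<open>x\<close> and \<open>u\<close>,
  of which the exponents of \<open>x\<close> account for \<open>sum_list \<beta>\<close>.
\<close>

lemma translate_filtration:
  fixes p :: "nat list \<Rightarrow> 'r::comm_ring_1" and F :: "int \<Rightarrow> 'r set"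
  assumes F0: "\<And>i. 0 \<in> F i" and Fadd: "\<And>i x y. x \<in> F i \<Longrightarrow> y \<in> F i \<Longrightarrow> x + y \<in> F i"
    and "\<And>z i x. z \<in> set zs \<Longrightarrow> x \<in> F i \<Longrightarrow> z * x \<in> F (i + 1)"
    and "\<And>\<beta>. length \<beta> = length zs \<Longrightarrow> p \<beta> \<in> F (c - int (sum_list \<beta>))"
    and "length \<beta> = length zs"
  shows "translate N zs p \<beta> \<in> F (c - int (sum_list \<beta>))"
  using assms(3-)
proof (induction zs arbitrary: p \<beta> c)
  case Nil
  then show ?case by simp
next
  case (Cons z zs)
  obtain i ks where \<beta>: "\<beta> = i # ks" "length ks = length zs" using Cons.prems(3) by (cases \<beta>) auto
  have IH: "translate N zs (\<lambda>js. p (s # js)) ks \<in> F (c - int s - int (sum_list ks))" for s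
  proof (rule Cons.IH)
    show "p (s # js) \<in> F (c - int s - int (sum_list js))" if "length js = length zs" for js
      using Cons.prems(2)[of "s # js"] that by (simp add: algebra_simps)
  qed (use Cons.prems \<beta> in auto)
  have pow: "z ^ n * x \<in> F (j + int n)" if "x \<in> F j" for n x j
  proof (induction n)
    case (Suc n)
    have "z * (z ^ n * x) \<in> F (j + int n + 1)" by (rule Cons.prems(1)) (use Suc in auto)
    then show ?case by (simp add: algebra_simps)
  qed (use that in simp)
  have mult: "of_nat n * x \<in> F j" if "x \<in> F j" for n x j
    by (induction n) (use that F0 Fadd in \<open>auto simp: algebra_simps\<close>)
  have sum: "(\<Sum>x\<in>A. f x) \<in> F j" if "\<And>x. x \<in> A \<Longrightarrow> f x \<in> F j" for A :: "nat set" and f j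
    using that by (induction A rule: infinite_finite_induct) (auto simp: F0 Fadd)
  show ?case unfolding \<beta> translate.simps
  proof (rule sum)
    fix s
    let ?t = "translate N zs (\<lambda>js. p (s # js)) ks"
    show "of_nat (s choose i) * z ^ (s - i) * ?t \<in> F (c - int (sum_list (i # ks)))"
    proof (cases "i \<le> s")
      case True
      have "of_nat (s choose i) * (z ^ (s - i) * ?t) \<in> F (c - int s - int (sum_list ks) + int (s - i))"
        by (intro mult pow IH)
      with True show ?thesis by (simp add: algebra_simps)
    qed (simp add: F0 binomial_eq_0)
  qed
qed

text \<open>
  Translation by elements of weight zero changes a polynomial only in lower weight.  Hence the position of
  a flat does not influence the leading form along it.
\<close>

lemma translate_const_filtration:
  fixes p :: "nat list \<Rightarrow> 'r::comm_ring_1" and F :: "int \<Rightarrow> 'r set"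
  assumes F0: "\<And>i. 0 \<in> F i" and Fadd: "\<And>i x y. x \<in> F i \<Longrightarrow> y \<in> F i \<Longrightarrow> x + y \<in> F i"
    and Fmono: "\<And>i j. i \<le> j \<Longrightarrow> F i \<subseteq> F j"
    and "\<And>y i x. y \<in> set ys \<Longrightarrow> x \<in> F i \<Longrightarrow> y * x \<in> F i"
    and "\<And>\<beta>. length \<beta> = length ys \<Longrightarrow> p \<beta> \<in> F (c - int (sum_list \<beta>))"
    and "\<And>\<beta>. length \<beta> = length ys \<Longrightarrow> p \<beta> \<noteq> 0 \<Longrightarrow> sum_list \<beta> \<le> N"
    and "length \<beta> = length ys"
  shows "translate N ys p \<beta> - p \<beta> \<in> F (c - 1 - int (sum_list \<beta>))"
  using assms(4-)
proof (induction ys arbitrary: p \<beta> c)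
  case Nil
  then show ?case by (simp add: F0)
next
  case (Cons y ys)
  obtain i ks where \<beta>: "\<beta> = i # ks" "length ks = length ys" using Cons.prems(4) by (cases \<beta>) auto
  let ?t = "\<lambda>s. translate N ys (\<lambda>js. p (s # js)) ks"
  let ?f = "\<lambda>s. of_nat (s choose i) * y ^ (s - i) * ?t s"
  have P: "p (s # js) \<in> F (c - int s - int (sum_list js))" if "length js = length ys" for s js
    using Cons.prems(2)[of "s # js"] that by (simp add: algebra_simps)
  have small: "sum_list js \<le> N" if "length js = length ys" "p (s # js) \<noteq> 0" for s js
    using Cons.prems(3)[of "s # js"] that by simp
  have IH: "?t s - p (s # ks) \<in> F (c - int s - 1 - int (sum_list ks))" for s
    by (rule Cons.IH) (use Cons.prems P small \<beta> in auto)
  have T: "?t s \<in> F (c - int s - int (sum_list ks))" for s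
  proof (rule translate_filtration[OF F0 Fadd])
    show "z * x \<in> F (i + 1)" if "z \<in> set ys" "x \<in> F i" for z i x
      using Cons.prems(1)[of z x i] that Fmono[of i "i + 1"] by auto
  qed (use P \<beta> in auto)
  have pow: "y ^ n * x \<in> F j" if "x \<in> F j" for n x j
  proof (induction n)
    case (Suc n)
    have "y * (y ^ n * x) \<in> F j" by (rule Cons.prems(1)) (use Suc in auto)
    then show ?case by (simp add: algebra_simps)
  qed (use that in simp)
  have mult: "of_nat n * x \<in> F j" if "x \<in> F j" for n x j
    by (induction n) (use that F0 Fadd in \<open>auto simp: algebra_simps\<close>)
  have sum: "(\<Sum>x\<in>A. f x) \<in> F j" if "\<And>x. x \<in> A \<Longrightarrow> f x \<in> F j" for A :: "nat set" and f j
    using that by (induction A rule: infinite_finite_induct) (auto simp: F0 Fadd)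
  show ?case
  proof (cases "i \<le> N")
    case True
    then have "translate N (y # ys) p \<beta> - p \<beta> = (\<Sum>s\<in>{..N} - {i}. ?f s) + (?t i - p (i # ks))"
      by (simp add: \<beta> sum.remove[of "{..N}" i])
    moreover have "(\<Sum>s\<in>{..N} - {i}. ?f s) \<in> F (c - 1 - int (sum_list \<beta>))"
    proof (rule sum)
      fix s assume s: "s \<in> {..N} - {i}"
      show "?f s \<in> F (c - 1 - int (sum_list \<beta>))"
      proof (cases "i \<le> s")
        case True
        have "of_nat (s choose i) * (y ^ (s - i) * ?t s) \<in> F (c - int s - int (sum_list ks))"
          by (intro mult pow T)
        moreover have "c - int s - int (sum_list ks) \<le> c - 1 - int (sum_list \<beta>)"
          using s True by (auto simp: \<beta>)
        ultimately have "of_nat (s choose i) * (y ^ (s - i) * ?t s) \<in> F (c - 1 - int (sum_list \<beta>))"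
          using Fmono by blast
        then show ?thesis by (simp add: mult.assoc)
      qed (simp add: F0 binomial_eq_0)
    qed
    moreover have "?t i - p (i # ks) \<in> F (c - 1 - int (sum_list \<beta>))"
      using IH[of i] by (simp add: \<beta> algebra_simps)
    ultimately show ?thesis by (simp only: Fadd)
  next
    case False
    then have "p \<beta> = 0" using Cons.prems(3)[of \<beta>] Cons.prems(4) by (auto simp: \<beta>)
    moreover have "translate N (y # ys) p \<beta> = 0"
      using False by (auto simp: \<beta> binomial_eq_0 intro!: sum.neutral)
    ultimately show ?thesis by (simp add: F0)
  qed
qed

lemma card_supported_functions:
  assumes "finite I"
  shows "finite {g :: 'i \<Rightarrow> 'f::{finite,zero}. \<forall>i. i \<notin> I \<longrightarrow> g i = 0}"
    and "card {g :: 'i \<Rightarrow> 'f::{finite,zero}. \<forall>i. i \<notin> I \<longrightarrow> g i = 0} = CARD('f) ^ card I"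
proof -
  let ?G = "{g :: 'i \<Rightarrow> 'f. \<forall>i. i \<notin> I \<longrightarrow> g i = 0}"
  have b: "bij_betw (\<lambda>g. restrict g I) ?G (PiE I (\<lambda>_. UNIV))"
    by (rule bij_betw_byWitness[where f' = "\<lambda>g i. if i \<in> I then g i else 0"]) 
       (auto simp: fun_eq_iff PiE_iff extensional_def)
  show "finite ?G" using bij_betw_finite[OF b] assms by (simp add: finite_PiE)
  show "card ?G = CARD('f) ^ card I"
    using bij_betw_same_card[OF b] assms by (simp add: card_PiE)
qed

text \<open>
  Each linear condition with values in the field reduces the size of a space at most by the factor
  \<open>q\<close>.
\<close>

lemma card_le_card_kernel_conditions:
  fixes A :: "'x::ab_group_add set" and \<Phi> :: "'x \<Rightarrow> 'i \<Rightarrow> 'f::{finite,ab_group_add}"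
  assumes "finite A" "add_subgroup A" "finite I"
    and "\<And>x y i. x \<in> A \<Longrightarrow> y \<in> A \<Longrightarrow> i \<in> I \<Longrightarrow> \<Phi> (x - y) i = \<Phi> x i - \<Phi> y i"
  shows "card A \<le> card {x \<in> A. \<forall>i\<in>I. \<Phi> x i = 0} * CARD('f) ^ card I"
proof -
  let ?\<Psi> = "\<lambda>x i. if i \<in> I then \<Phi> x i else 0"
  have "card A = card {x \<in> A. ?\<Psi> x = 0} * card (?\<Psi> ` A)"
    by (rule card_kernel_times_card_image) (use assms in \<open>auto simp: fun_eq_iff\<close>)
  moreover have "{x \<in> A. ?\<Psi> x = 0} = {x \<in> A. \<forall>i\<in>I. \<Phi> x i = 0}" by (auto simp: fun_eq_iff)
  moreover have "card (?\<Psi> ` A) \<le> card {g :: 'i \<Rightarrow> 'f. \<forall>i. i \<notin> I \<longrightarrow> g i = 0}"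
    by (rule card_mono) (use card_supported_functions(1)[OF assms(3)] in auto)
  ultimately show ?thesis by (simp add: card_supported_functions(2)[OF assms(3)])
qed

text \<open>
  Prepending the slack \<open>e - 1 - sum_list l\<close> turns the inequality into an equation for lists of length
  \<open>k + 1\<close>.
\<close>

lemma card_lists_sum_less: "card {l :: nat list. length l = k \<and> sum_list l < e} = (e + k - 1) choose k"
  if "k > 0"
proof (cases e)
  case (Suc e')
  have "bij_betw (\<lambda>l. (e' - sum_list l) # l) {l :: nat list. length l = k \<and> sum_list l < e}
      {l. length l = Suc k \<and> sum_list l = e'}"
    by (rule bij_betw_byWitness[where f' = tl]) (auto simp: Suc length_Suc_conv)
  then have "card {l :: nat list. length l = k \<and> sum_list l < e} = (e' + k) choose e'"
    by (simp add: bij_betw_same_card card_length_sum_list)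
  then show ?thesis by (simp add: Suc binomial_symmetric[of e' "e' + k"])
qed (use that in \<open>simp add: binomial_eq_0\<close>)

definition exponents :: "nat \<Rightarrow> nat \<Rightarrow> nat \<Rightarrow> (nat list \<times> (nat \<Rightarrow>\<^sub>0 nat)) set" where
  "exponents b a e = {(\<beta>, \<alpha>). length \<beta> = b \<and> keys \<alpha> \<subseteq> {..<a} \<and> sum_list \<beta> + mdeg \<alpha> < e}"

lemma mdeg_eq_sum:
  assumes "keys \<alpha> \<subseteq> {..<a}"
  shows "mdeg \<alpha> = (\<Sum>l<a. lookup \<alpha> l)"
  unfolding mdeg_def by (rule sum.mono_neutral_left) (use assms in \<open>auto simp: in_keys_iff\<close>)

lemma keys_nth_subset: "length ks = a \<Longrightarrow> keys (Poly_Mapping.nth ks) \<subseteq> {..<a}"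
  by (auto simp: in_keys_iff nth_default_def simp del: keys_nth split: if_splits)

lemma mdeg_nth: "mdeg (Poly_Mapping.nth ks) = sum_list ks"
proof -
  have "mdeg (Poly_Mapping.nth ks) = (\<Sum>l<length ks. lookup (Poly_Mapping.nth ks) l)"
    by (rule mdeg_eq_sum) (simp add: keys_nth_subset del: keys_nth)
  also have "\<dots> = (\<Sum>l<length ks. ks ! l)"
    by (rule sum.cong) (auto simp: nth_default_nth)
  finally show ?thesis by (simp add: sum_list_sum_nth atLeast0LessThan)
qed

lemma bij_betw_exponents:
  "bij_betw (\<lambda>(\<beta>, \<alpha>). \<beta> @ map (lookup \<alpha>) [0..<a]) (exponents b a e)
     {l :: nat list. length l = b + a \<and> sum_list l < e}"
proof (rule bij_betw_byWitness[where f' = "\<lambda>l. (take b l, Poly_Mapping.nth (drop b l))"])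
  have sum: "sum_list (map (lookup \<alpha>) [0..<a]) = mdeg \<alpha>" if "keys \<alpha> \<subseteq> {..<a}" for \<alpha>
    using mdeg_eq_sum[OF that] by (simp add: interv_sum_list_conv_sum_set_nat atLeast0LessThan)
  show "(\<lambda>(\<beta>, \<alpha>). \<beta> @ map (lookup \<alpha>) [0..<a]) ` exponents b a e \<subseteq> {l. length l = b + a \<and> sum_list l < e}"
    by (auto simp: exponents_def sum)
  show "\<forall>x\<in>exponents b a e. (\<lambda>l. (take b l, Poly_Mapping.nth (drop b l))) ((\<lambda>(\<beta>, \<alpha>). \<beta> @ map (lookup \<alpha>) [0..<a]) x) = x"
    by (auto simp: exponents_def nth_map_lookup)
  have nth': "map (lookup (Poly_Mapping.nth ks)) [0..<a] = ks" if "length ks = a" for ks :: "nat list"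
    using that by (auto intro!: nth_equalityI simp: nth_default_nth)
  show "\<forall>l\<in>{l. length l = b + a \<and> sum_list l < e}. (\<lambda>(\<beta>, \<alpha>). \<beta> @ map (lookup \<alpha>) [0..<a]) (take b l, Poly_Mapping.nth (drop b l)) = l"
    by (auto simp: nth' simp del: lookup_nth)
  have "sum_list (take b l) + sum_list (drop b l) = sum_list l" for l :: "nat list"
    by (simp flip: sum_list_append)
  moreover have "keys (Poly_Mapping.nth (drop b l)) \<subseteq> {..<a}" if "length l = b + a" for l :: "nat list"
    by (rule keys_nth_subset) (use that in simp)
  ultimately show "(\<lambda>l. (take b l, Poly_Mapping.nth (drop b l))) ` {l. length l = b + a \<and> sum_list l < e} \<subseteq> exponents b a e"
    unfolding exponents_def image_subset_iff mem_Collect_eq case_prod_conv mdeg_nth by simp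
qed

lemma finite_exponents: "finite (exponents b a e)"
proof -
  have "finite {l :: nat list. set l \<subseteq> {..<e} \<and> length l = b + a}" by (simp add: finite_lists_length_eq)
  moreover have "{l :: nat list. length l = b + a \<and> sum_list l < e} \<subseteq> {l. set l \<subseteq> {..<e} \<and> length l = b + a}"
    using member_le_sum_list by fastforce
  ultimately show ?thesis using bij_betw_finite[OF bij_betw_exponents] finite_subset by blast
qed

lemma card_exponents: "b + a > 0 \<Longrightarrow> card (exponents b a e) = (e + (b + a) - 1) choose (b + a)"
  using bij_betw_same_card[OF bij_betw_exponents[of a b e]] card_lists_sum_less[of "b + a" e] by simp

lemma exponents_mono: "e \<le> e' \<Longrightarrow> exponents b a e \<subseteq> exponents b a e'"
  by (auto simp: exponents_def)

section \<open>Polynomials in x and u, and linear forms\<close>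

text \<open>
  The bound of \<open>Deg\<close> is strict and an integer: in total degree below \<open>e\<close>, the coefficient of \<open>x\<^sup>\<beta>\<close> has degree
  below \<open>e - |\<beta>|\<close>; when this is not positive, the coefficient is zero.
\<close>

definition Deg :: "nat \<Rightarrow> int \<Rightarrow> 'f::comm_ring_1 upoly set" where
  "Deg a n = mon_in (\<lambda>\<alpha>. keys \<alpha> \<subseteq> {..<a} \<and> int (mdeg \<alpha>) < n)"
definition Homog :: "nat \<Rightarrow> int \<Rightarrow> 'f::comm_ring_1 upoly set" where
  "Homog a n = mon_in (\<lambda>\<alpha>. keys \<alpha> \<subseteq> {..<a} \<and> int (mdeg \<alpha>) = n)"
definition Ord :: "int \<Rightarrow> 'f::comm_ring_1 upoly set" where
  "Ord m = mon_in (\<lambda>\<alpha>. m \<le> int (mdeg \<alpha>))"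

lemma Deg_0 [simp]: "0 \<in> Deg a n" and Homog_0 [simp]: "0 \<in> Homog a n" and Ord_0 [simp]: "0 \<in> Ord m"
  by (simp_all add: Deg_def Homog_def Ord_def)

lemma Deg_add: "r \<in> Deg a n \<Longrightarrow> s \<in> Deg a n \<Longrightarrow> r + s \<in> Deg a n"
  and Homog_add: "r \<in> Homog a n \<Longrightarrow> s \<in> Homog a n \<Longrightarrow> r + s \<in> Homog a n"
  and Ord_add: "r \<in> Ord m \<Longrightarrow> s \<in> Ord m \<Longrightarrow> r + s \<in> Ord m"
  and Deg_diff: "r \<in> Deg a n \<Longrightarrow> s \<in> Deg a n \<Longrightarrow> r - s \<in> Deg a n"
  and Ord_diff: "r \<in> Ord m \<Longrightarrow> s \<in> Ord m \<Longrightarrow> r - s \<in> Ord m"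
  by (simp_all add: Deg_def Homog_def Ord_def mon_in_add mon_in_diff)

lemma Deg_mono: "r \<in> Deg a m \<Longrightarrow> m \<le> n \<Longrightarrow> r \<in> Deg a n"
  unfolding Deg_def by (erule mon_in_mono) auto

lemma Deg_nonpos: "r \<in> Deg a n \<Longrightarrow> n \<le> 0 \<Longrightarrow> r = 0"
  by (rule poly_mapping_eqI) (force simp: Deg_def dest: mon_inD)

lemma Homog_imp_Deg: "r \<in> Homog a m \<Longrightarrow> m < n \<Longrightarrow> r \<in> Deg a n"
  unfolding Deg_def Homog_def by (erule mon_in_mono) auto

lemma Homog_imp_Ord: "r \<in> Homog a m \<Longrightarrow> n \<le> m \<Longrightarrow> r \<in> Ord n"
  unfolding Ord_def Homog_def by (erule mon_in_mono) auto

lemma keys_plus_subset: "keys \<alpha> \<subseteq> A \<Longrightarrow> keys \<beta> \<subseteq> A \<Longrightarrow> keys (\<alpha> + \<beta> :: nat \<Rightarrow>\<^sub>0 nat) \<subseteq> A"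
  using keys_add[of \<alpha> \<beta>] by blast

lemma mdeg_0 [simp]: "mdeg 0 = 0" and mdeg_single [simp]: "mdeg (single l n) = n"
  by (simp_all add: mdeg_def)

lemma Deg_mult: "r \<in> Deg a m \<Longrightarrow> s \<in> Deg a n \<Longrightarrow> r * s \<in> Deg a (m + n - 1)"
  unfolding Deg_def Homog_def by (rule mon_in_mult, assumption, assumption) (simp add: mdeg_add keys_plus_subset)

lemma Homog_mult: "r \<in> Homog a m \<Longrightarrow> s \<in> Homog a n \<Longrightarrow> r * s \<in> Homog a (m + n)"
  unfolding Deg_def Homog_def by (rule mon_in_mult, assumption, assumption) (simp add: mdeg_add keys_plus_subset)

lemma Ord_mult: "r \<in> Ord m \<Longrightarrow> s \<in> Ord n \<Longrightarrow> r * s \<in> Ord (m + n)"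
  unfolding Ord_def by (rule mon_in_mult, assumption, assumption) (simp add: mdeg_add)

lemma Const_in_Deg: "Const c \<in> Deg a 1"
  by (simp add: Const_def Deg_def mon_in_single)

definition linear_form :: "nat \<Rightarrow> 'f::field vec \<Rightarrow> 'f upoly" where
  "linear_form a c = (\<Sum>l<a. Const (c $ l) * Var l)"

lemma linear_form_in_Homog: "linear_form a c \<in> Homog a 1"
proof -
  have "(\<Sum>l\<in>A. Const (c $ l) * Var l) \<in> Homog a 1" if "A \<subseteq> {..<a}" for A
    using finite_subset[OF that finite_lessThan] that
  proof (induction A rule: finite_induct)
    case (insert l A)
    have "Const (c $ l) * Var l \<in> Homog a 1"
      using insert.prems by (simp add: Const_def Var_def mult_single Homog_def mon_in_single)
    with insert show ?case by (simp add: Homog_add)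
  qed simp
  then show ?thesis unfolding linear_form_def by blast
qed

lemma lookup_linear_form: "l < a \<Longrightarrow> lookup (linear_form a c) (single l 1) = c $ l"
proof -
  assume l: "l < a"
  have "single x (Suc 0) = single l (Suc 0) \<longleftrightarrow> x = l" for x
    by (metis lookup_single_eq lookup_single_not_eq nat.simps(3))
  then have inj: "lookup (single (single x (Suc 0)) r) (single l (Suc 0)) = (if x = l then r else 0)" for x and r :: 'a
    by (metis lookup_single_eq lookup_single_not_eq)
  have "lookup (linear_form a c) (single l 1) = (\<Sum>l'<a. if l' = l then c $ l else 0)"
    unfolding linear_form_def lookup_sum
    by (rule sum.cong) (auto simp: Const_def Var_def mult_single inj)
  then show ?thesis using l by simp
qed

lemma inj_on_linear_form: "inj_on (linear_form a) (carrier_vec a)"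
  by (rule inj_onI, rule eq_vecI) (auto simp flip: lookup_linear_form[of _ a])

lemma bij_betw_vec_of_list:
  "bij_betw vec_of_list {zs. set zs \<subseteq> (UNIV :: 'f set) \<and> length zs = a} (carrier_vec a :: 'f vec set)"
  by (rule bij_betw_byWitness[where f' = list_of_vec]) (auto simp: vec_list list_vec intro!: carrier_vecI)

lemma card_carrier_vec: "card (carrier_vec a :: 'f::finite vec set) = CARD('f) ^ a"
  and finite_carrier_vec: "finite (carrier_vec a :: 'f::finite vec set)"
  using bij_betw_same_card[OF bij_betw_vec_of_list[where 'f = 'f and a = a]] card_lists_length_eq[of "UNIV :: 'f set" a]
    bij_betw_finite[OF bij_betw_vec_of_list[where 'f = 'f and a = a]] finite_lists_length_eq[of "UNIV :: 'f set" a]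
  by simp_all

text \<open>
  The coordinates of \<open>C u\<close> as elements of the coefficient ring.  Translation by them is the shear
  \<open>x \<mapsto> x + C u\<close>.
\<close>

definition linear_forms :: "'f::field mat \<Rightarrow> 'f upoly list" where
  "linear_forms C = map (\<lambda>i. linear_form (dim_col C) (row C i)) [0..<dim_row C]"

lemma length_linear_forms [simp]: "C \<in> carrier_mat b a \<Longrightarrow> length (linear_forms C) = b"
  by (simp add: linear_forms_def)

lemma linear_forms_in_Homog: "C \<in> carrier_mat b a \<Longrightarrow> z \<in> set (linear_forms C) \<Longrightarrow> z \<in> Homog a 1"
  using linear_form_in_Homog by (auto simp: linear_forms_def)

lemma linear_forms_in_Deg: "C \<in> carrier_mat b a \<Longrightarrow> z \<in> set (linear_forms C) \<Longrightarrow> z \<in> Deg a 2"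
  by (rule Homog_imp_Deg[OF linear_forms_in_Homog]) auto

lemma linear_forms_in_Ord: "C \<in> carrier_mat b a \<Longrightarrow> z \<in> set (linear_forms C) \<Longrightarrow> z \<in> Ord 1"
  by (rule Homog_imp_Ord[OF linear_forms_in_Homog]) auto

lemma linear_form_add:
  "dim_vec c = a \<Longrightarrow> dim_vec c' = a \<Longrightarrow> linear_form a (c + c') = linear_form a c + linear_form a c'"
  by (simp add: linear_form_def Const_add sum.distrib distrib_right)

lemma linear_forms_add:
  assumes "C \<in> carrier_mat b a" "C' \<in> carrier_mat b a"
  shows "map2 (+) (linear_forms C) (linear_forms C') = linear_forms (C + C')"
proof (rule nth_equalityI)
  fix i assume "i < length (map2 (+) (linear_forms C) (linear_forms C'))"
  with assms have "i < b" by simp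
  moreover have "row (C + C') i = row C i + row C' i" using assms \<open>i < b\<close> by (intro eq_vecI) auto
  ultimately show "map2 (+) (linear_forms C) (linear_forms C') ! i = linear_forms (C + C') ! i"
    using assms by (simp add: linear_forms_def linear_form_add)
qed (use assms length_linear_forms[of "C + C'" b a] in simp)

lemma translate_Deg:
  assumes "\<And>z. z \<in> set zs \<Longrightarrow> z \<in> Deg a 2"
    and "\<And>\<beta>. length \<beta> = length zs \<Longrightarrow> P \<beta> \<in> Deg a (c - int (sum_list \<beta>))" "length \<beta> = length zs"
  shows "translate N zs P \<beta> \<in> Deg a (c - int (sum_list \<beta>))"
proof (rule translate_filtration[of "Deg a"])
  show "z * x \<in> Deg a (i + 1)" if "z \<in> set zs" "x \<in> Deg a i" for z i x
    using Deg_mult[of z a 2 x i] assms(1)[of z] that by (simp add: add.commute)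
qed (use assms in \<open>auto simp: Deg_add\<close>)

lemma translate_Homog:
  assumes "\<And>z. z \<in> set zs \<Longrightarrow> z \<in> Homog a 1"
    and "\<And>\<beta>. length \<beta> = length zs \<Longrightarrow> P \<beta> \<in> Homog a (c - int (sum_list \<beta>))" "length \<beta> = length zs"
  shows "translate N zs P \<beta> \<in> Homog a (c - int (sum_list \<beta>))"
proof (rule translate_filtration[of "Homog a"])
  show "z * x \<in> Homog a (i + 1)" if "z \<in> set zs" "x \<in> Homog a i" for z i x
    using Homog_mult[of z a 1 x i] assms(1)[of z] that by (simp add: add.commute)
qed (use assms in \<open>auto simp: Homog_add\<close>)

lemma translate_Ord:
  assumes "\<And>z. z \<in> set zs \<Longrightarrow> z \<in> Ord 1"
    and "\<And>\<beta>. length \<beta> = length zs \<Longrightarrow> P \<beta> \<in> Ord (c - int (sum_list \<beta>))" "length \<beta> = length zs"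
  shows "translate N zs P \<beta> \<in> Ord (c - int (sum_list \<beta>))"
proof (rule translate_filtration[of Ord])
  show "z * x \<in> Ord (i + 1)" if "z \<in> set zs" "x \<in> Ord i" for z i x
    using Ord_mult[of z 1 x i] assms(1)[of z] that by (simp add: add.commute)
qed (use assms in \<open>auto simp: Ord_add\<close>)

lemma translate_Const_Deg:
  assumes "\<And>\<beta>. length \<beta> = length ys \<Longrightarrow> P \<beta> \<in> Deg a (int e - int (sum_list \<beta>))"
    and "length \<beta> = length ys" "e \<le> N"
  shows "translate N (map Const ys) P \<beta> - P \<beta> \<in> Deg a (int e - 1 - int (sum_list \<beta>))"
proof (rule translate_const_filtration[of "Deg a"])
  show "Deg a i \<subseteq> Deg a j" if "i \<le> j" for i j using that by (auto elim: Deg_mono)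
  show "y * x \<in> Deg a i" if "y \<in> set (map Const ys)" "x \<in> Deg a i" for y i x
    using that Deg_mult[OF Const_in_Deg that(2)] by auto
  show "sum_list \<beta> \<le> N" if "length \<beta> = length (map Const ys)" "P \<beta> \<noteq> 0" for \<beta>
  proof (rule ccontr)
    assume "\<not> sum_list \<beta> \<le> N"
    then have "P \<beta> = 0"
      using Deg_nonpos[OF assms(1)[of \<beta>]] that(1) assms(3) by simp
    with that show False by simp
  qed
qed (use assms in \<open>auto simp: Deg_add\<close>)

text \<open>
  The polynomials in \<open>b\<close> variables \<open>x\<close> and \<open>a\<close> variables \<open>u\<close> of total degree below \<open>e\<close>.
\<close>

definition polys :: "nat \<Rightarrow> nat \<Rightarrow> nat \<Rightarrow> (nat list \<Rightarrow> 'f::comm_ring_1 upoly) set" where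
  "polys b a e = {P. (\<forall>\<beta>. length \<beta> \<noteq> b \<longrightarrow> P \<beta> = 0) \<and>
     (\<forall>\<beta>. length \<beta> = b \<longrightarrow> P \<beta> \<in> Deg a (int e - int (sum_list \<beta>)))}"

lemma polysD: "P \<in> polys b a e \<Longrightarrow> length \<beta> = b \<Longrightarrow> P \<beta> \<in> Deg a (int e - int (sum_list \<beta>))"
  by (simp add: polys_def)

lemma polysD0: "P \<in> polys b a e \<Longrightarrow> length \<beta> \<noteq> b \<Longrightarrow> P \<beta> = 0"
  by (simp add: polys_def)

lemma polys_mono: "e \<le> e' \<Longrightarrow> polys b a e \<subseteq> polys b a e'"
  by (auto simp: polys_def elim!: Deg_mono)

lemma polys_lookup_eq_0:
  assumes "P \<in> polys b a e" "(\<beta>, \<alpha>) \<notin> exponents b a e"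
  shows "lookup (P \<beta>) \<alpha> = 0"
proof (cases "length \<beta> = b")
  case True
  show ?thesis using mon_inD[OF polysD[OF assms(1) True, unfolded Deg_def], of \<alpha>] assms(2) True
    by (force simp: exponents_def)
qed (simp add: polysD0[OF assms(1)])

lemma polys_degree:
  assumes "P \<in> polys b a e" "P \<beta> \<noteq> 0"
  shows "sum_list \<beta> < e"
proof -
  obtain \<alpha> where "lookup (P \<beta>) \<alpha> \<noteq> 0" using assms(2) by (metis poly_mapping_eqI lookup_zero)
  then have "(\<beta>, \<alpha>) \<in> exponents b a e" using polys_lookup_eq_0[OF assms(1)] by blast
  then show ?thesis by (simp add: exponents_def)
qed

lemma add_subgroup_polys: "add_subgroup (polys b a e)"
  by (auto simp: add_subgroup_def polys_def Deg_diff)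

lemma polys_0: "polys b a 0 = {0}"
proof -
  have "P = 0" if "P \<in> polys b a 0" for P :: "nat list \<Rightarrow> 'f::comm_ring_1 upoly"
    using polys_degree[OF that] by (auto simp: fun_eq_iff)
  then show ?thesis using add_subgroup_0[OF add_subgroup_polys[of b a 0]] by auto
qed

lemma translate_in_polys:
  assumes "\<And>z. z \<in> set zs \<Longrightarrow> z \<in> Deg a 2" "length zs = b" "P \<in> polys b a e"
  shows "translate N zs P \<in> polys b a e"
  unfolding polys_def
  using translate_Deg[of zs a P "int e"] translate_eq_0_length[of _ zs N P] polysD[OF assms(3)] assms(1,2) by auto

lemma card_polys:
  shows "finite (polys b a e :: (nat list \<Rightarrow> 'f::{field,finite} upoly) set)"
    and "card (polys b a e :: (nat list \<Rightarrow> 'f upoly) set) = CARD('f) ^ card (exponents b a e)"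
proof -
  let ?V = "polys b a e :: (nat list \<Rightarrow> 'f upoly) set"
  let ?G = "{g :: nat list \<times> (nat \<Rightarrow>\<^sub>0 nat) \<Rightarrow> 'f. \<forall>i. i \<notin> exponents b a e \<longrightarrow> g i = 0}"
  let ?dec = "\<lambda>g \<beta>. \<Sum>\<alpha>\<in>{\<alpha>. (\<beta>, \<alpha>) \<in> exponents b a e}. single \<alpha> (g (\<beta>, \<alpha>))"
  have fin: "finite {\<alpha>. (\<beta>, \<alpha>) \<in> exponents b a e}" for \<beta>
    using finite_imageI[OF finite_exponents[of b a e], of snd]
    by (rule rev_finite_subset) force
  have look: "lookup (?dec g \<beta>) \<alpha> = (if (\<beta>, \<alpha>) \<in> exponents b a e then g (\<beta>, \<alpha>) else 0)"
    for g :: "nat list \<times> (nat \<Rightarrow>\<^sub>0 nat) \<Rightarrow> 'f" and \<beta> \<alpha>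
  proof -
    have "lookup (?dec g \<beta>) \<alpha> = (\<Sum>\<alpha>'\<in>{\<alpha>. (\<beta>, \<alpha>) \<in> exponents b a e}. if \<alpha>' = \<alpha> then g (\<beta>, \<alpha>) else 0)"
      unfolding lookup_sum by (rule sum.cong) (auto simp: lookup_single_eq lookup_single_not_eq)
    then show ?thesis using fin by simp
  qed
  have bij: "bij_betw (\<lambda>P (\<beta>, \<alpha>). lookup (P \<beta>) \<alpha>) ?V ?G"
  proof (rule bij_betw_byWitness[where f' = ?dec])
    show "\<forall>P\<in>?V. ?dec (\<lambda>(\<beta>, \<alpha>). lookup (P \<beta>) \<alpha>) = P"
    proof (intro ballI ext poly_mapping_eqI)
      fix P \<beta> \<alpha> assume "P \<in> ?V"
      then show "lookup (?dec (\<lambda>(\<beta>, \<alpha>). lookup (P \<beta>) \<alpha>) \<beta>) \<alpha> = lookup (P \<beta>) \<alpha>"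
        unfolding look using polys_lookup_eq_0 by auto
    qed
    show "\<forall>g\<in>?G. (\<lambda>(\<beta>, \<alpha>). lookup (?dec g \<beta>) \<alpha>) = g"
      unfolding look by auto
    show "(\<lambda>P (\<beta>, \<alpha>). lookup (P \<beta>) \<alpha>) ` ?V \<subseteq> ?G"
      using polys_lookup_eq_0 by auto
    show "?dec ` ?G \<subseteq> ?V"
    proof (rule image_subsetI)
      fix g assume "g \<in> ?G"
      have "?dec g \<beta> \<in> Deg a (int e - int (sum_list \<beta>))" for \<beta>
        unfolding Deg_def
      proof (rule mon_inI)
        fix \<alpha> assume "lookup (?dec g \<beta>) \<alpha> \<noteq> 0"
        then have "(\<beta>, \<alpha>) \<in> exponents b a e" unfolding look by (simp split: if_splits)
        then show "keys \<alpha> \<subseteq> {..<a} \<and> int (mdeg \<alpha>) < int e - int (sum_list \<beta>)"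
          by (auto simp: exponents_def)
      qed
      moreover have "?dec g \<beta> = 0" if "length \<beta> \<noteq> b" for \<beta>
        by (rule poly_mapping_eqI) (use that in \<open>auto simp: look exponents_def\<close>)
      ultimately show "?dec g \<in> ?V" by (simp add: polys_def)
    qed
  qed
  show "finite ?V" using bij_betw_finite[OF bij] card_supported_functions(1)[OF finite_exponents] by blast
  show "card ?V = CARD('f) ^ card (exponents b a e)"
    using bij_betw_same_card[OF bij] card_supported_functions(2)[OF finite_exponents[of b a e]] by simp
qed

section \<open>Vanishing on a flat and along all shears\<close>

text \<open>
  \<open>P\<close> vanishes to order \<open>m\<close> at the point \<open>(y, u)\<close>: after moving the point to the origin, no monomial
  has total degree below \<open>m\<close>.
\<close>

definition vanishes :: "nat \<Rightarrow> nat \<Rightarrow> 'f::field vec \<Rightarrow> 'f vec \<Rightarrow> (nat list \<Rightarrow> 'f upoly) \<Rightarrow> bool" where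
  "vanishes N m y u P \<longleftrightarrow> (\<forall>\<beta>. length \<beta> = dim_vec y \<longrightarrow>
     translate N (map Const (list_of_vec y)) (\<lambda>\<beta>. shift (($) u) (P \<beta>)) \<beta>
       \<in> Ord (int m - int (sum_list \<beta>)))"

lemma shift_linear_form:
  assumes "dim_vec c = a" "v \<in> carrier_vec a"
  shows "shift (($) v) (linear_form a c) = linear_form a c + Const (c \<bullet> v)"
proof -
  have "shift (($) v) (linear_form a c) = (\<Sum>l<a. Const (c $ l) * (Var l + Const (v $ l)))"
    unfolding linear_form_def shift_sum shift_mult shift_Const shift_Var
    by (rule sum.cong) (use assms in \<open>auto simp: list_of_vec_index\<close>)
  also have "\<dots> = linear_form a c + Const (\<Sum>l<a. c $ l * v $ l)"
    by (simp add: linear_form_def distrib_left sum.distrib Const_sum Const_mult)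
  finally show ?thesis using assms by (simp add: scalar_prod_def atLeast0LessThan)
qed

lemma shift_linear_forms:
  assumes "C \<in> carrier_mat b a" "v \<in> carrier_vec a"
  shows "map (shift (($) v)) (linear_forms C)
       = map2 (+) (linear_forms C) (map Const (list_of_vec (C *\<^sub>v v)))"
  by (rule nth_equalityI)
     (use assms in \<open>auto simp: linear_forms_def list_of_vec_index shift_linear_form[where a = a]\<close>)

text \<open>
  Shearing \<open>P\<close> moves its zeros along with their multiplicities.  After substituting \<open>u + v\<close> for \<open>u\<close>, the shear
  \<open>C u\<close> splits into the constant \<open>C v\<close>, which joins \<open>y\<close>, and the linear part \<open>C u\<close>, which
  preserves orders at the origin.
\<close>

lemma vanishes_translate_linear_forms:
  assumes "C \<in> carrier_mat b a" "v \<in> carrier_vec a" "y \<in> carrier_vec b"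
    and "vanishes N m (y + C *\<^sub>v v) v P"
  shows "vanishes N m y v (translate N (linear_forms C) P)"
  unfolding vanishes_def
proof (intro allI impI)
  fix \<beta> :: "nat list" assume \<beta>: "length \<beta> = dim_vec y"
  let ?sh = "shift (($) v)"
  let ?P = "\<lambda>\<beta>. ?sh (P \<beta>)"
  let ?c = "\<lambda>x. map Const (list_of_vec x)"
  have len: "length (linear_forms C) = b" using assms by simp
  have zs: "map2 (+) (?c y) (map2 (+) (linear_forms C) (?c (C *\<^sub>v v))) = map2 (+) (linear_forms C) (?c (y + C *\<^sub>v v))"
    by (rule nth_equalityI) (use assms len in \<open>auto simp: list_of_vec_index Const_add algebra_simps\<close>)
  have "translate N (?c y) (\<lambda>\<beta>. ?sh (translate N (linear_forms C) P \<beta>)) \<beta>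
      = translate N (?c y) (translate N (map2 (+) (linear_forms C) (?c (C *\<^sub>v v))) ?P) \<beta>"
    by (simp add: shift_translate shift_linear_forms[OF assms(1,2)])
  also have "\<dots> = translate N (linear_forms C) (translate N (?c (y + C *\<^sub>v v)) ?P) \<beta>"
    using assms len by (simp add: translate_translate zs)
  also have "\<dots> \<in> Ord (int m - int (sum_list \<beta>))"
    by (rule translate_Ord)
       (use assms len \<beta> linear_forms_in_Ord[OF assms(1)] in \<open>auto simp: vanishes_def\<close>)
  finally show "translate N (?c y) (\<lambda>\<beta>. ?sh (translate N (linear_forms C) P \<beta>)) \<beta> \<in> Ord (int m - int (sum_list \<beta>))" .
qed

lemma Deg_eq_0_by_multiplicities:
  fixes r :: "'f::{field,finite} upoly"
  assumes r: "r \<in> Deg a (int d + 1)"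
    and van: "\<And>v. v \<in> carrier_vec a \<Longrightarrow> shift (($) v) r \<in> Ord (int (m v))"
    and big: "d * CARD('f) ^ a < (\<Sum>v\<in>carrier_vec a. m v) * CARD('f)"
  shows "r = 0"
proof (rule ccontr)
  assume "r \<noteq> 0"
  then obtain \<alpha> where \<alpha>: "lookup r \<alpha> \<noteq> 0" by (metis poly_mapping_eqI lookup_zero)
  then have keys: "keys \<alpha> \<subseteq> {..<a}" using r by (auto simp: Deg_def dest: mon_inD)
  have "(\<Sum>zs\<in>{zs. set zs \<subseteq> (UNIV :: 'f set) \<and> length zs = a}. m (vec_of_list zs)) * card (UNIV :: 'f set)
      \<le> d * card (UNIV :: 'f set) ^ a"
  proof (rule schwartz_zippel_multiplicity[where p = "\<lambda>\<alpha>s. lookup r (Poly_Mapping.nth \<alpha>s)" and N = d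
        and \<beta>\<^sub>0 = "map (lookup \<alpha>) [0..<a]"])
    show "lookup r (Poly_Mapping.nth (map (lookup \<alpha>) [0..<a])) \<noteq> 0"
      using \<alpha> nth_map_lookup[OF keys] by simp
    show "sum_list ks \<le> d" if "lookup r (Poly_Mapping.nth ks) \<noteq> 0" for ks
      using mon_inD[OF r[unfolded Deg_def] that] by (simp add: mdeg_nth)
    fix zs :: "'f list" and ks :: "nat list"
    assume zs: "length zs = a" and ks: "length ks = a" "sum_list ks < m (vec_of_list zs)"
    have "vec_of_list zs \<in> carrier_vec a" using zs by (intro carrier_vecI) simp
    moreover have nth: "($) (vec_of_list zs) = (!) zs" by (simp add: fun_eq_iff vec_of_list_index)
    ultimately have "shift ((!) zs) r \<in> Ord (int (m (vec_of_list zs)))" using van by metis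
    then have "lookup (shift (\<lambda>l. zs ! l) r) (Poly_Mapping.nth ks) = 0"
      using ks by (auto simp: Ord_def vec_of_list_index mdeg_nth dest!: mon_inD[where \<alpha> = "Poly_Mapping.nth ks"])
    moreover have "r \<in> mon_in (\<lambda>\<alpha>. keys \<alpha> \<subseteq> {..<a} \<and> mdeg \<alpha> \<le> d)"
      using r unfolding Deg_def by (rule mon_in_mono) auto
    ultimately show "translate d zs (\<lambda>\<alpha>s. lookup r (Poly_Mapping.nth \<alpha>s)) ks = 0"
      using lookup_shift[of r a d zs ks] zs ks by simp
  qed auto
  moreover have "(\<Sum>zs\<in>{zs. set zs \<subseteq> (UNIV :: 'f set) \<and> length zs = a}. m (vec_of_list zs)) = (\<Sum>v\<in>carrier_vec a. m v)"
    by (rule sum.reindex_bij_betw[OF bij_betw_vec_of_list])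
  ultimately show False using big by simp
qed

text \<open>
  For the flat \<open>x = y\<close>, obtained from a general one by a shear.  Expand \<open>Q(y + x, u)\<close> in powers of \<open>x\<close>.  The
  coefficient of \<open>x\<^sup>\<beta>\<close> has degree at most \<open>e - j\<close> and vanishes at \<open>v\<close> to order \<open>m v - j\<close>, so it is zero by
  the Schwartz--Zippel lemma if these orders add up to too much.  Passing from \<open>Q(y + x, u)\<close> to \<open>Q(x, u)\<close>
  affects only lower degrees.
\<close>

lemma flat_vanishing:
  fixes Q :: "nat list \<Rightarrow> 'f::{field,finite} upoly"
  assumes Q: "Q \<in> polys b a (Suc e)" "Suc e \<le> N" and y: "y \<in> carrier_vec b"
    and van: "\<And>v. v \<in> carrier_vec a \<Longrightarrow> vanishes N (m v) y v Q"
    and \<beta>: "length \<beta> = b" "sum_list \<beta> = j"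
    and big: "(e - j) * CARD('f) ^ a < (\<Sum>v\<in>carrier_vec a. m v - j) * CARD('f)"
  shows "Q \<beta> \<in> Deg a (int e - int j)"
proof -
  let ?ys = "list_of_vec y"
  define Q' where "Q' = translate N (map Const ?ys) Q"
  have len: "length ?ys = b" using y by simp
  have Q': "Q' \<beta> - Q \<beta> \<in> Deg a (int e - int j)"
  proof -
    have "translate N (map Const ?ys) Q \<beta> - Q \<beta> \<in> Deg a (int (Suc e) - 1 - int (sum_list \<beta>))"
      by (rule translate_Const_Deg) (use polysD[OF Q(1)] Q(2) \<beta> len in auto)
    then show ?thesis by (simp add: Q'_def \<beta>)
  qed
  have "Q' \<in> polys b a (Suc e)"
    unfolding Q'_def
    by (rule translate_in_polys) (use Q len in \<open>auto intro: Deg_mono[OF Const_in_Deg]\<close>)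
  then have deg: "Q' \<beta> \<in> Deg a (int (Suc e) - int j)" using polysD \<beta> by blast
  have "Q' \<beta> = 0"
  proof (cases "j \<le> e")
    case True
    show ?thesis
    proof (rule Deg_eq_0_by_multiplicities[where d = "e - j" and m = "\<lambda>v. m v - j"])
      show "Q' \<beta> \<in> Deg a (int (e - j) + 1)" using deg True by (simp add: of_nat_diff algebra_simps)
      fix v :: "'f vec" assume v: "v \<in> carrier_vec a"
      have "shift (($) v) (Q' \<beta>) = translate N (map Const ?ys) (\<lambda>\<beta>. shift (($) v) (Q \<beta>)) \<beta>"
        by (simp add: Q'_def shift_translate comp_def)
      moreover have "length \<beta> = dim_vec y" using \<beta> y by simp
      moreover have "translate N (map Const ?ys) (\<lambda>\<beta>. shift (($) v) (Q \<beta>)) \<beta> \<in> Ord (int (m v) - int j)"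
        using van[OF v] \<open>length \<beta> = dim_vec y\<close> unfolding vanishes_def \<beta>(2)[symmetric] by blast
      ultimately have "shift (($) v) (Q' \<beta>) \<in> Ord (int (m v) - int j)" by simp
      then show "shift (($) v) (Q' \<beta>) \<in> Ord (int (m v - j))"
        unfolding Ord_def by (rule mon_in_mono) linarith
    qed (rule big)
  qed (use deg Deg_nonpos in force)
  with Q' have "0 - Q \<beta> \<in> Deg a (int e - int j)" by simp
  from Deg_diff[OF Deg_0 this] show ?thesis by simp
qed

text \<open>
  The hypothesis says that the form of degree \<open>e\<close> in \<open>Q\<close> vanishes to order \<open>l\<close> at every point of the grid
  \<open>G\<^sup>b\<close>, where \<open>G\<close> is the set of the \<open>q\<^sup>a\<close> linear forms in \<open>u\<close>.  Its degree in \<open>x\<close> is at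
  most \<open>e\<close>, which is less than \<open>l |G|\<close>, so the Schwartz--Zippel lemma over the ring of
  polynomials in \<open>u\<close> leaves only the zero form.
\<close>

lemma lower_degree_if_all_shears_lower:
  fixes Q :: "nat list \<Rightarrow> 'f::{field,finite} upoly"
  assumes Q: "Q \<in> polys b a (Suc e)" "Suc e \<le> N" and e: "e < l * CARD('f) ^ a"
    and van: "\<And>C \<beta>. C \<in> carrier_mat b a \<Longrightarrow> length \<beta> = b \<Longrightarrow> sum_list \<beta> < l \<Longrightarrow>
       translate N (linear_forms C) Q \<beta> \<in> Deg a (int e - int (sum_list \<beta>))"
  shows "Q \<in> polys b a e"
proof -
  \<comment> \<open>The homogeneous part of total degree \<open>e\<close>.\<close>
  define H where "H \<beta> = (\<Sum>\<alpha>\<in>{\<alpha> \<in> keys (Q \<beta>). sum_list \<beta> + mdeg \<alpha> = e}. single \<alpha> (lookup (Q \<beta>) \<alpha>))" for \<beta>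
  have look: "lookup (H \<beta>) \<alpha> = (if sum_list \<beta> + mdeg \<alpha> = e then lookup (Q \<beta>) \<alpha> else 0)" for \<beta> \<alpha>
  proof -
    have "lookup (H \<beta>) \<alpha> = (\<Sum>\<alpha>'\<in>{\<alpha> \<in> keys (Q \<beta>). sum_list \<beta> + mdeg \<alpha> = e}. if \<alpha>' = \<alpha> then lookup (Q \<beta>) \<alpha> else 0)"
      unfolding H_def lookup_sum by (rule sum.cong) (auto simp: lookup_single_eq lookup_single_not_eq)
    then show ?thesis by (simp add: in_keys_iff)
  qed
  have Qk: "keys \<alpha> \<subseteq> {..<a} \<and> sum_list \<beta> + mdeg \<alpha> \<le> e" if "lookup (Q \<beta>) \<alpha> \<noteq> 0" for \<beta> \<alpha>
  proof -
    have "(\<beta>, \<alpha>) \<in> exponents b a (Suc e)" using polys_lookup_eq_0[OF Q(1)] that by blast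
    then show ?thesis by (auto simp: exponents_def)
  qed
  have homog: "H \<beta> \<in> Homog a (int e - int (sum_list \<beta>))" for \<beta>
    unfolding Homog_def by (rule mon_inI) (use Qk in \<open>auto simp: look split: if_splits\<close>)
  have low: "Q \<beta> - H \<beta> \<in> Deg a (int e - int (sum_list \<beta>))" for \<beta>
    unfolding Deg_def
    by (rule mon_inI) (use Qk in \<open>force simp: look lookup_minus split: if_splits\<close>)
  have H_len: "H \<beta> = 0" if "length \<beta> \<noteq> b" for \<beta>
    using polysD0[OF Q(1) that] by (simp add: H_def)
  have "H \<beta> = 0" for \<beta>
  proof (rule ccontr)
    assume nz: "H \<beta> \<noteq> 0"
    let ?G = "linear_form a ` (carrier_vec a :: 'f vec set)"
    have G: "finite ?G" "card ?G = CARD('f) ^ a"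
      by (simp_all add: finite_carrier_vec card_carrier_vec card_image inj_on_linear_form)
    have "(\<Sum>zs\<in>{zs. set zs \<subseteq> ?G \<and> length zs = b}. l) * card ?G \<le> e * card ?G ^ b"
    proof (rule schwartz_zippel_multiplicity[where p = H and \<beta>\<^sub>0 = \<beta> and N = N])
      show "sum_list \<beta> \<le> e" if nz': "H \<beta> \<noteq> 0" for \<beta>
      proof -
        obtain \<alpha> where "lookup (H \<beta>) \<alpha> \<noteq> 0" using nz' by (metis poly_mapping_eqI lookup_zero)
        then show ?thesis by (auto simp: look split: if_splits)
      qed
      show "length \<beta> = b" using nz H_len by blast
      fix zs :: "'f upoly list" and \<beta> :: "nat list"
      assume zs: "set zs \<subseteq> ?G" "length zs = b" and \<beta>: "length \<beta> = b" "sum_list \<beta> < l"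
      have "\<forall>i. \<exists>c. i < b \<longrightarrow> c \<in> carrier_vec a \<and> zs ! i = linear_form a c"
        using zs nth_mem[of _ zs] by blast
      then obtain c where c: "\<And>i. i < b \<Longrightarrow> c i \<in> carrier_vec a" "\<And>i. i < b \<Longrightarrow> zs ! i = linear_form a (c i)"
        by metis
      define C where "C = mat b a (\<lambda>(i, l). c i $ l)"
      have C: "C \<in> carrier_mat b a" by (simp add: C_def)
      have row: "row C i = c i" if "i < b" for i
        using c(1)[OF that] that by (intro eq_vecI) (auto simp: C_def)
      have zs_C: "zs = linear_forms C"
        by (rule nth_equalityI) (use zs c C row in \<open>auto simp: linear_forms_def\<close>)
      have 1: "translate N zs H \<beta> \<in> Homog a (int e - int (sum_list \<beta>))"
        by (rule translate_Homog) (use zs \<beta> homog linear_form_in_Homog in auto)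
      have "translate N zs (\<lambda>\<beta>. Q \<beta> - H \<beta>) \<beta> \<in> Deg a (int e - int (sum_list \<beta>))"
        by (rule translate_Deg) (use zs zs_C \<beta> low linear_forms_in_Deg[OF C] in auto)
      moreover have "translate N zs Q \<beta> \<in> Deg a (int e - int (sum_list \<beta>))"
        using van[OF C \<beta>] zs_C by simp
      ultimately have "translate N zs Q \<beta> - translate N zs (\<lambda>\<beta>. Q \<beta> - H \<beta>) \<beta> \<in> Deg a (int e - int (sum_list \<beta>))"
        by (intro Deg_diff)
      then have 2: "translate N zs H \<beta> \<in> Deg a (int e - int (sum_list \<beta>))"
        by (simp add: translate_diff)
      show "translate N zs H \<beta> = 0"
      proof (rule poly_mapping_eqI, rule ccontr)
        fix \<alpha> assume "lookup (translate N zs H \<beta>) \<alpha> \<noteq> lookup 0 \<alpha>"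
        then have "lookup (translate N zs H \<beta>) \<alpha> \<noteq> 0" by simp
        from mon_inD[OF 1[unfolded Homog_def] this] mon_inD[OF 2[unfolded Deg_def] this] show False
          by linarith
      qed
    qed (use G Q nz in auto)
    then have "(l * card ?G) * card ?G ^ b \<le> e * card ?G ^ b"
      using G by (simp add: card_lists_length_eq mult_ac)
    then have "l * card ?G \<le> e" using G by simp
    with e G show False by simp
  qed
  with low polysD0[OF Q(1)] show ?thesis by (simp add: polys_def)
qed

section \<open>The chain of spaces of bounded degree\<close>

definition mult_space :: "nat \<Rightarrow> nat \<Rightarrow> nat \<Rightarrow> ('f vec \<times> 'f vec \<Rightarrow> nat) \<Rightarrow> (nat list \<Rightarrow> 'f::field upoly) set" where
  "mult_space N b a \<mu> = {P. \<forall>y\<in>carrier_vec b. \<forall>u\<in>carrier_vec a. vanishes N (\<mu> (y, u)) y u P}"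

lemma add_subgroup_mult_space: "add_subgroup (mult_space N b a \<mu>)"
  by (auto simp: add_subgroup_def mult_space_def vanishes_def shift_diff translate_diff Ord_diff)

lemma mult_space_mono: "(\<And>p. \<mu> p \<le> \<mu>' p) \<Longrightarrow> mult_space N b a \<mu>' \<subseteq> mult_space N b a \<mu>"
proof -
  assume le: "\<And>p. \<mu> p \<le> \<mu>' p"
  have "r \<in> Ord (int (\<mu>' p) - i) \<Longrightarrow> r \<in> Ord (int (\<mu> p) - i)" for r :: "'a upoly" and p i
    unfolding Ord_def by (erule mon_in_mono) (use le[of p] in linarith)
  then show ?thesis unfolding mult_space_def vanishes_def by blast
qed

lemma translate_linear_forms_mult_space:
  assumes "C \<in> carrier_mat b a" "P \<in> mult_space N b a (\<lambda>_. m)"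
  shows "translate N (linear_forms C) P \<in> mult_space N b a (\<lambda>_. m)"
  using assms by (auto simp: mult_space_def intro!: vanishes_translate_linear_forms)

lemma translate_linear_forms_polys:
  assumes "C \<in> carrier_mat b a" "P \<in> polys b a e"
  shows "translate N (linear_forms C) P \<in> polys b a e"
  by (rule translate_in_polys) (use assms linear_forms_in_Deg[OF assms(1)] in auto)

lemma translate_linear_forms_add:
  assumes "C \<in> carrier_mat b a" "C' \<in> carrier_mat b a"
  shows "translate N (linear_forms C) (translate N (linear_forms C') P) = translate N (linear_forms (C + C')) P"
  using assms by (intro ext) (simp add: translate_translate linear_forms_add)

lemma translate_linear_forms_0:
  assumes "P \<in> polys b a e" "e \<le> N"
  shows "translate N (linear_forms (0\<^sub>m b a)) P = P"
proof
  fix \<beta>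
  have zero: "linear_forms (0\<^sub>m b a :: 'a mat) = replicate b 0"
    by (rule nth_equalityI) (auto simp: linear_forms_def linear_form_def)
  show "translate N (linear_forms (0\<^sub>m b a)) P \<beta> = P \<beta>"
  proof (cases "length \<beta> = b")
    case True
    have "sum_list \<beta> \<le> N" if "P \<beta> \<noteq> 0" for \<beta>
      using polys_degree[OF assms(1) that] assms(2) by simp
    with True show ?thesis unfolding zero by (intro translate_zero_shift)
  next
    case False
    then show ?thesis unfolding zero using polysD0[OF assms(1)] by (simp add: translate_eq_0_length)
  qed
qed

lemma finite_carrier_mat: "finite (carrier_mat b a :: 'f::finite mat set)"
proof -
  have "carrier_mat b a \<subseteq> (\<lambda>f. mat b a f) ` PiE ({..<b} \<times> {..<a}) (\<lambda>_. UNIV :: 'f set)"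
  proof
    fix C :: "'f mat" assume "C \<in> carrier_mat b a"
    then have "C = mat b a (restrict (\<lambda>p. C $$ p) ({..<b} \<times> {..<a}))"
      by (intro eq_matI) auto
    then show "C \<in> (\<lambda>f. mat b a f) ` PiE ({..<b} \<times> {..<a}) (\<lambda>_. UNIV :: 'f set)"
      by - (rule image_eqI, assumption, simp)
  qed
  then show ?thesis by (rule finite_subset) (simp add: finite_PiE)
qed

text \<open>
  The directions in which \<open>D\<close> has a rich flat: \<open>C\<close> is counted if some translate of \<open>{(C u, u)}\<close> meets \<open>D\<close>
  in at least \<open>t\<close> points.
\<close>

definition rich_shears :: "nat \<Rightarrow> nat \<Rightarrow> nat \<Rightarrow> ('f::field vec \<times> 'f vec) set \<Rightarrow> 'f mat set" where
  "rich_shears b a t D = {C \<in> carrier_mat b a. \<exists>y\<in>carrier_vec b.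
      t \<le> card {v \<in> carrier_vec a. (y + C *\<^sub>v v, v) \<in> D}}"

text \<open>
  The arithmetic of the induction step in \<open>card_Fine_power_le\<close>.
\<close>

lemma power_cancel_chain:
  fixes x x' y y' K :: nat
  assumes "x > 0" and "y' * x \<le> K * y" "K ^ n * x' ^ t \<le> x' ^ n * x ^ t" "y ^ n * x ^ t \<le> x ^ n"
  shows "y' ^ n * x' ^ t \<le> x' ^ n"
proof -
  have "(y' ^ n * x' ^ t) * x ^ n = (y' * x) ^ n * x' ^ t" by (simp add: power_mult_distrib mult_ac)
  also have "\<dots> \<le> (K * y) ^ n * x' ^ t" using assms(2) by (intro mult_right_mono power_mono) auto
  also have "\<dots> = (K ^ n * x' ^ t) * y ^ n" by (simp add: power_mult_distrib mult_ac)
  also have "\<dots> \<le> (x' ^ n * x ^ t) * y ^ n" using assms(3) by (intro mult_right_mono) auto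
  also have "\<dots> = x' ^ n * (y ^ n * x ^ t)" by (simp add: mult_ac)
  also have "\<dots> \<le> x' ^ n * x ^ n" using assms(4) by (intro mult_left_mono) auto
  finally show ?thesis using assms(1) by simp
qed

text \<open>
  \<open>Base e\<close> consists of the polynomials of degree below \<open>e\<close> that vanish to order \<open>m1\<close> everywhere, and
  \<open>Fine e\<close> of those that vanish even to order \<open>m2\<close> on \<open>D\<close>.  A polynomial of degree at most \<open>e\<close> is in \<open>Low e C\<close>
  if its form of degree \<open>e\<close> vanishes to order \<open>l\<close> along \<open>x = C u\<close>; the formulation
  modulo lower degree avoids speaking of forms.  The assumption \<open>big\<close> is what the Schwartz--Zippel lemma
  requires on a flat with \<open>t\<close> points in \<open>D\<close>, for the derivatives of each order \<open>j < l\<close> across the flat.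
\<close>

context
  fixes b a d l m1 m2 t :: nat and D :: "('f::{field,finite} vec \<times> 'f vec) set"
  assumes m12: "m1 \<le> m2" and d: "d \<le> l * CARD('f) ^ a"
    and big: "\<And>j. j < l \<Longrightarrow> j < d \<Longrightarrow>
      (d - 1 - j) * CARD('f) ^ a < (t * (m2 - j) + (CARD('f) ^ a - t) * (m1 - j)) * CARD('f)"
    and zero: "\<And>j. j < l \<Longrightarrow> 0 < t * (m2 - j) + (CARD('f) ^ a - t) * (m1 - j)"
begin

abbreviation (input) "\<mu> p \<equiv> if p \<in> D then m2 else m1"
abbreviation (input) "Base e \<equiv> mult_space d b a (\<lambda>_. m1) \<inter> polys b a e :: (nat list \<Rightarrow> 'f upoly) set"
abbreviation (input) "Fine e \<equiv> mult_space d b a (\<lambda>p. \<mu> p) \<inter> polys b a e"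
abbreviation (input) "Low e C \<equiv> {Q :: nat list \<Rightarrow> 'f upoly. \<forall>\<beta>. length \<beta> = b \<longrightarrow> sum_list \<beta> < l \<longrightarrow>
   translate d (linear_forms C) Q \<beta> \<in> Deg a (int e - int (sum_list \<beta>))}"
abbreviation (input) "Shears \<equiv> carrier_mat b a :: 'f mat set"
abbreviation (input) "Rich \<equiv> rich_shears b a t D"

lemma Fine_subset_Low:
  assumes "Suc e \<le> d" "C \<in> Rich"
  shows "Fine (Suc e) \<subseteq> Low e C"
proof (intro subsetI CollectI allI impI)
  fix P and \<beta> :: "nat list"
  assume P: "P \<in> Fine (Suc e)" and \<beta>: "length \<beta> = b" "sum_list \<beta> < l"
  let ?j = "sum_list \<beta>" and ?q = "CARD('f)"
  have C: "C \<in> carrier_mat b a" using assms(2) by (simp add: rich_shears_def)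
  obtain y where y: "y \<in> carrier_vec b" "t \<le> card {v \<in> carrier_vec a. (y + C *\<^sub>v v, v) \<in> D}"
    using assms(2) by (auto simp: rich_shears_def)
  let ?T = "{v \<in> carrier_vec a. (y + C *\<^sub>v v, v) \<in> D}"
  let ?m = "\<lambda>v. \<mu> (y + C *\<^sub>v v, v)"
  have fin: "finite (carrier_vec a :: 'f vec set)" by (rule finite_carrier_vec)
  have T: "card ?T \<le> ?q ^ a"
    using card_mono[OF fin, of ?T] by (simp add: card_carrier_vec)
  have "(\<Sum>v\<in>carrier_vec a. ?m v - ?j) = (\<Sum>v\<in>?T. m2 - ?j) + (\<Sum>v\<in>carrier_vec a - ?T. m1 - ?j)"
    using sum.subset_diff[of ?T "carrier_vec a" "\<lambda>v. ?m v - ?j"] fin by (simp add: add.commute)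
  also have "\<dots> = card ?T * (m2 - ?j) + (?q ^ a - card ?T) * (m1 - ?j)"
    using fin by (simp add: card_Diff_subset card_carrier_vec)
  finally have sum: "(\<Sum>v\<in>carrier_vec a. ?m v - ?j) = card ?T * (m2 - ?j) + (?q ^ a - card ?T) * (m1 - ?j)" .
  have "t * (m2 - ?j) + (?q ^ a - t) * (m1 - ?j)
      = t * (m2 - ?j) + (card ?T - t) * (m1 - ?j) + (?q ^ a - card ?T) * (m1 - ?j)"
    using y(2) T by (simp flip: distrib_right add: add.assoc)
  also have "\<dots> \<le> t * (m2 - ?j) + (card ?T - t) * (m2 - ?j) + (?q ^ a - card ?T) * (m1 - ?j)"
    using m12 by (intro add_mono mult_left_mono) auto
  also have "\<dots> = card ?T * (m2 - ?j) + (?q ^ a - card ?T) * (m1 - ?j)"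
    using y(2) by (simp flip: distrib_right)
  finally have ge: "t * (m2 - ?j) + (?q ^ a - t) * (m1 - ?j) \<le> (\<Sum>v\<in>carrier_vec a. ?m v - ?j)"
    unfolding sum .
  show "translate d (linear_forms C) P \<beta> \<in> Deg a (int e - int ?j)"
  proof (rule flat_vanishing[where N = d and m = ?m])
    show "translate d (linear_forms C) P \<in> polys b a (Suc e)"
      using P C by (auto intro: translate_linear_forms_polys)
    show "(e - ?j) * ?q ^ a < (\<Sum>v\<in>carrier_vec a. ?m v - ?j) * ?q"
    proof (cases "?j < d")
      case True
      have "(e - ?j) * ?q ^ a \<le> (d - 1 - ?j) * ?q ^ a" using assms(1) by (intro mult_right_mono) auto
      also have "\<dots> < (t * (m2 - ?j) + (?q ^ a - t) * (m1 - ?j)) * ?q" using big \<beta> True by blast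
      also have "\<dots> \<le> (\<Sum>v\<in>carrier_vec a. ?m v - ?j) * ?q" using ge by (intro mult_right_mono) auto
      finally show ?thesis .
    next
      case False
      then have "e - ?j = 0" using assms(1) by simp
      moreover have "0 < (\<Sum>v\<in>carrier_vec a. ?m v - ?j)" using zero[OF \<beta>(2)] ge by linarith
      ultimately show ?thesis by simp
    qed
    show "vanishes d (?m v) y v (translate d (linear_forms C) P)" if "v \<in> carrier_vec a" for v
      using P C y(1) that by (intro vanishes_translate_linear_forms) (auto simp: mult_space_def)
  qed (use assms y \<beta> in auto)
qed

lemma Inter_Low:
  assumes "Suc e \<le> d"
  shows "Base (Suc e) \<inter> (\<Inter>C\<in>Shears. Low e C) = Base e"
proof
  have "Q \<in> polys b a e" if "Q \<in> polys b a (Suc e)" "Q \<in> (\<Inter>C\<in>Shears. Low e C)"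
    for Q :: "nat list \<Rightarrow> 'f upoly"
    by (rule lower_degree_if_all_shears_lower[where N = d and l = l])
       (use that d assms in auto)
  then show "Base (Suc e) \<inter> (\<Inter>C\<in>Shears. Low e C) \<subseteq> Base e" by blast
  show "Base e \<subseteq> Base (Suc e) \<inter> (\<Inter>C\<in>Shears. Low e C)"
  proof (intro subsetI IntI INT_I CollectI allI impI)
    fix P C and \<beta> :: "nat list"
    assume P: "P \<in> Base e"
    then show "P \<in> mult_space d b a (\<lambda>_. m1)" "P \<in> polys b a (Suc e)"
      using polys_mono[of e "Suc e" b a] by auto
    assume "C \<in> Shears" "length \<beta> = b"
    then show "translate d (linear_forms C) P \<beta> \<in> Deg a (int e - int (sum_list \<beta>))"
      using polysD[OF translate_linear_forms_polys[of C b a P e d]] P by blast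
  qed
qed

text \<open>
  The base space is invariant under the shear by \<open>J\<close>, which carries the conditions for \<open>C + J\<close> to those for
  \<open>C\<close>.
\<close>

lemma card_shifted_shears:
  assumes "Suc e \<le> d" "W \<subseteq> Shears" "J \<in> Shears"
  shows "card (Base (Suc e) \<inter> (\<Inter>C\<in>(\<lambda>C. C + J) ` W. Low e C)) = card (Base (Suc e) \<inter> (\<Inter>C\<in>W. Low e C))"
proof (rule bij_betw_same_card)
  let ?X = "Base (Suc e)"
  let ?A = "?X \<inter> (\<Inter>C\<in>(\<lambda>C. C + J) ` W. Low e C)" and ?B = "?X \<inter> (\<Inter>C\<in>W. Low e C)"
  let ?f = "translate d (linear_forms J)" and ?g = "translate d (linear_forms (- J))"
  have mJ: "- J \<in> Shears" using assms(3) by simp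
  have inX: "?f Q \<in> ?X" "?g Q \<in> ?X" if "Q \<in> ?X" for Q
    using that assms(3) mJ by (auto intro: translate_linear_forms_mult_space translate_linear_forms_polys)
  have inv: "?g (?f Q) = Q" "?f (?g Q) = Q" if "Q \<in> ?X" for Q
  proof -
    have J0: "- J + J = 0\<^sub>m b a" "J + - J = 0\<^sub>m b a" using assms(3) by (auto intro!: eq_matI)
    show "?g (?f Q) = Q" "?f (?g Q) = Q"
      using that assms translate_linear_forms_0[of Q b a "Suc e" d]
      by (simp_all add: translate_linear_forms_add[OF mJ assms(3)] translate_linear_forms_add[OF assms(3) mJ] J0)
  qed
  have add: "translate d (linear_forms C) (?f Q) = translate d (linear_forms (C + J)) Q"
    "translate d (linear_forms (C + J)) (?g Q) = translate d (linear_forms C) Q" if "C \<in> W" for C Q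
  proof -
    have C: "C \<in> Shears" using that assms(2) by blast
    then have CJ: "C + J \<in> Shears" using assms(3) by simp
    have "C + J + - J = C" using C assms(3) by (intro eq_matI) auto
    with CJ C assms(3) mJ show "translate d (linear_forms C) (?f Q) = translate d (linear_forms (C + J)) Q"
      "translate d (linear_forms (C + J)) (?g Q) = translate d (linear_forms C) Q"
      by (simp_all add: translate_linear_forms_add[of _ b a])
  qed
  show "bij_betw ?f ?A ?B"
    by (rule bij_betw_byWitness[where f' = ?g]) (use inX inv add in auto)
qed

lemma Base_facts:
  shows "finite (Base e)" "add_subgroup (Base e)" "0 < card (Base e)"
proof -
  show fin: "finite (Base e)" using card_polys(1)[of b a e] by blast
  show sub: "add_subgroup (Base e)" by (intro add_subgroup_Int add_subgroup_mult_space add_subgroup_polys)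
  show "0 < card (Base e)" using fin add_subgroup_0[OF sub] card_gt_0_iff by blast
qed

lemma add_subgroup_Low: "add_subgroup (Low e C)"
  by (auto simp: add_subgroup_def fun_diff_def translate_diff Deg_diff)
     (use translate_0_fun in \<open>simp_all add: zero_fun_def\<close>)

text \<open>
  In terms of dimensions: the codimension of \<open>Fine e\<close> in \<open>Base e\<close> is at least the proportion of rich shears
  times the dimension of \<open>Base e\<close>.  Induct on \<open>e\<close>, which amounts to summing over the spaces of leading
  forms.  In degree \<open>e\<close>, the conditions \<open>Low e C\<close> for all \<open>C\<close> together cut \<open>Base (e + 1)\<close> down to
  \<open>Base e\<close>; the translates of the set of rich shears cover every shear equally often and impose equally
  strong conditions, so fractional subadditivity applies.
\<close>

lemma card_Fine_power_le:
  assumes "e \<le> d"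
  shows "card (Fine e) ^ card Shears * card (Base e) ^ card Rich \<le> card (Base e) ^ card Shears"
  using assms
proof (induction e)
  case 0
  have "Fine 0 = {0}" "Base 0 = {0}"
    using add_subgroup_0[OF add_subgroup_mult_space[of d b a "\<lambda>p. \<mu> p"]]
      add_subgroup_0[OF add_subgroup_mult_space[of d b a "\<lambda>_. m1"]]
    by (auto simp: polys_0)
  then show ?case by simp
next
  case (Suc e)
  let ?K = "\<lambda>W. Base (Suc e) \<inter> (\<Inter>C\<in>W. Low e C)"
  have Rich: "Rich \<subseteq> Shears" by (auto simp: rich_shears_def)
  have finS: "finite Shears" by (rule finite_carrier_mat)
  have "(\<Prod>J\<in>Shears. card (?K ((\<lambda>C. C + J) ` Rich \<inter> Shears))) * card (Base (Suc e)) ^ card Rich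
      \<le> card (Base (Suc e)) ^ card Shears * card (?K Shears) ^ card Rich"
  proof (rule fractional_subadditivity)
    fix w assume w: "w \<in> Shears"
    have "{J \<in> Shears. w \<in> (\<lambda>C. C + J) ` Rich} = (\<lambda>C. w - C) ` Rich"
    proof (rule subset_antisym; rule subsetI)
      fix J assume "J \<in> {J \<in> Shears. w \<in> (\<lambda>C. C + J) ` Rich}"
      then obtain C where "C \<in> Rich" "w = C + J" "J \<in> Shears" by blast
      moreover from this have "J = w - C" using Rich by (intro eq_matI) auto
      ultimately show "J \<in> (\<lambda>C. w - C) ` Rich" by blast
    next
      fix J assume "J \<in> (\<lambda>C. w - C) ` Rich"
      then obtain C where C: "C \<in> Rich" "J = w - C" by blast
      then have "C \<in> Shears" using Rich by blast
      then have "w = C + J" "J \<in> Shears" using C w by (auto intro!: eq_matI minus_carrier_mat)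
      with C(1) show "J \<in> {J \<in> Shears. w \<in> (\<lambda>C. C + J) ` Rich}" by blast
    qed
    moreover have "inj_on (\<lambda>C. w - C) Rich"
    proof (rule inj_onI)
      fix C C' assume "C \<in> Rich" "C' \<in> Rich" and eq: "w - C = w - C'"
      then have C: "C \<in> Shears" "C' \<in> Shears" using Rich by auto
      have "w - (w - C) = C" "w - (w - C') = C'" using C w by (auto intro!: eq_matI)
      then show "C = C'" using eq by metis
    qed
    ultimately show "card {J \<in> Shears. w \<in> (\<lambda>C. C + J) ` Rich} = card Rich"
      by (simp add: card_image)
  qed (use Base_facts finS add_subgroup_Low in auto)
  also have "(\<Prod>J\<in>Shears. card (?K ((\<lambda>C. C + J) ` Rich \<inter> Shears))) = card (?K Rich) ^ card Shears"
  proof -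
    have "(\<Prod>J\<in>Shears. card (?K ((\<lambda>C. C + J) ` Rich \<inter> Shears))) = (\<Prod>J\<in>Shears. card (?K Rich))"
    proof (rule prod.cong[OF refl])
      fix J assume J: "J \<in> Shears"
      then have "(\<lambda>C. C + J) ` Rich \<inter> Shears = (\<lambda>C. C + J) ` Rich" using Rich by auto
      then show "card (?K ((\<lambda>C. C + J) ` Rich \<inter> Shears)) = card (?K Rich)"
        using card_shifted_shears[OF Suc.prems Rich J] by simp
    qed
    then show ?thesis by simp
  qed
  also have "?K Shears = Base e" by (rule Inter_Low[OF Suc.prems])
  finally have frac: "card (?K Rich) ^ card Shears * card (Base (Suc e)) ^ card Rich
      \<le> card (Base (Suc e)) ^ card Shears * card (Base e) ^ card Rich" .
  have Fine_Base: "Fine e \<subseteq> Base e" for e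
  proof -
    have "mult_space d b a (\<lambda>p. \<mu> p) \<subseteq> mult_space d b a (\<lambda>_. m1)"
      by (rule mult_space_mono) (use m12 in simp)
    then show ?thesis by blast
  qed
  have Base_K: "Base e \<subseteq> ?K Rich"
    using Inter_Low[OF Suc.prems] Rich by blast
  \<comment> \<open>Passing to leading forms: \<open>Fine (e + 1) / Fine e\<close> embeds into \<open>?K Rich / Base e\<close>.\<close>
  have "card (Fine (Suc e)) * card (?K Rich \<inter> Base e) \<le> card (?K Rich) * card (Fine (Suc e) \<inter> Base e)"
  proof (rule card_Int_subgroup_le)
    show "Fine (Suc e) \<subseteq> ?K Rich"
      using Fine_Base[of "Suc e"] Fine_subset_Low[OF Suc.prems] by blast
  qed (use Base_facts add_subgroup_Low in \<open>auto intro!: add_subgroup_Int add_subgroup_INT add_subgroup_mult_space add_subgroup_polys\<close>)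
  moreover have "?K Rich \<inter> Base e = Base e" using Base_K by blast
  moreover have "Fine (Suc e) \<inter> Base e = Fine e" using Fine_Base polys_mono[of e "Suc e" b a] by auto
  ultimately have step: "card (Fine (Suc e)) * card (Base e) \<le> card (?K Rich) * card (Fine e)" by simp
  show ?case
    by (rule power_cancel_chain[OF Base_facts(3) step frac]) (use Suc in auto)
qed

end

section \<open>The Kakeya inequality for rich shears\<close>

lemma card_field_ge_2: "2 \<le> CARD('f::{field,finite})"
proof -
  have "card {0, 1 :: 'f} \<le> CARD('f)" by (rule card_mono) auto
  then show ?thesis by simp
qed

lemma mon_in_keys_shift:
  assumes "r \<in> mon_in (\<lambda>\<alpha>. keys \<alpha> \<subseteq> A)"
  shows "shift v r \<in> mon_in (\<lambda>\<alpha>. keys \<alpha> \<subseteq> A)"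
proof -
  let ?R = "mon_in (\<lambda>\<alpha>. keys \<alpha> \<subseteq> A) :: 'a upoly set"
  have mult: "r * s \<in> ?R" if "r \<in> ?R" "s \<in> ?R" for r s
    by (rule mon_in_mult[OF that]) (rule keys_plus_subset)
  have pow: "r ^ n \<in> ?R" if "r \<in> ?R" for r n
  proof (induction n)
    case 0
    show ?case by (simp add: mon_in_def)
  next
    case (Suc n)
    then show ?case unfolding power_Suc by (intro mult that)
  qed
  have mono: "shifted_monomial v \<alpha> \<in> ?R" if "keys \<alpha> \<subseteq> A" for \<alpha>
  proof -
    have *: "(\<Prod>l\<in>L. (Var l + Const (v l)) ^ lookup \<alpha> l) \<in> ?R" if "finite L" "L \<subseteq> A" for L
      using that
    proof (induction L rule: finite_induct)
      case (insert l L)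
      have "Var l + Const (v l) \<in> ?R"
        unfolding Var_def Const_def
        by (intro mon_in_add; rule mon_in_single) (use insert.prems in auto)
      with insert show ?case by (simp add: mult pow)
    qed (simp add: mon_in_def)
    show ?thesis unfolding shifted_monomial_def by (rule *[OF finite_keys that])
  qed
  have *: "(\<Sum>\<alpha>\<in>L. Const (lookup r \<alpha>) * shifted_monomial v \<alpha>) \<in> ?R" if "L \<subseteq> keys r" for L
    using finite_subset[OF that finite_keys] that
  proof (induction L rule: finite_induct)
    case (insert \<alpha> L)
    have "keys \<alpha> \<subseteq> A" using insert.prems assms by (auto simp: mon_in_def)
    moreover have "Const (lookup r \<alpha>) \<in> ?R" unfolding Const_def by (rule mon_in_single) simp
    ultimately have "Const (lookup r \<alpha>) * shifted_monomial v \<alpha> \<in> ?R"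
      using mult mono by blast
    with insert show ?case by (simp add: mon_in_add)
  qed simp
  show ?thesis unfolding shift_def by (rule *[OF subset_refl])
qed

text \<open>
  The Taylor coefficients at the points, as linear functionals: their vanishing for exponents below \<open>m\<close> is
  vanishing to order \<open>m\<close>.
\<close>

definition jet :: "nat \<Rightarrow> (nat list \<Rightarrow> 'f::field upoly) \<Rightarrow> ('f vec \<times> 'f vec) \<times> (nat list \<times> (nat \<Rightarrow>\<^sub>0 nat)) \<Rightarrow> 'f" where
  "jet N P = (\<lambda>((y, u), (\<beta>, \<alpha>)).
     lookup (translate N (map Const (list_of_vec y)) (\<lambda>\<beta>. shift (($) u) (P \<beta>)) \<beta>) \<alpha>)"

lemma jet_diff: "jet N (P - Q) i = jet N P i - jet N Q i"
  by (simp add: jet_def split_def shift_diff translate_diff lookup_minus)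

lemma keys_jet:
  assumes "P \<in> polys b a e" "y \<in> carrier_vec b" "length \<beta> = b" "jet N P ((y, u), (\<beta>, \<alpha>)) \<noteq> 0"
  shows "keys \<alpha> \<subseteq> {..<a}"
proof -
  let ?R = "mon_in (\<lambda>\<alpha>. keys \<alpha> \<subseteq> {..<a}) :: 'a upoly set"
  have "translate N (map Const (list_of_vec y)) (\<lambda>\<beta>. shift (($) u) (P \<beta>)) \<beta> \<in> ?R"
  proof (rule translate_filtration[where F = "\<lambda>_. ?R"])
    show "z * x \<in> ?R" if "z \<in> set (map Const (list_of_vec y))" "x \<in> ?R" for z x
    proof (rule mon_in_mult[where P = "\<lambda>\<alpha>. keys \<alpha> \<subseteq> {..<a}", OF _ that(2)])
      show "z \<in> ?R" using that(1) unfolding Const_def by (auto intro: mon_in_single)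
    qed (rule keys_plus_subset)
    show "shift (($) u) (P \<gamma>) \<in> ?R" if "length \<gamma> = length (map Const (list_of_vec y))" for \<gamma>
      using polysD[OF assms(1), of \<gamma>] that assms(2)
      by (intro mon_in_keys_shift) (auto simp: Deg_def elim: mon_in_mono)
  qed (use assms in \<open>auto simp: mon_in_add\<close>)
  then show ?thesis using assms(4) by (auto simp: jet_def dest: mon_inD)
qed

lemma vanishes_if_jet_0:
  assumes "P \<in> polys b a e" "y \<in> carrier_vec b" "u \<in> carrier_vec a"
    and "\<And>i. i \<in> exponents b a m \<Longrightarrow> jet N P ((y, u), i) = 0"
  shows "vanishes N m y u P"
  unfolding vanishes_def Ord_def
proof (intro allI impI mon_inI)
  fix \<beta> :: "nat list" and \<alpha>
  assume \<beta>: "length \<beta> = dim_vec y"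
    and nz: "lookup (translate N (map Const (list_of_vec y)) (\<lambda>\<beta>. shift (($) u) (P \<beta>)) \<beta>) \<alpha> \<noteq> 0"
  then have j: "jet N P ((y, u), (\<beta>, \<alpha>)) \<noteq> 0" by (simp add: jet_def)
  have b: "length \<beta> = b" using \<beta> assms(2) by simp
  have "(\<beta>, \<alpha>) \<notin> exponents b a m" using j assms(4) by blast
  with keys_jet[OF assms(1,2) b j] b show "int m - int (sum_list \<beta>) \<le> int (mdeg \<alpha>)"
    by (auto simp: exponents_def)
qed

lemma jet_0_if_vanishes:
  assumes "vanishes N m y u P" "y \<in> carrier_vec b" "i \<in> exponents b a m"
  shows "jet N P ((y, u), i) = 0"
proof (rule ccontr)
  obtain \<beta> \<alpha> where i: "i = (\<beta>, \<alpha>)" by (cases i)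
  assume "jet N P ((y, u), i) \<noteq> 0"
  then have nz: "lookup (translate N (map Const (list_of_vec y)) (\<lambda>\<beta>. shift (($) u) (P \<beta>)) \<beta>) \<alpha> \<noteq> 0"
    by (simp add: jet_def i)
  have "length \<beta> = dim_vec y" using assms(2,3) by (simp add: i exponents_def)
  then have "int m - int (sum_list \<beta>) \<le> int (mdeg \<alpha>)"
    using assms(1) mon_inD[OF _ nz] unfolding vanishes_def Ord_def by blast
  then show False using assms(3) by (simp add: i exponents_def)
qed

text \<open>
  Compare dimensions.  All polynomials of degree below \<open>d\<close> satisfying the \<open>q\<^sup>k |exponents m1|\<close> base
  conditions form a space of at least the obvious dimension; adding \<open>|D| (|exponents m2| - |exponents m1|)\<close>
  conditions leaves the fine space, whose codimension is at least the proportion of rich shears times the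
  dimension of the base space by \<open>card_Fine_power_le\<close>.
\<close>

theorem kakeya_counting:
  fixes D :: "('f::{field,finite} vec \<times> 'f vec) set"
  assumes D: "D \<subseteq> carrier_vec b \<times> carrier_vec a"
    and m12: "m1 \<le> m2" and d: "d \<le> l * CARD('f) ^ a"
    and big: "\<And>j. j < l \<Longrightarrow> j < d \<Longrightarrow>
      (d - 1 - j) * CARD('f) ^ a < (t * (m2 - j) + (CARD('f) ^ a - t) * (m1 - j)) * CARD('f)"
    and zero: "\<And>j. j < l \<Longrightarrow> 0 < t * (m2 - j) + (CARD('f) ^ a - t) * (m1 - j)"
  shows "card (rich_shears b a t D) * card (exponents b a d)
    \<le> card (carrier_mat b a :: 'f mat set) * (card D * (card (exponents b a m2) - card (exponents b a m1)))
      + card (rich_shears b a t D) * (CARD('f) ^ (b + a) * card (exponents b a m1))"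
proof -
  let ?q = "CARD('f)" and ?c = "\<lambda>m. card (exponents b a m)"
  let ?n = "card (carrier_mat b a :: 'f mat set)" and ?R = "card (rich_shears b a t D)"
  let ?pts = "carrier_vec b \<times> carrier_vec a :: ('f vec \<times> 'f vec) set"
  let ?V = "polys b a d :: (nat list \<Rightarrow> 'f upoly) set"
  let ?B = "mult_space d b a (\<lambda>_. m1) \<inter> ?V"
  let ?F = "mult_space d b a (\<lambda>p. if p \<in> D then m2 else m1) \<inter> ?V"
  define x y where "x = card ?B" and "y = card ?F"
  have finV: "finite ?V" by (rule card_polys)
  have fin_pts: "finite ?pts" by (simp add: finite_carrier_vec)
  have finD: "finite D" by (rule finite_subset[OF D fin_pts])
  have subB: "add_subgroup ?B" and subF: "add_subgroup ?F"
    by (intro add_subgroup_Int add_subgroup_mult_space add_subgroup_polys)+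
  have y0: "y > 0" using add_subgroup_0[OF subF] finV unfolding y_def by (subst card_gt_0_iff) blast
  have chain: "y ^ ?n * x ^ ?R \<le> x ^ ?n"
    using card_Fine_power_le[OF m12 d big zero, of d] unfolding x_def y_def by simp
  have "?q ^ ?c d = card ?V" by (simp add: card_polys)
  also have "\<dots> \<le> card {P \<in> ?V. \<forall>i\<in>?pts \<times> exponents b a m1. jet d P i = 0} * ?q ^ card (?pts \<times> exponents b a m1)"
    by (rule card_le_card_kernel_conditions)
       (use finV fin_pts finite_exponents[of b a m1] jet_diff add_subgroup_polys in auto)
  also have "{P \<in> ?V. \<forall>i\<in>?pts \<times> exponents b a m1. jet d P i = 0} \<subseteq> ?B"
    by (auto simp: mult_space_def intro!: vanishes_if_jet_0)
  then have "card {P \<in> ?V. \<forall>i\<in>?pts \<times> exponents b a m1. jet d P i = 0} \<le> x"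
    unfolding x_def using finV by (intro card_mono) auto
  also have "card (?pts \<times> exponents b a m1) = ?q ^ (b + a) * ?c m1"
    by (simp add: card_cartesian_product card_carrier_vec power_add)
  finally have 1: "?q ^ ?c d \<le> x * ?q ^ (?q ^ (b + a) * ?c m1)" by simp
  let ?I = "D \<times> (exponents b a m2 - exponents b a m1)"
  have "x \<le> card {P \<in> ?B. \<forall>i\<in>?I. jet d P i = 0} * ?q ^ card ?I"
    unfolding x_def
    by (rule card_le_card_kernel_conditions)
       (use finV finD finite_exponents[of b a m2] jet_diff subB in auto)
  also have "{P \<in> ?B. \<forall>i\<in>?I. jet d P i = 0} \<subseteq> ?F"
  proof
    fix P assume P: "P \<in> {P \<in> ?B. \<forall>i\<in>?I. jet d P i = 0}"
    have "vanishes d m2 v u P" if vu: "(v, u) \<in> D" for v u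
    proof (rule vanishes_if_jet_0)
      show "v \<in> carrier_vec b" "u \<in> carrier_vec a" "P \<in> polys b a d" using vu D P by auto
      fix i assume "i \<in> exponents b a m2"
      show "jet d P ((v, u), i) = 0"
      proof (cases "i \<in> exponents b a m1")
        case True
        have "vanishes d m1 v u P" using P D vu by (auto simp: mult_space_def)
        with True show ?thesis using D vu by (auto intro: jet_0_if_vanishes)
      next
        case False
        with \<open>i \<in> exponents b a m2\<close> P vu show ?thesis by auto
      qed
    qed
    with P show "P \<in> ?F" by (auto simp: mult_space_def)
  qed
  then have "card {P \<in> ?B. \<forall>i\<in>?I. jet d P i = 0} \<le> y"
    unfolding y_def using finV by (intro card_mono) auto
  also have "card ?I = card D * (?c m2 - ?c m1)"
    using exponents_mono[OF m12, of b a] by (simp add: card_cartesian_product card_Diff_subset finite_exponents)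
  finally have 2: "x \<le> y * ?q ^ (card D * (?c m2 - ?c m1))" by simp
  have "y ^ ?n * x ^ ?R \<le> (y * ?q ^ (card D * (?c m2 - ?c m1))) ^ ?n"
    using chain power_mono[OF 2, of ?n] by simp
  then have "y ^ ?n * x ^ ?R \<le> y ^ ?n * ?q ^ (?n * (card D * (?c m2 - ?c m1)))"
    by (simp add: power_mult_distrib flip: power_mult add: mult.commute)
  then have 3: "x ^ ?R \<le> ?q ^ (?n * (card D * (?c m2 - ?c m1)))" using y0 by simp
  have "?q ^ (?R * ?c d) = (?q ^ ?c d) ^ ?R" by (simp add: power_mult mult.commute flip: power_mult)
  also have "\<dots> \<le> (x * ?q ^ (?q ^ (b + a) * ?c m1)) ^ ?R" by (rule power_mono[OF 1]) simp
  also have "\<dots> = x ^ ?R * ?q ^ (?R * (?q ^ (b + a) * ?c m1))"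
    by (simp add: power_mult_distrib mult.commute flip: power_mult)
  also have "\<dots> \<le> ?q ^ (?n * (card D * (?c m2 - ?c m1))) * ?q ^ (?R * (?q ^ (b + a) * ?c m1))"
    by (rule mult_right_mono[OF 3]) simp
  finally have "?q ^ (?R * ?c d) \<le> ?q ^ (?n * (card D * (?c m2 - ?c m1)) + ?R * (?q ^ (b + a) * ?c m1))"
    by (simp add: power_add)
  moreover have "1 < ?q" using card_field_ge_2[where 'f = 'f] by simp
  ultimately show ?thesis by (rule power_le_imp_le_exp[rotated])
qed

section \<open>Asymptotic choice of multiplicities\<close>

lemma tendsto_card_exponents:
  fixes s :: "nat \<Rightarrow> nat"
  assumes "(\<lambda>n. real (s n) / real n) \<longlonglongrightarrow> \<sigma>" "b + a = k" "k > 0"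
  shows "(\<lambda>n. real (card (exponents b a (s n))) / real n ^ k) \<longlonglongrightarrow> \<sigma> ^ k / fact k"
proof -
  have eq: "real (card (exponents b a (s n))) = (\<Prod>i<k. real (s n) + real i) / fact k" for n
  proof -
    have "real (card (exponents b a (s n))) = real (s n + k - 1) gchoose k"
      using assms by (simp add: card_exponents binomial_gbinomial)
    also have "\<dots> = (\<Prod>i<k. real (s n) + real i) / fact k"
      using assms(3) by (simp add: gbinomial_pochhammer' pochhammer_prod atLeast0LessThan of_nat_diff)
    finally show ?thesis .
  qed
  have "(\<lambda>n. (\<Prod>i<k. real (s n) / real n + real i / real n) / fact k) \<longlonglongrightarrow> (\<Prod>i<k. \<sigma> + 0) / fact k"
    by (intro tendsto_intros assms(1)) auto
  then have lim: "(\<lambda>n. (\<Prod>i<k. real (s n) / real n + real i / real n) / fact k) \<longlonglongrightarrow> \<sigma> ^ k / fact k"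
    by simp
  have "real (card (exponents b a (s n))) / real n ^ k = (\<Prod>i<k. real (s n) / real n + real i / real n) / fact k" for n
    by (simp add: eq prod_dividef flip: add_divide_distrib)
  with lim show ?thesis by simp
qed

lemma tendsto_ceiling_linear: "(\<lambda>n. real (nat \<lceil>c * real n\<rceil>) / real n) \<longlonglongrightarrow> c" if "c \<ge> 0"
proof (rule tendsto_sandwich)
  show "eventually (\<lambda>n. c \<le> real (nat \<lceil>c * real n\<rceil>) / real n) sequentially"
    using eventually_gt_at_top[of "0::nat"]
  proof eventually_elim
    case (elim n)
    have "c * real n \<le> real (nat \<lceil>c * real n\<rceil>)" by linarith
    then show ?case using elim by (simp add: field_simps)
  qed
  show "eventually (\<lambda>n. real (nat \<lceil>c * real n\<rceil>) / real n \<le> c + 1 / real n) sequentially"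
    using eventually_gt_at_top[of "0::nat"]
  proof eventually_elim
    case (elim n)
    have "0 \<le> c * real n" using that by simp
    then have "real (nat \<lceil>c * real n\<rceil>) \<le> c * real n + 1" by linarith
    then show ?case using elim by (simp add: field_simps)
  qed
  show "(\<lambda>n. c + 1 / real n) \<longlonglongrightarrow> c" using tendsto_add[OF tendsto_const lim_1_over_n, of c] by simp
qed simp

lemma tendsto_floor_linear: "(\<lambda>n. real (nat \<lfloor>c * real n\<rfloor>) / real n) \<longlonglongrightarrow> c" if "c \<ge> 0"
proof (rule tendsto_sandwich)
  show "eventually (\<lambda>n. real (nat \<lfloor>c * real n\<rfloor>) / real n \<le> c) sequentially"
    using eventually_gt_at_top[of "0::nat"]
  proof eventually_elim
    case (elim n)
    have "0 \<le> c * real n" using that by simp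
    then have "real (nat \<lfloor>c * real n\<rfloor>) \<le> c * real n" by linarith
    then show ?case using elim by (simp add: field_simps)
  qed
  show "eventually (\<lambda>n. c - 1 / real n \<le> real (nat \<lfloor>c * real n\<rfloor>) / real n) sequentially"
    using eventually_gt_at_top[of "0::nat"]
  proof eventually_elim
    case (elim n)
    have "c * real n - 1 \<le> real (nat \<lfloor>c * real n\<rfloor>)" by linarith
    then have "(c * real n - 1) / real n \<le> real (nat \<lfloor>c * real n\<rfloor>) / real n" by (rule divide_right_mono) simp
    then show ?case using elim by (simp add: diff_divide_distrib)
  qed
  show "(\<lambda>n. c - 1 / real n) \<longlonglongrightarrow> c" using tendsto_diff[OF tendsto_const lim_1_over_n, of c] by simp
qed simp

lemma tendsto_multiple: "(\<lambda>n. real (f n) / real n) \<longlonglongrightarrow> c \<Longrightarrow> (\<lambda>n. real (f n * m) / real n) \<longlonglongrightarrow> c * real m"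
  using tendsto_mult[of "\<lambda>n. real (f n) / real n" c sequentially "\<lambda>_. real m" "real m"] by simp

text \<open>
  Take \<open>m1 = 0\<close>, \<open>d = l q\<^sup>a\<close> and the smallest \<open>m2\<close> that makes \<open>kakeya_counting\<close> applicable, and let \<open>l\<close> tend
  to infinity.  Both sides grow like the \<open>k\<close>-th power of \<open>l\<close>.
\<close>

theorem kakeya_power_bound:
  fixes D :: "('f::{field,finite} vec \<times> 'f vec) set" and \<gamma> :: real
  defines "q \<equiv> CARD('f)"
  assumes D: "D \<subseteq> carrier_vec b \<times> carrier_vec a" and a: "a \<ge> 1"
    and \<gamma>: "0 < \<gamma>" "\<gamma> \<le> 1" and t: "\<gamma> * real q ^ a \<le> real t"
  shows "real (card (rich_shears b a t D)) * real q ^ (b + a)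
    \<le> real (card (carrier_mat b a :: 'f mat set)) * real (card D) * ((real q ^ a + real q - 1) / (\<gamma> * real q ^ a)) ^ (b + a)"
proof -
  define k where "k = b + a"
  have k: "k > 0" using a by (simp add: k_def)
  have q: "q \<ge> 2" unfolding q_def by (rule card_field_ge_2)
  \<comment> \<open>The limit of \<open>m2 / l\<close>: a flat with \<open>\<gamma> q\<^sup>a\<close> points forces order \<open>l\<close> if \<open>\<gamma> q (m2 - j) \<ge> d - j\<close> for \<open>j < l\<close>.\<close>
  define c where "c = (real q ^ a + real q - 1) / (\<gamma> * real q)"
  define m where "m l = nat \<lceil>c * real l\<rceil>" for l
  let ?R = "real (card (rich_shears b a t D))" and ?n = "real (card (carrier_mat b a :: 'f mat set))"
  have qa: "real q \<le> real q ^ a" using a q self_le_power[of "real q" a] by simp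
  have c1: "1 \<le> c"
  proof -
    have "\<gamma> * real q \<le> real q" using \<gamma> q by (simp add: mult_le_cancel_right1)
    also have "\<dots> \<le> real q ^ a + real q - 1" using qa q by simp
    finally show ?thesis using \<gamma> q by (simp add: c_def)
  qed
  have cm: "c * real l \<le> real (m l)" for l unfolding m_def by linarith
  have lm: "l \<le> m l" for l
  proof -
    have "real l \<le> c * real l" using c1 mult_right_mono[of 1 c "real l"] by simp
    with cm[of l] show ?thesis by linarith
  qed
  have tpos: "t > 0"
  proof -
    have "0 < \<gamma> * real q ^ a" using \<gamma> q by simp
    with t show ?thesis by (cases t) auto
  qed
  have ineq: "?R * real (card (exponents b a (l * q ^ a))) \<le> ?n * real (card D) * real (card (exponents b a (m l)))" for l
  proof -
    have "card (rich_shears b a t D) * card (exponents b a (l * CARD('f) ^ a))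
      \<le> card (carrier_mat b a :: 'f mat set) * (card D * (card (exponents b a (m l)) - card (exponents b a 0)))
        + card (rich_shears b a t D) * (CARD('f) ^ (b + a) * card (exponents b a 0))"
    proof (rule kakeya_counting[OF D])
      fix j assume j: "j < l"
      show "0 < t * (m l - j) + (CARD('f) ^ a - t) * (0 - j)"
        using tpos lm[of l] j by simp
      assume j': "j < l * CARD('f) ^ a"
      have "real q * real j \<ge> \<gamma> * real q * real j" using \<gamma> by (intro mult_right_mono mult_left_le_one_le) auto
      moreover have "\<gamma> * real q * (c * real l) = (real q ^ a + real q - 1) * real l"
        using \<gamma> q by (simp add: c_def)
      moreover have "\<gamma> * real q * (c * real l) \<le> \<gamma> * real q * real (m l)"
        using cm[of l] \<gamma> by (intro mult_left_mono) auto
      moreover have "(real q - 1) * real j \<le> (real q - 1) * real l" using j q by (intro mult_left_mono) auto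
      ultimately have 1: "real (l * q ^ a) - real j \<le> \<gamma> * real q * (real (m l) - real j)"
        by (simp add: algebra_simps)
      have "real ((l * q ^ a - 1 - j) * q ^ a) < (real (l * q ^ a) - real j) * real q ^ a"
        using j' q by (simp add: of_nat_diff q_def)
      also have "\<dots> \<le> \<gamma> * real q * (real (m l) - real j) * real q ^ a"
        using 1 by (intro mult_right_mono) auto
      also have "\<dots> = \<gamma> * real q ^ a * ((real (m l) - real j) * real q)" by simp
      also have "\<dots> \<le> real t * ((real (m l) - real j) * real q)"
        using t lm[of l] j by (intro mult_right_mono) auto
      also have "\<dots> = real (t * (m l - j) * q)" using lm[of l] j by (simp add: of_nat_diff)
      finally have "(l * q ^ a - 1 - j) * q ^ a < t * (m l - j) * q" by linarith
      then show "(l * CARD('f) ^ a - 1 - j) * CARD('f) ^ a < (t * (m l - j) + (CARD('f) ^ a - t) * (0 - j)) * CARD('f)"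
        by (simp add: q_def)
    qed auto
    then have "real (card (rich_shears b a t D) * card (exponents b a (l * q ^ a)))
        \<le> real (card (carrier_mat b a :: 'f mat set) * (card D * card (exponents b a (m l))))"
      by (subst of_nat_le_iff) (simp add: exponents_def q_def)
    then show ?thesis by (simp add: mult.assoc)
  qed
  have "(\<lambda>l. real l / real l) \<longlonglongrightarrow> 1"
    by (rule tendsto_eventually) (use eventually_gt_at_top[of "0::nat"] in eventually_elim, simp)
  then have "(\<lambda>l. real (l * q ^ a) / real l) \<longlonglongrightarrow> 1 * real (q ^ a)" by (rule tendsto_multiple)
  then have L: "(\<lambda>l. ?R * (real (card (exponents b a (l * q ^ a))) / real l ^ k)) \<longlonglongrightarrow> ?R * ((1 * real (q ^ a)) ^ k / fact k)"
    by (intro tendsto_mult tendsto_const tendsto_card_exponents k) (simp_all add: k_def)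
  have "(\<lambda>l. real (m l) / real l) \<longlonglongrightarrow> c" unfolding m_def by (rule tendsto_ceiling_linear) (use c1 in simp)
  then have U: "(\<lambda>l. ?n * real (card D) * (real (card (exponents b a (m l))) / real l ^ k)) \<longlonglongrightarrow> ?n * real (card D) * (c ^ k / fact k)"
    by (intro tendsto_mult tendsto_const tendsto_card_exponents k) (simp_all add: k_def)
  have "?R * ((1 * real (q ^ a)) ^ k / fact k) \<le> ?n * real (card D) * (c ^ k / fact k)"
  proof (rule LIMSEQ_le[OF L U], intro exI allI impI)
    fix l :: nat
    show "?R * (real (card (exponents b a (l * q ^ a))) / real l ^ k) \<le> ?n * real (card D) * (real (card (exponents b a (m l))) / real l ^ k)"
      using divide_right_mono[OF ineq[of l], of "real l ^ k"] by simp
  qed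
  then have *: "?R * (real q ^ a) ^ k \<le> ?n * real (card D) * c ^ k"
    by (simp add: divide_le_cancel)
  have "?R * real q ^ k = ?R * (real q ^ a) ^ k * (real q / real q ^ a) ^ k"
    using q by (simp add: power_divide)
  also have "\<dots> \<le> ?n * real (card D) * c ^ k * (real q / real q ^ a) ^ k"
    using * by (intro mult_right_mono) auto
  also have "\<dots> = ?n * real (card D) * (c * (real q / real q ^ a)) ^ k" by (simp only: power_mult_distrib mult.assoc)
  also have "c * (real q / real q ^ a) = (real q ^ a + real q - 1) / (\<gamma> * real q ^ a)"
    using q by (simp add: c_def)
  finally show ?thesis by (simp add: k_def)
qed

text \<open>
  Let \<open>m1 = N\<close> tend to infinity, with \<open>m2\<close> about \<open>(1 + \<rho>) N\<close>.  On a rich flat the average order is about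
  \<open>(1 + \<gamma> \<rho>) N\<close>, which permits the degree \<open>v q N\<close> with \<open>v\<close> close to
  \<open>(1 + \<gamma> \<rho>) / (1 + \<epsilon>)\<close>; the loss \<open>\<epsilon> = 1 / q\<^sup>a\<^sup>-\<^sup>1\<close> is the price of order \<open>l\<close>
  across the flat.  In the limit, the proportion of rich shears is at most the density of \<open>D\<close> times
  \<open>((1 + \<rho>)\<^sup>k - 1) / (v\<^sup>k - 1)\<close>.  Small \<open>\<rho>\<close> makes this nearly \<open>\<rho> / (v - 1)\<close>, and
  \<open>\<gamma> \<rho> = 8 \<epsilon>\<close> keeps \<open>v - 1\<close> comparable to \<open>\<gamma> \<rho>\<close>.
\<close>

theorem kakeya_exponential_bound:
  fixes D :: "('f::{field,finite} vec \<times> 'f vec) set" and \<gamma> :: real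
  defines "q \<equiv> CARD('f)"
  assumes D: "D \<subseteq> carrier_vec b \<times> carrier_vec a" and a: "a \<ge> 1"
    and \<gamma>: "0 < \<gamma>" "\<gamma> \<le> 1" and t: "\<gamma> * real q ^ a \<le> real t" "t \<le> q ^ a"
    and x: "\<gamma> * real q ^ (a - 1) \<ge> 8"
  shows "real (card (rich_shears b a t D)) * real q ^ (b + a)
    \<le> real (card (carrier_mat b a :: 'f mat set)) * real (card D)
        * (16 / (7 * \<gamma>) * exp (8 * real (b + a) / (\<gamma> * real q ^ (a - 1))))"
proof -
  define k where "k = b + a"
  have k: "k > 0" using a by (simp add: k_def)
  have q: "q \<ge> 2" unfolding q_def by (rule card_field_ge_2)
  define \<epsilon> where "\<epsilon> = 1 / real q ^ (a - 1)"
  define \<rho> where "\<rho> = 8 * \<epsilon> / \<gamma>"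
  \<comment> \<open>The largest ratio \<open>l / N\<close> for which the orders on a rich flat suffice.\<close>
  define c where "c = real q * (1 + 8 * \<epsilon>) / (real q ^ a + real q - 1)"
  define m where "m N = N + nat \<lceil>\<rho> * real N\<rceil>" for N
  define l where "l N = nat \<lfloor>c * real N\<rfloor>" for N
  let ?R = "real (card (rich_shears b a t D))" and ?n = "real (card (carrier_mat b a :: 'f mat set))"
  have qa: "real q ^ a = real q * real q ^ (a - 1)" using a by (cases a) auto
  have Q: "real q ^ (a - 1) \<ge> 8"
  proof -
    have "\<gamma> * real q ^ (a - 1) \<le> real q ^ (a - 1)" using \<gamma> q by (simp add: mult_le_cancel_right1)
    with x show ?thesis by simp
  qed
  have \<epsilon>: "0 < \<epsilon>" "\<epsilon> \<le> 1 / 8" using Q q by (simp_all add: \<epsilon>_def field_simps)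
  have \<rho>: "0 < \<rho>" "\<gamma> * \<rho> = 8 * \<epsilon>" using \<epsilon> \<gamma> by (simp_all add: \<rho>_def)
  have den: "0 < real q ^ a + real q - 1"
  proof -
    have "0 < real q ^ a" using q by simp
    with q show ?thesis by linarith
  qed
  have c: "0 < c" using q \<epsilon> den by (simp add: c_def)
  have c1: "c \<le> 1"
  proof -
    have "real q * 8 \<le> real q ^ a" unfolding qa using Q q by (intro mult_left_mono) auto
    moreover have "real q * (1 + 8 * \<epsilon>) \<le> real q * 2" using \<epsilon> q by (intro mult_left_mono) auto
    moreover have "real q \<ge> 2" using q by simp
    ultimately have "real q * (1 + 8 * \<epsilon>) \<le> real q ^ a + real q - 1" by linarith
    then show ?thesis using den by (simp add: c_def)
  qed
  have lc: "real (l N) \<le> c * real N" for N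
  proof -
    have "0 \<le> c * real N" using c by simp
    then show ?thesis unfolding l_def by linarith
  qed
  have lN: "l N \<le> N" for N
  proof -
    have "c * real N \<le> real N" using c1 mult_right_mono[of c 1 "real N"] by simp
    with lc[of N] show ?thesis by linarith
  qed
  have mN: "N \<le> m N" for N by (simp add: m_def)
  have tpos: "t > 0"
  proof -
    have "0 < \<gamma> * real q ^ a" using \<gamma> q by simp
    with t show ?thesis by (cases t) auto
  qed
  let ?c = "\<lambda>s. real (card (exponents b a s))"
  have ineq: "?R * ?c (l N * q ^ a) \<le> ?n * real (card D) * (?c (m N) - ?c N) + ?R * (real q ^ k * ?c N)" for N
  proof -
    have "card (rich_shears b a t D) * card (exponents b a (l N * CARD('f) ^ a))
      \<le> card (carrier_mat b a :: 'f mat set) * (card D * (card (exponents b a (m N)) - card (exponents b a N)))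
        + card (rich_shears b a t D) * (CARD('f) ^ (b + a) * card (exponents b a N))"
    proof (rule kakeya_counting[OF D mN])
      fix j assume j: "j < l N"
      then have jN: "j < N" using lN[of N] by simp
      show "0 < t * (m N - j) + (CARD('f) ^ a - t) * (N - j)"
        using tpos mN[of N] jN by simp
      assume j': "j < l N * CARD('f) ^ a"
      have 0: "\<rho> * real N \<le> real (m N) - real N" by (simp add: m_def) linarith
      have "real (l N) * (real q ^ a + real q - 1) \<le> c * real N * (real q ^ a + real q - 1)"
        using lc[of N] den by (intro mult_right_mono) auto
      also have "\<dots> = real q * (1 + 8 * \<epsilon>) * real N" using den by (simp add: c_def)
      finally have "real (l N) * (real q ^ a + real q - 1) \<le> real q * (1 + \<gamma> * \<rho>) * real N" by (simp add: \<rho>)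
      moreover have "(real q - 1) * real j \<le> (real q - 1) * real (l N)" using j q by (intro mult_left_mono) auto
      ultimately have 1: "real (l N * q ^ a) - real j \<le> real q * ((real N - real j) + \<gamma> * (\<rho> * real N))"
        by (simp add: algebra_simps)
      have "real ((l N * q ^ a - 1 - j) * q ^ a) < (real (l N * q ^ a) - real j) * real q ^ a"
        using j' q by (simp add: of_nat_diff q_def)
      also have "\<dots> \<le> real q * ((real N - real j) + \<gamma> * (\<rho> * real N)) * real q ^ a"
        using 1 by (intro mult_right_mono) auto
      also have "\<dots> = (real q ^ a * (real N - real j) + \<gamma> * real q ^ a * (\<rho> * real N)) * real q"
        by (simp add: algebra_simps)
      also have "\<dots> \<le> (real q ^ a * (real N - real j) + real t * (real (m N) - real N)) * real q"
        using t(1) 0 \<rho> \<gamma> by (intro mult_right_mono add_left_mono mult_mono) auto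
      also have "\<dots> = (real t * (real (m N) - real j) + (real q ^ a - real t) * (real N - real j)) * real q"
        by (simp add: algebra_simps)
      also have "\<dots> = real ((t * (m N - j) + (q ^ a - t) * (N - j)) * q)"
        using jN mN[of N] t(2) by (simp add: of_nat_diff)
      finally have "(l N * q ^ a - 1 - j) * q ^ a < (t * (m N - j) + (q ^ a - t) * (N - j)) * q" by linarith
      then show "(l N * CARD('f) ^ a - 1 - j) * CARD('f) ^ a < (t * (m N - j) + (CARD('f) ^ a - t) * (N - j)) * CARD('f)"
        by (simp add: q_def)
    qed auto
    then have "real (card (rich_shears b a t D) * card (exponents b a (l N * q ^ a)))
        \<le> real (card (carrier_mat b a :: 'f mat set) * (card D * (card (exponents b a (m N)) - card (exponents b a N)))
        + card (rich_shears b a t D) * (q ^ k * card (exponents b a N)))"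
      by (subst of_nat_le_iff) (simp add: q_def k_def)
    moreover have "card (exponents b a N) \<le> card (exponents b a (m N))"
      by (rule card_mono[OF finite_exponents exponents_mono[OF mN]])
    ultimately show ?thesis by (simp add: of_nat_diff mult.assoc)
  qed
  have id: "(\<lambda>N. real N / real N) \<longlonglongrightarrow> 1"
    by (rule tendsto_eventually) (use eventually_gt_at_top[of "0::nat"] in eventually_elim, simp)
  have kab: "b + a = k" by (simp add: k_def)
  have lim_l: "(\<lambda>N. ?c (l N * q ^ a) / real N ^ k) \<longlonglongrightarrow> (c * real (q ^ a)) ^ k / fact k"
    unfolding l_def by (intro tendsto_card_exponents[OF _ kab k] tendsto_multiple tendsto_floor_linear) (use c in simp)
  have "(\<lambda>N. real N / real N + real (nat \<lceil>\<rho> * real N\<rceil>) / real N) \<longlonglongrightarrow> 1 + \<rho>"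
    by (intro tendsto_add id tendsto_ceiling_linear) (use \<rho> in simp)
  then have lim_m: "(\<lambda>N. ?c (m N) / real N ^ k) \<longlonglongrightarrow> (1 + \<rho>) ^ k / fact k"
    unfolding m_def by (intro tendsto_card_exponents[OF _ kab k]) (simp add: add_divide_distrib)
  have lim_N: "(\<lambda>N. ?c N / real N ^ k) \<longlonglongrightarrow> 1 ^ k / fact k"
    by (rule tendsto_card_exponents[OF id kab k])
  have "?R * ((c * real (q ^ a)) ^ k / fact k)
      \<le> ?n * real (card D) * ((1 + \<rho>) ^ k / fact k - 1 ^ k / fact k) + ?R * (real q ^ k * (1 ^ k / fact k))"
  proof (rule LIMSEQ_le)
    show "(\<lambda>N. ?R * (?c (l N * q ^ a) / real N ^ k)) \<longlonglongrightarrow> ?R * ((c * real (q ^ a)) ^ k / fact k)"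
      by (intro tendsto_mult tendsto_const lim_l)
    show "(\<lambda>N. ?n * real (card D) * (?c (m N) / real N ^ k - ?c N / real N ^ k) + ?R * (real q ^ k * (?c N / real N ^ k)))
      \<longlonglongrightarrow> ?n * real (card D) * ((1 + \<rho>) ^ k / fact k - 1 ^ k / fact k) + ?R * (real q ^ k * (1 ^ k / fact k))"
      by (intro tendsto_intros lim_m lim_N)
    show "\<exists>N0. \<forall>N\<ge>N0. ?R * (?c (l N * q ^ a) / real N ^ k)
      \<le> ?n * real (card D) * (?c (m N) / real N ^ k - ?c N / real N ^ k) + ?R * (real q ^ k * (?c N / real N ^ k))"
    proof (intro exI allI impI)
      fix N :: nat
      show "?R * (?c (l N * q ^ a) / real N ^ k)
        \<le> ?n * real (card D) * (?c (m N) / real N ^ k - ?c N / real N ^ k) + ?R * (real q ^ k * (?c N / real N ^ k))"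
        using divide_right_mono[OF ineq[of N], of "real N ^ k"]
        by (simp add: add_divide_distrib flip: diff_divide_distrib)
    qed
  qed
  then have "?R * (c * real (q ^ a)) ^ k / fact k
      \<le> (?n * real (card D) * ((1 + \<rho>) ^ k - 1) + ?R * real q ^ k) / fact k"
    by (simp add: add_divide_distrib diff_divide_distrib right_diff_distrib)
  then have main: "?R * (c * real q ^ a) ^ k \<le> ?n * real (card D) * ((1 + \<rho>) ^ k - 1) + ?R * real q ^ k"
    by (simp add: divide_le_cancel)
  define v where "v = c * real q ^ a / real q"
  have v: "v - 1 \<ge> 7 / 2 * \<epsilon>"
  proof -
    have "v = (1 + 8 * \<epsilon>) * (real q ^ a / (real q ^ a + real q - 1))"
      using q by (simp add: v_def c_def)
    also have "real q ^ a / (real q ^ a + real q - 1) \<ge> 1 / (1 + \<epsilon>)"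
    proof -
      have "real q ^ a * (1 + \<epsilon>) = real q ^ a + real q" using q by (simp add: qa \<epsilon>_def field_simps)
      then show ?thesis using den \<epsilon> by (simp add: field_simps)
    qed
    then have "(1 + 8 * \<epsilon>) * (real q ^ a / (real q ^ a + real q - 1)) \<ge> (1 + 8 * \<epsilon>) * (1 / (1 + \<epsilon>))"
      using \<epsilon> by (intro mult_left_mono) auto
    moreover have "(1 + 8 * \<epsilon>) * (1 / (1 + \<epsilon>)) \<ge> 1 + 7 / 2 * \<epsilon>"
    proof -
      have "\<epsilon> * \<epsilon> \<le> \<epsilon> * 1" using \<epsilon> by (intro mult_left_mono) auto
      then show ?thesis using \<epsilon> by (simp add: field_simps)
    qed
    ultimately show ?thesis by linarith
  qed
  have "1 + real k * (v - 1) \<le> (1 + (v - 1)) ^ k" by (rule Bernoulli_inequality) (use v \<epsilon> in linarith)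
  moreover have "real k * (7 / 2 * \<epsilon>) \<le> real k * (v - 1)" using v by (intro mult_left_mono) auto
  ultimately have vk: "7 / 2 * \<epsilon> * real k \<le> v ^ k - 1" by (simp add: algebra_simps)
  have rk: "(1 + \<rho>) ^ k - 1 \<le> real k * \<rho> * exp (real k * \<rho>)"
  proof -
    have "(1 + \<rho>) ^ k \<le> exp \<rho> ^ k" using \<rho> exp_ge_add_one_self[of \<rho>] by (intro power_mono) auto
    also have "\<dots> = exp (real k * \<rho>)" by (simp add: exp_of_nat_mult)
    finally have 1: "(1 + \<rho>) ^ k \<le> exp (real k * \<rho>)" .
    have "1 - real k * \<rho> \<le> exp (- (real k * \<rho>))" using exp_ge_add_one_self[of "- (real k * \<rho>)"] by simp
    then have "(1 - real k * \<rho>) * exp (real k * \<rho>) \<le> exp (- (real k * \<rho>)) * exp (real k * \<rho>)"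
      by (intro mult_right_mono) auto
    then have "exp (real k * \<rho>) - 1 \<le> real k * \<rho> * exp (real k * \<rho>)"
      by (simp add: algebra_simps flip: exp_add)
    with 1 show ?thesis by linarith
  qed
  have "?R * (c * real q ^ a) ^ k = ?R * real q ^ k * v ^ k"
    using q by (simp add: v_def power_divide)
  then have "?R * real q ^ k * v ^ k \<le> ?n * real (card D) * ((1 + \<rho>) ^ k - 1) + ?R * real q ^ k"
    using main by (simp only:)
  then have "?R * real q ^ k * (v ^ k - 1) \<le> ?n * real (card D) * ((1 + \<rho>) ^ k - 1)"
    unfolding right_diff_distrib[of "?R * real q ^ k"] mult_1_right by linarith
  also have "\<dots> \<le> ?n * real (card D) * (real k * \<rho> * exp (real k * \<rho>))"
    by (rule mult_left_mono[OF rk]) simp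
  finally have "?R * real q ^ k * (7 / 2 * \<epsilon> * real k) \<le> ?n * real (card D) * (real k * \<rho> * exp (real k * \<rho>))"
    using mult_left_mono[OF vk, of "?R * real q ^ k"] by simp
  also have "\<dots> = ?n * real (card D) * (16 / (7 * \<gamma>) * exp (real k * \<rho>)) * (7 / 2 * \<epsilon> * real k)"
    using \<gamma> by (simp add: \<rho>_def)
  finally have "?R * real q ^ k \<le> ?n * real (card D) * (16 / (7 * \<gamma>) * exp (real k * \<rho>))"
    by (rule mult_right_le_imp_le) (use \<epsilon> k in simp)
  moreover have "real k * \<rho> = 8 * real (b + a) / (\<gamma> * real q ^ (a - 1))"
    by (simp add: \<rho>_def \<epsilon>_def k_def mult.commute)
  ultimately show ?thesis by (simp only: k_def)
qed

section \<open>Second moments of random matrices\<close>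

text \<open>
  A uniformly random matrix sends a fixed nonzero vector to a uniformly random one: all fibres of
  \<open>M \<mapsto> M w\<close> are translates of each other, and none is empty.
\<close>

lemma card_mat_fibre:
  fixes w :: "'f::{field,finite} vec"
  assumes w: "w \<in> carrier_vec n" "w \<noteq> 0\<^sub>v n" and y: "y \<in> carrier_vec b"
  shows "card {M \<in> carrier_mat b n. M *\<^sub>v w = y} * CARD('f) ^ b = card (carrier_mat b n :: 'f mat set)"
proof -
  obtain j where j: "j < n" "w $ j \<noteq> 0" using w by (metis eq_vecI carrier_vecD index_zero_vec)
  have hit: "\<exists>M0\<in>carrier_mat b n. M0 *\<^sub>v w = z" if z: "z \<in> carrier_vec b" for z
  proof
    let ?M0 = "mat b n (\<lambda>(i, l). if l = j then z $ i / w $ j else 0)"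
    show "?M0 \<in> carrier_mat b n" by simp
    show "?M0 *\<^sub>v w = z"
    proof (rule eq_vecI)
      fix i assume "i < dim_vec z"
      then have i: "i < b" using z by simp
      have "(?M0 *\<^sub>v w) $ i = (\<Sum>l\<in>{0..<n}. (if l = j then z $ i / w $ j else 0) * w $ l)"
        using i w by (simp add: scalar_prod_def)
      also have "\<dots> = (\<Sum>l\<in>{0..<n}. if l = j then z $ i else 0)"
        by (rule sum.cong) (use j in auto)
      finally have "(?M0 *\<^sub>v w) $ i = (\<Sum>l\<in>{0..<n}. if l = j then z $ i else 0)" .
      then show "(?M0 *\<^sub>v w) $ i = z $ i" using j by simp
    qed (use z in simp)
  qed
  have fibre: "card {M \<in> carrier_mat b n. M *\<^sub>v w = z} = card {M \<in> carrier_mat b n. M *\<^sub>v w = 0\<^sub>v b}"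
    if z: "z \<in> carrier_vec b" for z
  proof -
    obtain M0 where M0: "M0 \<in> carrier_mat b n" "M0 *\<^sub>v w = z" using hit[OF z] by blast
    have "bij_betw (\<lambda>M. M - M0) {M \<in> carrier_mat b n. M *\<^sub>v w = z} {M \<in> carrier_mat b n. M *\<^sub>v w = 0\<^sub>v b}"
    proof (rule bij_betw_byWitness[where f' = "\<lambda>M. M + M0"])
      show "\<forall>M\<in>{M \<in> carrier_mat b n. M *\<^sub>v w = z}. M - M0 + M0 = M"
        using M0 by (auto intro!: eq_matI)
      show "\<forall>M\<in>{M \<in> carrier_mat b n. M *\<^sub>v w = 0\<^sub>v b}. M + M0 - M0 = M"
        using M0 by (auto intro!: eq_matI)
      show "(\<lambda>M. M - M0) ` {M \<in> carrier_mat b n. M *\<^sub>v w = z} \<subseteq> {M \<in> carrier_mat b n. M *\<^sub>v w = 0\<^sub>v b}"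
        using M0 w z by (auto simp: minus_mult_distrib_mat_vec[where nr = b and nc = n] minus_carrier_mat)
      show "(\<lambda>M. M + M0) ` {M \<in> carrier_mat b n. M *\<^sub>v w = 0\<^sub>v b} \<subseteq> {M \<in> carrier_mat b n. M *\<^sub>v w = z}"
        using M0 w z by (auto simp: add_mult_distrib_mat_vec[where nr = b and nc = n])
    qed
    then show ?thesis by (rule bij_betw_same_card)
  qed
  have "(\<lambda>M. M *\<^sub>v w) ` (carrier_mat b n :: 'f mat set) = carrier_vec b"
  proof (rule subset_antisym)
    show "(\<lambda>M. M *\<^sub>v w) ` (carrier_mat b n :: 'f mat set) \<subseteq> carrier_vec b" using w by auto
    show "carrier_vec b \<subseteq> (\<lambda>M. M *\<^sub>v w) ` (carrier_mat b n :: 'f mat set)" using hit by blast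
  qed
  moreover have "card (carrier_mat b n :: 'f mat set)
      = card {M \<in> carrier_mat b n. M *\<^sub>v w = 0\<^sub>v b} * card ((\<lambda>M. M *\<^sub>v w) ` (carrier_mat b n :: 'f mat set))"
  proof (rule card_eq_card_fibres[OF finite_carrier_mat])
    fix z assume "z \<in> (\<lambda>M. M *\<^sub>v w) ` (carrier_mat b n :: 'f mat set)"
    then have "z \<in> carrier_vec b" using w by auto
    then show "card {M \<in> carrier_mat b n. M *\<^sub>v w = z} = card {M \<in> carrier_mat b n. M *\<^sub>v w = 0\<^sub>v b}"
      by (rule fibre)
  qed
  ultimately show ?thesis using fibre[OF y] by (simp add: card_carrier_vec)
qed

lemma mult_mat_vec_eq_iff:
  fixes M :: "'f::field mat"
  assumes "M \<in> carrier_mat b n" "x \<in> carrier_vec n" "x' \<in> carrier_vec n"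
  shows "M *\<^sub>v x = M *\<^sub>v x' \<longleftrightarrow> M *\<^sub>v (x - x') = 0\<^sub>v b"
proof -
  have "M *\<^sub>v (x - x') = M *\<^sub>v x - M *\<^sub>v x'" by (rule mult_minus_distrib_mat_vec[OF assms])
  moreover have "v = v' \<longleftrightarrow> v - v' = 0\<^sub>v b" if vc: "v \<in> carrier_vec b" "v' \<in> carrier_vec b" for v v' :: "'f vec"
  proof
    assume 0: "v - v' = 0\<^sub>v b"
    have "v $ i = v' $ i" if i: "i < b" for i
    proof -
      have "(v - v') $ i = 0" using 0 i by simp
      moreover have "(v - v') $ i = v $ i - v' $ i" using i vc by simp
      ultimately show ?thesis by simp
    qed
    then show "v = v'" using that by (intro eq_vecI) simp_all
  next
    assume "v = v'"
    then show "v - v' = 0\<^sub>v b" using that by simp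
  qed
  moreover have "M *\<^sub>v x \<in> carrier_vec b" "M *\<^sub>v x' \<in> carrier_vec b" using assms by simp_all
  ultimately show ?thesis by metis
qed

lemma card_mat_collision:
  fixes x :: "'f::{field,finite} vec"
  assumes "x \<in> carrier_vec n" "x' \<in> carrier_vec n" "x \<noteq> x'"
  shows "card {M \<in> carrier_mat b n. M *\<^sub>v x = M *\<^sub>v x'} * CARD('f) ^ b = card (carrier_mat b n :: 'f mat set)"
proof -
  have "x - x' \<noteq> 0\<^sub>v n"
  proof
    assume 0: "x - x' = 0\<^sub>v n"
    have "x $ i = x' $ i" if i: "i < n" for i
    proof -
      have "(x - x') $ i = 0" using 0 i by simp
      moreover have "(x - x') $ i = x $ i - x' $ i" using i assms by simp
      ultimately show ?thesis by simp
    qed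
    then have "x = x'" using assms by (intro eq_vecI) simp_all
    with assms show False by simp
  qed
  moreover have "{M \<in> carrier_mat b n. M *\<^sub>v x = M *\<^sub>v x'} = {M \<in> carrier_mat b n. M *\<^sub>v (x - x') = 0\<^sub>v b}"
    using mult_mat_vec_eq_iff[OF _ assms(1,2)] by blast
  ultimately show ?thesis using card_mat_fibre[of "x - x'" n "0\<^sub>v b" b] assms by simp
qed

text \<open>
  The variance bound behind both applications of Chebyshev's inequality, for a family of maps \<open>f \<omega>\<close>
  under which distinct points collide with probability \<open>1 / |Y|\<close>.
\<close>

lemma second_moment_bound:
  fixes f :: "'w \<Rightarrow> 'x \<Rightarrow> 'y"
  assumes fin: "finite W" "finite S" "finite Y" and f: "\<And>\<omega> x. \<omega> \<in> W \<Longrightarrow> x \<in> S \<Longrightarrow> f \<omega> x \<in> Y"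
    and Y: "card Y > 0"
    and coll: "\<And>x x'. x \<in> S \<Longrightarrow> x' \<in> S \<Longrightarrow> x \<noteq> x' \<Longrightarrow> card {\<omega> \<in> W. f \<omega> x = f \<omega> x'} * card Y = card W"
  shows "(\<Sum>\<omega>\<in>W. \<Sum>y\<in>Y. (real (card {x \<in> S. f \<omega> x = y}) - real (card S) / real (card Y))\<^sup>2) \<le> real (card W) * real (card S)"
proof -
  let ?s = "real (card S)" and ?c = "real (card Y)"
  let ?N = "\<lambda>\<omega> y. real (card {x \<in> S. f \<omega> x = y})"
  have N: "?N \<omega> y = (\<Sum>x\<in>S. if f \<omega> x = y then 1 else 0)" for \<omega> y
    using fin by (simp add: sum.If_cases Int_def)
  have sumN: "(\<Sum>y\<in>Y. ?N \<omega> y) = ?s" if "\<omega> \<in> W" for \<omega>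
    unfolding N by (subst sum.swap) (use fin f that in simp)
  have sumN2: "(\<Sum>y\<in>Y. (?N \<omega> y)\<^sup>2) = (\<Sum>x\<in>S. \<Sum>x'\<in>S. if f \<omega> x = f \<omega> x' then 1 else 0)" if "\<omega> \<in> W" for \<omega>
  proof -
    have "(\<Sum>y\<in>Y. (?N \<omega> y)\<^sup>2) = (\<Sum>y\<in>Y. \<Sum>x\<in>S. \<Sum>x'\<in>S. if f \<omega> x = y then (if f \<omega> x' = y then 1 else 0) else 0)"
      unfolding N power2_eq_square sum_product by (intro sum.cong refl) auto
    also have "\<dots> = (\<Sum>x\<in>S. \<Sum>x'\<in>S. \<Sum>y\<in>Y. if f \<omega> x = y then (if f \<omega> x' = y then 1 else 0) else 0)"
      by (subst sum.swap) (rule sum.cong[OF refl], rule sum.swap)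
    also have "\<dots> = (\<Sum>x\<in>S. \<Sum>x'\<in>S. if f \<omega> x = f \<omega> x' then 1 else 0)"
      by (intro sum.cong refl) (use fin f that in auto)
    finally show ?thesis .
  qed
  have var: "(\<Sum>y\<in>Y. (?N \<omega> y - ?s / ?c)\<^sup>2) = (\<Sum>y\<in>Y. (?N \<omega> y)\<^sup>2) - ?s\<^sup>2 / ?c" if "\<omega> \<in> W" for \<omega>
  proof -
    have "(\<Sum>y\<in>Y. (?N \<omega> y - ?s / ?c)\<^sup>2) = (\<Sum>y\<in>Y. (?N \<omega> y)\<^sup>2 + (?s / ?c)\<^sup>2 - 2 * (?s / ?c) * ?N \<omega> y)"
      by (simp add: power2_diff mult_ac)
    also have "\<dots> = (\<Sum>y\<in>Y. (?N \<omega> y)\<^sup>2) + ?c * (?s / ?c)\<^sup>2 - 2 * (?s / ?c) * (\<Sum>y\<in>Y. ?N \<omega> y)"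
      by (simp add: sum.distrib sum_subtractf sum_distrib_left)
    also have "\<dots> = (\<Sum>y\<in>Y. (?N \<omega> y)\<^sup>2) - ?s\<^sup>2 / ?c"
      unfolding sumN[OF that] using Y by (simp add: power2_eq_square)
    finally show ?thesis .
  qed
  have pair: "(\<Sum>\<omega>\<in>W. if f \<omega> x = f \<omega> x' then 1 else 0) = (if x = x' then real (card W) - real (card W) / ?c else 0) + real (card W) / ?c"
    if "x \<in> S" "x' \<in> S" for x x'
  proof -
    have "(\<Sum>\<omega>\<in>W. if f \<omega> x = f \<omega> x' then 1 else 0) = real (card {\<omega> \<in> W. f \<omega> x = f \<omega> x'})"
      using fin by (simp add: sum.If_cases Int_def)
    moreover have "real (card {\<omega> \<in> W. f \<omega> x = f \<omega> x'}) = real (card W) / ?c" if "x \<noteq> x'"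
      using coll[OF \<open>x \<in> S\<close> \<open>x' \<in> S\<close> that] Y by (simp add: field_simps flip: of_nat_mult)
    ultimately show ?thesis by auto
  qed
  have "(\<Sum>\<omega>\<in>W. \<Sum>y\<in>Y. (?N \<omega> y)\<^sup>2) = (\<Sum>\<omega>\<in>W. \<Sum>x\<in>S. \<Sum>x'\<in>S. if f \<omega> x = f \<omega> x' then 1 else 0)"
    by (intro sum.cong refl sumN2)
  also have "\<dots> = (\<Sum>x\<in>S. \<Sum>x'\<in>S. \<Sum>\<omega>\<in>W. if f \<omega> x = f \<omega> x' then 1 else 0)"
    by (subst sum.swap) (rule sum.cong[OF refl], rule sum.swap)
  also have "\<dots> = (\<Sum>x\<in>S. \<Sum>x'\<in>S. (if x = x' then real (card W) - real (card W) / ?c else 0) + real (card W) / ?c)"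
    by (intro sum.cong refl pair)
  also have "\<dots> = ?s * (real (card W) - real (card W) / ?c) + ?s * (?s * (real (card W) / ?c))"
    using fin by (simp add: sum.distrib distrib_left)
  finally have tot: "(\<Sum>\<omega>\<in>W. \<Sum>y\<in>Y. (?N \<omega> y)\<^sup>2) = ?s * (real (card W) - real (card W) / ?c) + ?s * (?s * (real (card W) / ?c))" .
  have "(\<Sum>\<omega>\<in>W. \<Sum>y\<in>Y. (?N \<omega> y - ?s / ?c)\<^sup>2) = (\<Sum>\<omega>\<in>W. \<Sum>y\<in>Y. (?N \<omega> y)\<^sup>2) - real (card W) * (?s\<^sup>2 / ?c)"
    by (simp add: var sum_subtractf)
  also have "\<dots> = real (card W) * ?s - real (card W) * ?s / ?c"
    unfolding tot by (simp add: algebra_simps power2_eq_square)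
  also have "\<dots> \<le> real (card W) * ?s" by simp
  finally show ?thesis .
qed

definition cell_count :: "'f::field vec set \<Rightarrow> 'f mat \<Rightarrow> 'f mat \<Rightarrow> 'f vec \<times> 'f vec \<Rightarrow> nat" where
  "cell_count S L M p = card {x \<in> S. (L *\<^sub>v x, M *\<^sub>v x) = p}"

text \<open>
  The threshold \<open>\<tau> E / 2\<close> is halfway between typical cells and the average cell of an
  unbalanced fibre.
\<close>

definition deviating_cells :: "'f::field vec set \<Rightarrow> nat \<Rightarrow> nat \<Rightarrow> real \<Rightarrow> real \<Rightarrow> 'f mat \<Rightarrow> 'f mat \<Rightarrow> ('f vec \<times> 'f vec) set" where
  "deviating_cells S b a E \<tau> L M =
     {p \<in> carrier_vec b \<times> carrier_vec a. \<bar>real (cell_count S L M p) - E\<bar> \<ge> \<tau> * E / 2}"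

lemma sum_card_deviating_cells:
  fixes S :: "'f::{field,finite} vec set"
  assumes S: "S \<subseteq> carrier_vec n" and E: "E = real (card S) / real CARD('f) ^ (b + a)" and E0: "E > 0" and \<tau>: "\<tau> > 0"
  shows "(\<Sum>(L, M)\<in>carrier_mat b n \<times> carrier_mat a n. real (card (deviating_cells S b a E \<tau> L M)))
    \<le> real (card (carrier_mat b n :: 'f mat set)) * real (card (carrier_mat a n :: 'f mat set))
        * real CARD('f) ^ (b + a) * (4 / (\<tau>\<^sup>2 * E))"
proof -
  let ?q = "CARD('f)"
  let ?W = "carrier_mat b n \<times> carrier_mat a n :: ('f mat \<times> 'f mat) set"
  let ?Y = "carrier_vec b \<times> carrier_vec a :: ('f vec \<times> 'f vec) set"
  let ?f = "\<lambda>(L, M) x. (L *\<^sub>v x, M *\<^sub>v x)"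
  have finS: "finite S" using S finite_carrier_vec finite_subset by blast
  have cY: "card ?Y = ?q ^ (b + a)" by (simp add: card_cartesian_product card_carrier_vec power_add)
  have finY: "finite ?Y" by (simp add: finite_carrier_vec)
  have "(\<Sum>\<omega>\<in>?W. \<Sum>y\<in>?Y. (real (card {x \<in> S. ?f \<omega> x = y}) - real (card S) / real (card ?Y))\<^sup>2) \<le> real (card ?W) * real (card S)"
  proof (rule second_moment_bound)
    show "?f \<omega> x \<in> ?Y" if "\<omega> \<in> ?W" "x \<in> S" for \<omega> x
      using that S by auto
    fix x x' assume x: "x \<in> S" "x' \<in> S" "x \<noteq> x'"
    have "{\<omega> \<in> ?W. ?f \<omega> x = ?f \<omega> x'} = {L \<in> carrier_mat b n. L *\<^sub>v x = L *\<^sub>v x'} \<times> {M \<in> carrier_mat a n. M *\<^sub>v x = M *\<^sub>v x'}"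
      by auto
    then have "card {\<omega> \<in> ?W. ?f \<omega> x = ?f \<omega> x'} * card ?Y
      = (card {L \<in> carrier_mat b n. L *\<^sub>v x = L *\<^sub>v x'} * ?q ^ b) * (card {M \<in> carrier_mat a n. M *\<^sub>v x = M *\<^sub>v x'} * ?q ^ a)"
      by (simp add: card_cartesian_product card_carrier_vec)
    also have "\<dots> = card ?W"
      using card_mat_collision[of x n x' b] card_mat_collision[of x n x' a] x S by (simp add: card_cartesian_product subset_iff)
    finally show "card {\<omega> \<in> ?W. ?f \<omega> x = ?f \<omega> x'} * card ?Y = card ?W" .
  qed (use finS finY finite_carrier_mat cY in auto)
  then have sm: "(\<Sum>(L, M)\<in>?W. \<Sum>p\<in>?Y. (real (cell_count S L M p) - E)\<^sup>2) \<le> real (card ?W) * (E * real ?q ^ (b + a))"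
    by (simp add: cell_count_def split_def cY E)
  have "(\<Sum>(L, M)\<in>?W. real (card (deviating_cells S b a E \<tau> L M)) * (\<tau> * E / 2)\<^sup>2)
      \<le> (\<Sum>(L, M)\<in>?W. \<Sum>p\<in>?Y. (real (cell_count S L M p) - E)\<^sup>2)"
  proof (rule sum_mono, clarify)
    fix L M
    let ?D = "deviating_cells S b a E \<tau> L M"
    have "real (card ?D) * (\<tau> * E / 2)\<^sup>2 = (\<Sum>p\<in>?D. (\<tau> * E / 2)\<^sup>2)" by simp
    also have "\<dots> \<le> (\<Sum>p\<in>?D. (real (cell_count S L M p) - E)\<^sup>2)"
    proof (rule sum_mono)
      fix p assume "p \<in> ?D"
      then have "\<bar>\<tau> * E / 2\<bar> \<le> \<bar>real (cell_count S L M p) - E\<bar>"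
        using \<tau> E0 by (simp add: deviating_cells_def)
      then show "(\<tau> * E / 2)\<^sup>2 \<le> (real (cell_count S L M p) - E)\<^sup>2" by (simp only: abs_le_square_iff)
    qed
    also have "\<dots> \<le> (\<Sum>p\<in>?Y. (real (cell_count S L M p) - E)\<^sup>2)"
      by (rule sum_mono2[OF finY]) (auto simp: deviating_cells_def)
    finally show "real (card ?D) * (\<tau> * E / 2)\<^sup>2 \<le> (\<Sum>p\<in>?Y. (real (cell_count S L M p) - E)\<^sup>2)" .
  qed
  also note sm
  finally have "(\<Sum>(L, M)\<in>?W. real (card (deviating_cells S b a E \<tau> L M))) * (\<tau> * E / 2)\<^sup>2 \<le> real (card ?W) * (E * real ?q ^ (b + a))"
    by (simp add: split_def sum_distrib_right)
  moreover have pos: "0 < (\<tau> * E / 2)\<^sup>2" using \<tau> E0 by simp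
  ultimately have "(\<Sum>(L, M)\<in>?W. real (card (deviating_cells S b a E \<tau> L M))) \<le> real (card ?W) * (E * real ?q ^ (b + a)) / (\<tau> * E / 2)\<^sup>2"
    by (simp add: pos_le_divide_eq)
  also have "\<dots> = real (card ?W) * real ?q ^ (b + a) * (4 / (\<tau>\<^sup>2 * E))"
    using \<tau> E0 by (simp add: field_simps power2_eq_square)
  finally show ?thesis by (simp add: card_cartesian_product)
qed

section \<open>From unbalanced matrices to rich shears\<close>

text \<open>
  Let \<open>s\<close> be the average count over the cells of an unbalanced fibre.  A cell that does not deviate has a count
  \<open>N\<close> at distance more than \<open>\<tau> E / 2\<close> from \<open>s\<close>; for large \<open>s\<close> this distance grows with \<open>s\<close>.  So
  such a cell contributes at least \<open>\<tau>\<^sup>2 E / (4 (1 + \<tau>))\<close> times the mean \<open>s\<close> to the variance,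
  which itself has expectation at most \<open>s\<close> per cell.
\<close>

lemma deviation_ratio:
  fixes s E \<tau> :: real
  assumes "E > 0" "\<tau> > 0" "s \<ge> 0" and out: "s < (1 - \<tau>) * E \<or> (1 + \<tau>) * E < s"
    and N: "\<bar>N - E\<bar> < \<tau> * E / 2"
  shows "s \<le> 4 * (1 + \<tau>) / (\<tau>\<^sup>2 * E) * (N - s)\<^sup>2"
proof -
  have "s * (\<tau>\<^sup>2 * E) \<le> 4 * (1 + \<tau>) * (N - s)\<^sup>2"
    using out
  proof
    assume s: "s < (1 - \<tau>) * E"
    have "s < E - \<tau> * E" using s by (simp add: algebra_simps)
    then have "\<tau> * E / 2 \<le> N - s" using N by linarith
    then have "(\<tau> * E / 2)\<^sup>2 \<le> (N - s)\<^sup>2" using assms by (intro power_mono) auto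
    then have "(\<tau> * E)\<^sup>2 \<le> 4 * (N - s)\<^sup>2" by (simp add: power_divide)
    also have "\<dots> \<le> 4 * (1 + \<tau>) * (N - s)\<^sup>2" using assms by (intro mult_right_mono) auto
    finally have 1: "(\<tau> * E)\<^sup>2 \<le> 4 * (1 + \<tau>) * (N - s)\<^sup>2" .
    have "(1 - \<tau>) * E \<le> 1 * E" using assms by (intro mult_right_mono) auto
    with s have "s \<le> E" by simp
    then have "s * (\<tau>\<^sup>2 * E) \<le> E * (\<tau>\<^sup>2 * E)" using assms by (intro mult_right_mono) auto
    with 1 show ?thesis by (simp add: power2_eq_square mult_ac)
  next
    assume s: "(1 + \<tau>) * E < s"
    define \<delta> where "\<delta> = s - (1 + \<tau>) * E"
    have \<delta>: "\<delta> > 0" "s = (1 + \<tau>) * E + \<delta>" using s by (simp_all add: \<delta>_def)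
    have "s = E + \<tau> * E + \<delta>" by (simp add: \<delta>(2) algebra_simps)
    then have "\<tau> * E / 2 + \<delta> \<le> s - N" using N by linarith
    then have "(\<tau> * E / 2 + \<delta>)\<^sup>2 \<le> (s - N)\<^sup>2" using assms \<delta> by (intro power_mono) auto
    then have 2: "4 * (1 + \<tau>) * (\<tau> * E / 2 + \<delta>)\<^sup>2 \<le> 4 * (1 + \<tau>) * (N - s)\<^sup>2"
      using assms by (intro mult_left_mono) (auto simp: power2_commute)
    have "4 * (1 + \<tau>) * (\<tau> * E / 2 + \<delta>)\<^sup>2 - s * (\<tau>\<^sup>2 * E)
        = \<tau> * E * \<delta> * (4 + 3 * \<tau>) + 4 * (1 + \<tau>) * \<delta>\<^sup>2"
      by (simp add: \<delta>(2) power2_eq_square algebra_simps)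
    also have "\<dots> \<ge> 0" using assms \<delta> by simp
    finally show ?thesis using 2 by linarith
  qed
  then show ?thesis using assms by (simp add: field_simps)
qed

lemma unbalanced_fibre:
  fixes L :: "'f::{field,finite} mat"
  assumes "unbalanced n S b \<tau> L" and S: "S \<subseteq> carrier_vec n"
  obtains y where "y \<in> carrier_vec b"
    "real (card {x \<in> S. L *\<^sub>v x = y}) < (1 - \<tau>) * (real (card S) / real CARD('f) ^ b)
     \<or> (1 + \<tau>) * (real (card S) / real CARD('f) ^ b) < real (card {x \<in> S. L *\<^sub>v x = y})"
proof -
  have "S \<inter> {x \<in> carrier_vec n. L *\<^sub>v x = y} = {x \<in> S. L *\<^sub>v x = y}" for y using S by auto
  with assms(1) that show ?thesis
    unfolding balanced_def Let_def by (auto simp: not_le)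
qed

text \<open>
  By \<open>deviation_ratio\<close> and the variance bound for the points above \<open>y\<close>, the expected proportion of cells above
  \<open>y\<close> that do not deviate is at most \<open>(1 - \<gamma>) / 2\<close>.  By Markov's inequality it exceeds \<open>1 - \<gamma>\<close> for at
  most half of the matrices \<open>M\<close>.
\<close>

lemma half_of_extensions_rich:
  fixes S :: "'f::{field,finite} vec set" and L :: "'f mat"
  assumes S: "S \<subseteq> carrier_vec n" and E: "E = real (card S) / real CARD('f) ^ (b + a)" "E > 0" and \<tau>: "\<tau> > 0"
    and \<gamma>: "\<gamma> = 1 - 8 * (1 + \<tau>) / (\<tau>\<^sup>2 * E)"
    and L: "L \<in> carrier_mat b n" "unbalanced n S b \<tau> L"
  shows "real (card (carrier_mat a n :: 'f mat set)) / 2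
    \<le> real (card {M \<in> carrier_mat a n. \<exists>y\<in>carrier_vec b.
          \<gamma> * real CARD('f) ^ a \<le> real (card {u \<in> carrier_vec a. (y, u) \<in> deviating_cells S b a E \<tau> L M})})"
proof -
  let ?q = "real CARD('f)" and ?W = "carrier_mat a n :: 'f mat set" and ?Y = "carrier_vec a :: 'f vec set"
  have q: "?q > 0" by simp
  have finS: "finite S" using S finite_carrier_vec finite_subset by blast
  obtain y where y: "y \<in> carrier_vec b" and out:
    "real (card {x \<in> S. L *\<^sub>v x = y}) < (1 - \<tau>) * (real (card S) / ?q ^ b)
     \<or> (1 + \<tau>) * (real (card S) / ?q ^ b) < real (card {x \<in> S. L *\<^sub>v x = y})"
    by (rule unbalanced_fibre[OF L(2) S])
  define S' where "S' = {x \<in> S. L *\<^sub>v x = y}"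
  define s where "s = real (card S') / ?q ^ a"
  have mu: "real (card S) / ?q ^ b = E * ?q ^ a" by (simp add: E power_add)
  have out': "s < (1 - \<tau>) * E \<or> (1 + \<tau>) * E < s"
    using out unfolding mu s_def S'_def[symmetric] using q by (simp add: pos_divide_less_eq pos_less_divide_eq mult.assoc)
  have s0: "s \<ge> 0" by (simp add: s_def)
  define B where "B M = {u \<in> ?Y. \<bar>real (cell_count S L M (y, u)) - E\<bar> < \<tau> * E / 2}" for M
  have count: "cell_count S L M (y, u) = card {x \<in> S'. M *\<^sub>v x = u}" for M u
    unfolding cell_count_def S'_def by (rule arg_cong[where f = card]) auto
  define K where "K = 4 * (1 + \<tau>) / (\<tau>\<^sup>2 * E)"
  have K: "K > 0" "2 * K = 1 - \<gamma>" using \<tau> E(2) by (simp_all add: K_def \<gamma>)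
  have "(\<Sum>M\<in>?W. \<Sum>u\<in>?Y. (real (card {x \<in> S'. M *\<^sub>v x = u}) - real (card S') / real (card ?Y))\<^sup>2) \<le> real (card ?W) * real (card S')"
  proof (rule second_moment_bound)
    show "M *\<^sub>v x \<in> ?Y" if "M \<in> ?W" "x \<in> S'" for M x using that S by (auto simp: S'_def)
    show "card {M \<in> ?W. M *\<^sub>v x = M *\<^sub>v x'} * card ?Y = card ?W" if "x \<in> S'" "x' \<in> S'" "x \<noteq> x'" for x x'
      using card_mat_collision[of x n x' a] that S by (auto simp: S'_def card_carrier_vec)
    show "finite S'" using finS by (simp add: S'_def)
    show "card ?Y > 0" by (simp add: card_carrier_vec)
  qed (simp_all add: finite_carrier_mat finite_carrier_vec)
  then have sm: "(\<Sum>M\<in>?W. \<Sum>u\<in>?Y. (real (cell_count S L M (y, u)) - s)\<^sup>2) \<le> real (card ?W) * (s * ?q ^ a)"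
    by (simp add: count s_def card_carrier_vec)
  have pt: "real (card (B M)) * s \<le> K * (\<Sum>u\<in>?Y. (real (cell_count S L M (y, u)) - s)\<^sup>2)" for M
  proof -
    have "real (card (B M)) * s = (\<Sum>u\<in>B M. s)" by simp
    also have "\<dots> \<le> (\<Sum>u\<in>B M. K * (real (cell_count S L M (y, u)) - s)\<^sup>2)"
      by (rule sum_mono) (use deviation_ratio[OF E(2) \<tau> s0 out'] in \<open>simp add: B_def K_def\<close>)
    also have "\<dots> \<le> (\<Sum>u\<in>?Y. K * (real (cell_count S L M (y, u)) - s)\<^sup>2)"
      by (rule sum_mono2) (use K in \<open>auto simp: B_def finite_carrier_vec\<close>)
    finally show ?thesis by (simp add: sum_distrib_left)
  qed
  have sumB: "(\<Sum>M\<in>?W. real (card (B M))) \<le> K * (real (card ?W) * ?q ^ a)"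
  \<comment> \<open>For an empty fibre every cell deviates: \<open>\<tau> < 1\<close>, because the count can only be too small.\<close>
  proof (cases "s = 0")
    case True
    then have "S' = {}" using finS by (simp add: s_def S'_def)
    have "\<tau> * E / 2 \<le> E"
    proof (rule ccontr)
      assume "\<not> \<tau> * E / 2 \<le> E"
      have "s < (1 - \<tau>) * E" using out' True \<tau> E(2) by (auto simp: mult_less_0_iff)
      then have "\<tau> < 1" using True E(2) by (simp add: zero_less_mult_iff)
      then have "\<tau> * E \<le> 1 * E" using E(2) by (intro mult_right_mono) auto
      with \<open>\<not> \<tau> * E / 2 \<le> E\<close> E(2) show False by simp
    qed
    then have "B M = {}" for M using \<open>S' = {}\<close> E(2) by (auto simp: B_def count)
    then show ?thesis using K by simp
  next
    case False
    with s0 have s: "s > 0" by simp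
    have "(\<Sum>M\<in>?W. real (card (B M))) * s \<le> K * (\<Sum>M\<in>?W. \<Sum>u\<in>?Y. (real (cell_count S L M (y, u)) - s)\<^sup>2)"
      unfolding sum_distrib_left sum_distrib_right by (rule sum_mono) (use pt in \<open>simp add: sum_distrib_left\<close>)
    also have "\<dots> \<le> K * (real (card ?W) * (s * ?q ^ a))" using sm K by (intro mult_left_mono) auto
    also have "\<dots> = K * (real (card ?W) * ?q ^ a) * s" by simp
    finally show ?thesis using s by (rule mult_right_le_imp_le)
  qed
  define Big where "Big = {M \<in> ?W. (1 - \<gamma>) * ?q ^ a < real (card (B M))}"
  have "real (card Big) * ((1 - \<gamma>) * ?q ^ a) = (\<Sum>M\<in>Big. (1 - \<gamma>) * ?q ^ a)" by simp
  also have "\<dots> \<le> (\<Sum>M\<in>Big. real (card (B M)))" by (rule sum_mono) (simp add: Big_def)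
  also have "\<dots> \<le> (\<Sum>M\<in>?W. real (card (B M)))"
    by (rule sum_mono2) (auto simp: Big_def finite_carrier_mat)
  also note sumB
  also have "K * (real (card ?W) * ?q ^ a) = real (card ?W) / 2 * ((1 - \<gamma>) * ?q ^ a)"
    unfolding K(2)[symmetric] by simp
  finally have half: "real (card Big) \<le> real (card ?W) / 2"
    by (rule mult_right_le_imp_le) (use K in simp)
  let ?G = "{M \<in> ?W. \<exists>y\<in>carrier_vec b. \<gamma> * ?q ^ a \<le> real (card {u \<in> ?Y. (y, u) \<in> deviating_cells S b a E \<tau> L M})}"
  have "?W - Big \<subseteq> ?G"
  proof
    fix M assume M: "M \<in> ?W - Big"
    have "{u \<in> ?Y. (y, u) \<in> deviating_cells S b a E \<tau> L M} = ?Y - B M"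
      using y by (auto simp: deviating_cells_def B_def)
    moreover have "card (?Y - B M) = CARD('f) ^ a - card (B M)"
      by (subst card_Diff_subset) (auto simp: B_def finite_carrier_vec card_carrier_vec)
    moreover have "card (B M) \<le> CARD('f) ^ a"
      using card_mono[OF finite_carrier_vec, of "B M" a] by (auto simp: B_def card_carrier_vec)
    moreover have "real (card (B M)) \<le> (1 - \<gamma>) * ?q ^ a" using M by (auto simp: Big_def not_less)
    ultimately have "\<gamma> * ?q ^ a \<le> real (card {u \<in> ?Y. (y, u) \<in> deviating_cells S b a E \<tau> L M})"
      by (simp add: of_nat_diff algebra_simps)
    with M y show "M \<in> ?G" by blast
  qed
  then have "card (?W - Big) \<le> card ?G" by (intro card_mono) (auto simp: finite_carrier_mat)
  moreover have "card (?W - Big) = card ?W - card Big"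
    by (rule card_Diff_subset) (auto simp: Big_def finite_carrier_mat intro: finite_subset[OF _ finite_carrier_mat])
  moreover have "card Big \<le> card ?W" by (rule card_mono) (auto simp: Big_def finite_carrier_mat)
  ultimately show ?thesis using half by linarith
qed

lemma deviating_cells_shear:
  fixes L :: "'f::field mat"
  assumes S: "S \<subseteq> carrier_vec n" and L: "L \<in> carrier_mat b n" and M: "M \<in> carrier_mat a n" and C: "C \<in> carrier_mat b a"
    and y: "y \<in> carrier_vec b" and u: "u \<in> carrier_vec a"
  shows "(y, u) \<in> deviating_cells S b a E \<tau> (L - C * M) M \<longleftrightarrow> (y + C *\<^sub>v u, u) \<in> deviating_cells S b a E \<tau> L M"
proof -
  have "(L - C * M) *\<^sub>v x = y \<and> M *\<^sub>v x = u \<longleftrightarrow> L *\<^sub>v x = y + C *\<^sub>v u \<and> M *\<^sub>v x = u" if x: "x \<in> S" for x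
  proof -
    have xc: "x \<in> carrier_vec n" using x S by blast
    have 1: "(L - C * M) *\<^sub>v x = L *\<^sub>v x - C *\<^sub>v (M *\<^sub>v x)"
      using xc L M C by (simp add: minus_mult_distrib_mat_vec[where nr = b and nc = n])
    have 2: "w - z = y \<longleftrightarrow> w = y + z" if "w \<in> carrier_vec b" "z \<in> carrier_vec b" for w z :: "'f vec"
    proof
      assume "w - z = y"
      moreover have "w = (w - z) + z" by (rule eq_vecI) (use that in auto)
      ultimately show "w = y + z" by simp
    next
      assume "w = y + z"
      moreover have "(y + z) - z = y" by (rule eq_vecI) (use that y in auto)
      ultimately show "w - z = y" by simp
    qed
    show ?thesis using 1 2[of "L *\<^sub>v x" "C *\<^sub>v u"] L C xc u by auto
  qed
  then have "cell_count S (L - C * M) M (y, u) = cell_count S L M (y + C *\<^sub>v u, u)"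
    unfolding cell_count_def by (intro arg_cong[where f = card]) auto
  then show ?thesis using y u C by (simp add: deviating_cells_def)
qed

text \<open>
  Count the pairs \<open>(L, M)\<close> that have a rich flat in the direction \<open>C = 0\<close>.  Unbalanced \<open>L\<close> supply at least
  half of their extensions.  For fixed \<open>M\<close> and \<open>C\<close> the map \<open>L \<mapsto> L - C M\<close> is a bijection, so the number of pairs
  does not change if \<open>C = 0\<close> is replaced by another \<open>C\<close>; averaging over all \<open>C\<close> gives the
  number of rich shears, which the Kakeya inequality \<open>kakeya\<close> bounds by the number of deviating cells.
\<close>

lemma card_unbalanced_le:
  fixes S :: "'f::{field,finite} vec set"
  assumes S: "S \<subseteq> carrier_vec n" and E: "E = real (card S) / real CARD('f) ^ (b + a)" "E > 0" and \<tau>: "\<tau> > 0"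
    and \<gamma>: "\<gamma> = 1 - 8 * (1 + \<tau>) / (\<tau>\<^sup>2 * E)" and t: "t = nat \<lceil>\<gamma> * real CARD('f) ^ a\<rceil>"
    and kakeya: "\<And>D :: ('f vec \<times> 'f vec) set. D \<subseteq> carrier_vec b \<times> carrier_vec a \<Longrightarrow>
       real (card (rich_shears b a t D)) * real CARD('f) ^ (b + a)
         \<le> real (card (carrier_mat b a :: 'f mat set)) * real (card D) * K"
    and K: "K \<ge> 0"
  shows "real (card {L \<in> carrier_mat b n. unbalanced n S b \<tau> L})
    \<le> 8 / (\<tau>\<^sup>2 * E) * K * real (card (carrier_mat b n :: 'f mat set))"
proof -
  let ?q = "real CARD('f)"
  let ?A = "carrier_mat b n :: 'f mat set" and ?B = "carrier_mat a n :: 'f mat set" and ?C = "carrier_mat b a :: 'f mat set"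
  let ?D = "deviating_cells S b a E \<tau>"
  define good where "good L M \<longleftrightarrow> (\<exists>y\<in>carrier_vec b. t \<le> card {u \<in> carrier_vec a. (y, u) \<in> ?D L M})" for L M :: "'f mat"
  define U where "U = {L \<in> ?A. unbalanced n S b \<tau> L}"
  have finA: "finite ?A" and finB: "finite ?B" and finC: "finite ?C" by (rule finite_carrier_mat)+
  have finU: "finite U" using finA by (simp add: U_def)
  have nonempty: "card ?B > 0" "card ?C > 0"
    using zero_carrier_mat[of a n] zero_carrier_mat[of b a] finB finC by (auto simp: card_gt_0_iff)
  have shear: "good (L - C * M) M \<longleftrightarrow> C \<in> rich_shears b a t (?D L M)" if "L \<in> ?A" "M \<in> ?B" "C \<in> ?C" for L M C
  proof -
    have "{u \<in> carrier_vec a. (y, u) \<in> ?D (L - C * M) M} = {u \<in> carrier_vec a. (y + C *\<^sub>v u, u) \<in> ?D L M}"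
      if "y \<in> carrier_vec b" for y
      using deviating_cells_shear[OF S \<open>L \<in> ?A\<close> \<open>M \<in> ?B\<close> \<open>C \<in> ?C\<close> that] by auto
    then show ?thesis using that(3) by (auto simp: good_def rich_shears_def)
  qed
  have swap: "card {L \<in> ?A. good (L - C * M) M} = card {L \<in> ?A. good L M}" if "M \<in> ?B" "C \<in> ?C" for M C
  proof (rule bij_betw_same_card)
    have CM: "C * M \<in> ?A" using that by simp
    show "bij_betw (\<lambda>L. L - C * M) {L \<in> ?A. good (L - C * M) M} {L \<in> ?A. good L M}"
    proof (rule bij_betw_byWitness[where f' = "\<lambda>L. L + C * M"])
      have "L - X + X = L" "L + X - X = L" if "L \<in> ?A" "X \<in> ?A" for L X
        using that by (auto intro!: eq_matI)
      from this[OF _ CM] have 1: "L - C * M + C * M = L" "L + C * M - C * M = L" if "L \<in> ?A" for L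
        using that by blast+
      show "\<forall>L\<in>{L \<in> ?A. good (L - C * M) M}. L - C * M + C * M = L" using 1 by blast
      show "\<forall>L\<in>{L \<in> ?A. good L M}. L + C * M - C * M = L" using 1 by blast
      show "(\<lambda>L. L - C * M) ` {L \<in> ?A. good (L - C * M) M} \<subseteq> {L \<in> ?A. good L M}"
        using CM by (auto simp: minus_carrier_mat)
      show "(\<lambda>L. L + C * M) ` {L \<in> ?A. good L M} \<subseteq> {L \<in> ?A. good (L - C * M) M}"
        using CM 1 by auto
    qed
  qed
  have half: "real (card ?B) / 2 \<le> real (card {M \<in> ?B. good L M})" if "L \<in> U" for L
  proof -
    have "{M \<in> ?B. \<exists>y\<in>carrier_vec b. \<gamma> * ?q ^ a \<le> real (card {u \<in> carrier_vec a. (y, u) \<in> ?D L M})} \<subseteq> {M \<in> ?B. good L M}"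
      unfolding good_def t by (auto simp: nat_le_iff ceiling_le_iff)
    then have "card {M \<in> ?B. \<exists>y\<in>carrier_vec b. \<gamma> * ?q ^ a \<le> real (card {u \<in> carrier_vec a. (y, u) \<in> ?D L M})}
        \<le> card {M \<in> ?B. good L M}"
      by (rule card_mono[rotated]) (use finB in simp)
    moreover have "real (card ?B) / 2 \<le> real (card {M \<in> ?B. \<exists>y\<in>carrier_vec b. \<gamma> * ?q ^ a \<le> real (card {u \<in> carrier_vec a. (y, u) \<in> ?D L M})})"
      by (rule half_of_extensions_rich[OF S E \<tau> \<gamma>]) (use that in \<open>auto simp: U_def\<close>)
    ultimately show ?thesis by linarith
  qed
  have cnt: "real (card {x \<in> X. P x}) = (\<Sum>x\<in>X. if P x then 1 else 0)" if "finite X" for X :: "'f mat set" and P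
    using that by (simp add: sum.If_cases Int_def)
  have "real (card U) * (real (card ?B) / 2) = (\<Sum>L\<in>U. real (card ?B) / 2)" by simp
  also have "\<dots> \<le> (\<Sum>L\<in>U. real (card {M \<in> ?B. good L M}))" by (rule sum_mono) (rule half)
  also have "\<dots> \<le> (\<Sum>L\<in>?A. real (card {M \<in> ?B. good L M}))" by (rule sum_mono2) (auto simp: U_def finA)
  also have "\<dots> = (\<Sum>M\<in>?B. real (card {L \<in> ?A. good L M}))"
    unfolding cnt[OF finA] cnt[OF finB] by (rule sum.swap)
  finally have low: "real (card U) * (real (card ?B) / 2) \<le> (\<Sum>M\<in>?B. real (card {L \<in> ?A. good L M}))" .
  have "real (card ?C) * (\<Sum>M\<in>?B. real (card {L \<in> ?A. good L M}))
      = (\<Sum>M\<in>?B. \<Sum>C\<in>?C. real (card {L \<in> ?A. good (L - C * M) M}))"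
    unfolding sum_distrib_left by (intro sum.cong refl) (simp add: swap)
  also have "\<dots> = (\<Sum>M\<in>?B. \<Sum>L\<in>?A. real (card (rich_shears b a t (?D L M))))"
  proof (rule sum.cong[OF refl])
    fix M assume M: "M \<in> ?B"
    have "(\<Sum>C\<in>?C. real (card {L \<in> ?A. good (L - C * M) M})) = (\<Sum>L\<in>?A. \<Sum>C\<in>?C. if good (L - C * M) M then 1 else 0)"
      unfolding cnt[OF finA] by (rule sum.swap)
    also have "\<dots> = (\<Sum>L\<in>?A. real (card (rich_shears b a t (?D L M))))"
    proof (rule sum.cong[OF refl])
      fix L assume L: "L \<in> ?A"
      have "{C \<in> ?C. good (L - C * M) M} = rich_shears b a t (?D L M)"
        using shear[OF L M] by (auto simp: rich_shears_def)
      then show "(\<Sum>C\<in>?C. if good (L - C * M) M then 1 else 0) = real (card (rich_shears b a t (?D L M)))"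
        using cnt[OF finC, of "\<lambda>C. good (L - C * M) M"] by simp
    qed
    finally show "(\<Sum>C\<in>?C. real (card {L \<in> ?A. good (L - C * M) M})) = (\<Sum>L\<in>?A. real (card (rich_shears b a t (?D L M))))" .
  qed
  finally have tot: "real (card ?C) * (\<Sum>M\<in>?B. real (card {L \<in> ?A. good L M}))
      = (\<Sum>M\<in>?B. \<Sum>L\<in>?A. real (card (rich_shears b a t (?D L M))))" .
  have "(\<Sum>M\<in>?B. \<Sum>L\<in>?A. real (card (rich_shears b a t (?D L M)))) * ?q ^ (b + a)
      = (\<Sum>M\<in>?B. \<Sum>L\<in>?A. real (card (rich_shears b a t (?D L M))) * ?q ^ (b + a))"
    by (simp add: sum_distrib_right)
  also have "\<dots> \<le> (\<Sum>M\<in>?B. \<Sum>L\<in>?A. real (card ?C) * real (card (?D L M)) * K)"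
    by (intro sum_mono kakeya) (auto simp: deviating_cells_def)
  also have "\<dots> = real (card ?C) * K * (\<Sum>M\<in>?B. \<Sum>L\<in>?A. real (card (?D L M)))"
    by (simp add: sum_distrib_left mult_ac)
  also have "(\<Sum>M\<in>?B. \<Sum>L\<in>?A. real (card (?D L M))) = (\<Sum>(L, M)\<in>?A \<times> ?B. real (card (?D L M)))"
    by (subst sum.swap) (simp add: sum.cartesian_product)
  also have "real (card ?C) * K * (\<Sum>(L, M)\<in>?A \<times> ?B. real (card (?D L M)))
      \<le> real (card ?C) * K * (real (card ?A) * real (card ?B) * ?q ^ (b + a) * (4 / (\<tau>\<^sup>2 * E)))"
    using sum_card_deviating_cells[OF S E \<tau>] K by (intro mult_left_mono) auto
  finally have "(real (card ?C) * (\<Sum>M\<in>?B. real (card {L \<in> ?A. good L M}))) * ?q ^ (b + a)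
      \<le> (real (card ?C) * (K * (real (card ?A) * real (card ?B) * (4 / (\<tau>\<^sup>2 * E))))) * ?q ^ (b + a)"
    unfolding tot by (simp only: mult_ac)
  then have "real (card ?C) * (\<Sum>M\<in>?B. real (card {L \<in> ?A. good L M}))
      \<le> real (card ?C) * (K * (real (card ?A) * real (card ?B) * (4 / (\<tau>\<^sup>2 * E))))"
    by (rule mult_right_le_imp_le) simp
  then have "(\<Sum>M\<in>?B. real (card {L \<in> ?A. good L M})) \<le> K * (real (card ?A) * real (card ?B) * (4 / (\<tau>\<^sup>2 * E)))"
    by (rule mult_left_le_imp_le) (use nonempty in simp)
  with low have "real (card U) * (real (card ?B) / 2) \<le> K * (real (card ?A) * real (card ?B) * (4 / (\<tau>\<^sup>2 * E)))"
    by linarith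
  also have "\<dots> = (8 / (\<tau>\<^sup>2 * E) * K * real (card ?A)) * (real (card ?B) / 2)" by (simp add: mult_ac)
  finally have "real (card U) \<le> 8 / (\<tau>\<^sup>2 * E) * K * real (card ?A)"
    by (rule mult_right_le_imp_le) (use nonempty in simp)
  then show ?thesis by (simp add: U_def)
qed

section \<open>Surjective matrices and the main bound\<close>

lemma card_kernel_times_card_range:
  fixes L :: "'f::{field,finite} mat"
  assumes L: "L \<in> carrier_mat b n"
  shows "CARD('f) ^ n = card {x \<in> carrier_vec n. L *\<^sub>v x = 0\<^sub>v b} * card ((\<lambda>x. L *\<^sub>v x) ` carrier_vec n)"
proof -
  have "card (carrier_vec n :: 'f vec set) = card {x \<in> carrier_vec n. L *\<^sub>v x = 0\<^sub>v b} * card ((\<lambda>x. L *\<^sub>v x) ` carrier_vec n)"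
  proof (rule card_eq_card_fibres[OF finite_carrier_vec])
    fix y assume "y \<in> (\<lambda>x. L *\<^sub>v x) ` carrier_vec n"
    then obtain w where w: "w \<in> carrier_vec n" "y = L *\<^sub>v w" by blast
    have inv: "x - w + w = x" "x + w - w = x" if "x \<in> carrier_vec n" for x
      using that w by (auto intro!: eq_vecI)
    have "bij_betw (\<lambda>x. x - w) {x \<in> carrier_vec n. L *\<^sub>v x = y} {x \<in> carrier_vec n. L *\<^sub>v x = 0\<^sub>v b}"
    proof (rule bij_betw_byWitness[where f' = "\<lambda>x. x + w"])
      show "(\<lambda>x. x - w) ` {x \<in> carrier_vec n. L *\<^sub>v x = y} \<subseteq> {x \<in> carrier_vec n. L *\<^sub>v x = 0\<^sub>v b}"
        using w L by (auto simp: mult_minus_distrib_mat_vec[OF L])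
      show "(\<lambda>x. x + w) ` {x \<in> carrier_vec n. L *\<^sub>v x = 0\<^sub>v b} \<subseteq> {x \<in> carrier_vec n. L *\<^sub>v x = y}"
        using w L by (auto simp: mult_add_distrib_mat_vec[OF L])
    qed (use inv in auto)
    then show "card {x \<in> carrier_vec n. L *\<^sub>v x = y} = card {x \<in> carrier_vec n. L *\<^sub>v x = 0\<^sub>v b}"
      by (rule bij_betw_same_card)
  qed
  then show ?thesis by (simp add: card_carrier_vec)
qed

text \<open>
  A proper subgroup is disjoint from one of its cosets.
\<close>

lemma card_range_le_half:
  fixes L :: "'f::{field,finite} mat"
  assumes L: "L \<in> carrier_mat b n" and ns: "(\<lambda>x. L *\<^sub>v x) ` carrier_vec n \<noteq> carrier_vec b"
  shows "2 * card ((\<lambda>x. L *\<^sub>v x) ` carrier_vec n) \<le> CARD('f) ^ b"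
proof -
  let ?I = "(\<lambda>x. L *\<^sub>v x) ` carrier_vec n"
  have I: "?I \<subseteq> carrier_vec b" using L by auto
  with ns obtain y where y: "y \<in> carrier_vec b" "y \<notin> ?I" by blast
  have finI: "finite ?I" using I finite_carrier_vec finite_subset by blast
  have "inj_on (\<lambda>v. y + v) ?I"
  proof (rule inj_onI)
    fix v v' assume "v \<in> ?I" "v' \<in> ?I" and eq: "y + v = y + v'"
    then have v: "v \<in> carrier_vec b" "v' \<in> carrier_vec b" using I by auto
    have "v = y + v - y" "v' = y + v' - y" using v y by (auto intro!: eq_vecI)
    then show "v = v'" using eq by simp
  qed
  then have "card ((\<lambda>v. y + v) ` ?I) = card ?I" by (rule card_image)
  moreover have "?I \<inter> (\<lambda>v. y + v) ` ?I = {}"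
  proof (rule ccontr)
    assume "?I \<inter> (\<lambda>v. y + v) ` ?I \<noteq> {}"
    then obtain x x' where x: "x \<in> carrier_vec n" "x' \<in> carrier_vec n" "L *\<^sub>v x = y + L *\<^sub>v x'" by blast
    have "L *\<^sub>v (x - x') = y + L *\<^sub>v x' - L *\<^sub>v x'" using x by (simp add: mult_minus_distrib_mat_vec[OF L])
    also have "\<dots> = y" by (rule eq_vecI) (use L y x in auto)
    finally have "y \<in> ?I" using x by (metis image_eqI minus_carrier_vec)
    with y show False by simp
  qed
  ultimately have "2 * card ?I = card (?I \<union> (\<lambda>v. y + v) ` ?I)"
    using finI by (simp add: card_Un_disjoint)
  also have "\<dots> \<le> card (carrier_vec b :: 'f vec set)"
    by (rule card_mono[OF finite_carrier_vec]) (use I y in auto)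
  finally show ?thesis by (simp add: card_carrier_vec)
qed

text \<open>
  First moment of the size of the kernel.  The kernel has at least \<open>q\<^sup>n\<^sup>-\<^sup>b\<close> elements, and at least
  twice as many if the matrix is not surjective, whereas its expected size is less than \<open>q\<^sup>n\<^sup>-\<^sup>b + 1\<close>.
\<close>

lemma card_surjective_maps_ge:
  "(1 - real CARD('f) ^ b / real CARD('f) ^ n) * real (card (carrier_mat b n :: 'f::{field,finite} mat set))
    \<le> real (card (surjective_maps n b :: 'f mat set))"
proof -
  let ?q = "CARD('f)" and ?A = "carrier_mat b n :: 'f mat set"
  let ?S = "surjective_maps n b :: 'f mat set"
  let ?ker = "\<lambda>L :: 'f mat. card {x \<in> carrier_vec n. L *\<^sub>v x = 0\<^sub>v b}"
  have S: "?S \<subseteq> ?A" by (auto simp: surjective_maps_def)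
  have finA: "finite ?A" by (rule finite_carrier_mat)
  have fibre: "card {L \<in> ?A. L *\<^sub>v x = 0\<^sub>v b} * ?q ^ b = (if x = 0\<^sub>v n then card ?A * ?q ^ b else card ?A)"
    if "x \<in> carrier_vec n" for x
  proof (cases "x = 0\<^sub>v n")
    case True
    have "L *\<^sub>v 0\<^sub>v n = 0\<^sub>v b" if "L \<in> ?A" for L using that by (intro eq_vecI) auto
    then have "{L \<in> ?A. L *\<^sub>v x = 0\<^sub>v b} = ?A" using True by auto
    with True show ?thesis by simp
  qed (use card_mat_fibre[OF that _ zero_carrier_vec, of b] in simp)
  have "(\<Sum>L\<in>?A. ?ker L) = (\<Sum>x\<in>carrier_vec n. card {L \<in> ?A. L *\<^sub>v x = 0\<^sub>v b})"
  proof -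
    have "?ker L = (\<Sum>x\<in>carrier_vec n. if L *\<^sub>v x = 0\<^sub>v b then 1 else 0)" for L
      by (simp add: sum.If_cases finite_carrier_vec Int_def)
    moreover have "card {L \<in> ?A. L *\<^sub>v x = 0\<^sub>v b} = (\<Sum>L\<in>?A. if L *\<^sub>v x = 0\<^sub>v b then 1 else 0)" for x
      by (simp add: sum.If_cases finA Int_def)
    ultimately show ?thesis by (simp add: sum.swap[of _ ?A])
  qed
  then have "(\<Sum>L\<in>?A. ?ker L) * ?q ^ b = (\<Sum>x\<in>carrier_vec n. card {L \<in> ?A. L *\<^sub>v x = 0\<^sub>v b} * ?q ^ b)"
    by (simp add: sum_distrib_right)
  also have "\<dots> = (\<Sum>x\<in>(carrier_vec n :: 'f vec set). if x = 0\<^sub>v n then card ?A * ?q ^ b else card ?A)"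
    by (intro sum.cong refl fibre)
  also have "\<dots> \<le> (\<Sum>x\<in>(carrier_vec n :: 'f vec set). (if x = 0\<^sub>v n then card ?A * ?q ^ b else 0) + card ?A)"
    by (rule sum_mono) auto
  also have "\<dots> = card ?A * ?q ^ b + ?q ^ n * card ?A"
    by (simp add: sum.distrib finite_carrier_vec card_carrier_vec)
  finally have up: "(\<Sum>L\<in>?A. ?ker L) * ?q ^ b \<le> card ?A * ?q ^ b + ?q ^ n * card ?A" .
  have ker: "?ker L * ?q ^ b \<ge> ?q ^ n + (if L \<in> ?S then 0 else ?q ^ n)" if L: "L \<in> ?A" for L
  proof -
    let ?I = "(\<lambda>x. L *\<^sub>v x) ` carrier_vec n"
    have "?I \<subseteq> carrier_vec b" using L by auto
    then have "card ?I \<le> ?q ^ b"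
      using card_mono[OF finite_carrier_vec] unfolding card_carrier_vec[symmetric] by blast
    moreover have "2 * card ?I \<le> ?q ^ b" if "L \<notin> ?S"
      by (rule card_range_le_half[OF L]) (use that L in \<open>auto simp: surjective_maps_def\<close>)
    ultimately have "(if L \<in> ?S then 1 else 2) * card ?I \<le> ?q ^ b" by simp
    then have "?ker L * ((if L \<in> ?S then 1 else 2) * card ?I) \<le> ?ker L * ?q ^ b" by (rule mult_left_mono) simp
    moreover have "?ker L * ((if L \<in> ?S then 1 else 2) * card ?I) = (if L \<in> ?S then 1 else 2) * ?q ^ n"
      by (simp only: card_kernel_times_card_range[OF L] mult.left_commute)
    ultimately have "(if L \<in> ?S then 1 else 2) * ?q ^ n \<le> ?ker L * ?q ^ b" by (simp only:)
    then show ?thesis by (cases "L \<in> ?S") simp_all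
  qed
  have "?q ^ n * card ?A + ?q ^ n * card (?A - ?S) = (\<Sum>L\<in>?A. ?q ^ n + (if L \<in> ?S then 0 else ?q ^ n))"
    using finA by (simp add: sum.distrib sum.If_cases Diff_eq mult.commute)
  also have "\<dots> \<le> (\<Sum>L\<in>?A. ?ker L) * ?q ^ b"
    unfolding sum_distrib_right by (rule sum_mono[OF ker])
  also note up
  finally have "?q ^ n * card (?A - ?S) \<le> card ?A * ?q ^ b" by simp
  then have "real (?q ^ n * card (?A - ?S)) \<le> real (card ?A * ?q ^ b)" by (rule of_nat_mono)
  moreover have "real (card (?A - ?S)) = real (card ?A) - real (card ?S)"
    using card_mono[OF finA S] finite_subset[OF S finA] by (simp add: card_Diff_subset[OF _ S] of_nat_diff)
  ultimately have "real ?q ^ n * (real (card ?A) - real (card ?S)) \<le> real (card ?A) * real ?q ^ b" by simp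
  then show ?thesis by (simp add: field_simps)
qed

theorem theorem1p5:
  fixes S :: "'f :: {field, finite} vec set"
    and n a b q :: nat and \<tau> E \<gamma> M :: real
  assumes "q = CARD('f)"
    and "S \<subseteq> carrier_vec n" and "S \<noteq> {}"
    and "a \<ge> 1" and "b \<ge> 1" and "b + a < n"
    and "\<tau> > 0"
    and "E = real (card S) / real q ^ (b + a)"
    and "\<gamma> = 1 - 8 * (1 + \<tau>) / (\<tau>\<^sup>2 * E)"
    and "\<gamma> > 0"
    and "M = (let first = ((1 + real q powi (1 - int a)) / \<gamma>) ^ (b + a);
                  second = 4 / \<gamma> * exp (8 * real (b + a) / (\<gamma> * real q ^ (a - 1)))
              in if \<gamma> * real q ^ (a - 1) \<ge> 8 then min first second else first)"
  shows "beta n S b \<tau> \<le> 8 / (\<tau>\<^sup>2 * E) * M \<and>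
    (\<tau> \<le> 1 \<longrightarrow>
      measure_pmf.prob (pmf_of_set (carrier_mat b n)) {L :: 'f mat. unbalanced n S b \<tau> L}
        \<le> 9 / (\<tau>\<^sup>2 * E) * M)"
proof -
  note q_def = assms(1) and S = assms(2) and \<tau> = assms(7) and E_def = assms(8) and \<gamma>_def = assms(9) and \<gamma>0 = assms(10)
  let ?A = "carrier_mat b n :: 'f mat set" and ?Sur = "surjective_maps n b :: 'f mat set"
  define U where "U = {L \<in> ?A. unbalanced n S b \<tau> L}"
  define k where "k = b + a"
  define first where "first = ((1 + real q powi (1 - int a)) / \<gamma>) ^ (b + a)"
  define second where "second = 4 / \<gamma> * exp (8 * real (b + a) / (\<gamma> * real q ^ (a - 1)))"
  have finA: "finite ?A" by (rule finite_carrier_mat)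
  have A0: "card ?A > 0" using zero_carrier_mat[of b n] finA by (auto simp: card_gt_0_iff)
  have q: "q \<ge> 2" unfolding q_def by (rule card_field_ge_2)
  have "card S > 0"
    using S assms(3) finite_subset[OF S finite_carrier_vec] by (simp add: card_gt_0_iff)
  then have E0: "E > 0" using q by (simp add: E_def)
  have \<gamma>1: "\<gamma> \<le> 1" using \<tau> E0 by (simp add: \<gamma>_def)
  define t where "t = nat \<lceil>\<gamma> * real q ^ a\<rceil>"
  have t1: "\<gamma> * real q ^ a \<le> real t" unfolding t_def by linarith
  have t2: "t \<le> q ^ a"
  proof -
    have "\<gamma> * real q ^ a \<le> real (q ^ a)" using \<gamma>0 \<gamma>1 by (simp add: mult_left_le_one_le)
    then show ?thesis by (simp add: t_def nat_le_iff ceiling_le_iff)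
  qed
  \<comment> \<open>A bound for the proportion of nonsurjective matrices; each Kakeya bound absorbs the factor \<open>1 - u\<close>.\<close>
  define u where "u = real q ^ b / real q ^ n"
  define \<eta> where "\<eta> = 1 / real q ^ a"
  define \<epsilon> where "\<epsilon> = 1 / real q ^ (a - 1)"
  have qa: "real q ^ a = real q * real q ^ (a - 1)" using assms(4) by (cases a) auto
  have \<eta>: "0 < \<eta>" "\<eta> \<le> 1 / 2"
  proof -
    have "real q ^ 1 \<le> real q ^ a" using q assms(4) by (intro power_increasing) auto
    moreover have "2 \<le> real q" using q by simp
    ultimately have "2 \<le> real q ^ a" unfolding power_one_right by linarith
    then show "\<eta> \<le> 1 / 2" unfolding \<eta>_def by (rule divide_left_mono) (use q in auto)
  qed (use q in \<open>simp add: \<eta>_def\<close>)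
  have \<epsilon>: "0 < \<epsilon>" "\<epsilon> \<le> 1" using q by (simp_all add: \<epsilon>_def)
  have u: "u \<le> \<eta> / 2"
  proof -
    have "real q ^ n = real q ^ b * real q ^ (n - b)" using assms(6) by (simp flip: power_add)
    then have "u = 1 / real q ^ (n - b)" using q by (simp add: u_def)
    also have "\<dots> \<le> 1 / real q ^ (Suc a)"
      using q assms(6) by (intro divide_left_mono power_increasing) auto
    also have "\<dots> = \<eta> / real q" by (simp add: \<eta>_def)
    also have "\<dots> \<le> \<eta> / 2" using q \<eta> by (intro divide_left_mono) auto
    finally show ?thesis .
  qed
  have u1: "0 \<le> u" "u \<le> 1 / 4"
    using u \<eta> by (simp add: u_def, linarith)
  have bound: "real (card U) \<le> 8 / (\<tau>\<^sup>2 * E) * K * real (card ?A)"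
    if "\<And>D :: ('f vec \<times> 'f vec) set. D \<subseteq> carrier_vec b \<times> carrier_vec a \<Longrightarrow>
       real (card (rich_shears b a t D)) * real q ^ (b + a)
         \<le> real (card (carrier_mat b a :: 'f mat set)) * real (card D) * K" "K \<ge> 0" for K
    unfolding U_def
    by (rule card_unbalanced_le[OF S E_def[unfolded q_def] E0 \<tau> \<gamma>_def t_def[unfolded q_def]])
       (use that in \<open>auto simp: q_def\<close>)
  have pre: "0 \<le> 8 / (\<tau>\<^sup>2 * E)" using E0 by simp
  have first_bound: "real (card U) \<le> 8 / (\<tau>\<^sup>2 * E) * ((1 - u) * first) * real (card ?A)"
  proof -
    let ?K = "((real q ^ a + real q - 1) / (\<gamma> * real q ^ a)) ^ (b + a)"
    have "real q powi (1 - int a) = \<epsilon>"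
    proof -
      have "1 - int a = - int (a - 1)" using assms(4) by (simp add: of_nat_diff)
      then have "real q powi (1 - int a) = inverse (real q ^ (a - 1))"
        by (simp only: power_int_minus power_int_of_nat)
      then show ?thesis by (simp only: \<epsilon>_def inverse_eq_divide)
    qed
    then have f: "first = ((1 + \<epsilon>) / \<gamma>) ^ k" by (simp add: first_def k_def)
    have eq: "(real q ^ a + real q - 1) / (\<gamma> * real q ^ a) = (1 + \<epsilon> - \<eta>) / \<gamma>"
      using q \<gamma>0 by (simp add: \<epsilon>_def \<eta>_def qa field_simps)
    \<comment> \<open>\<open>kakeya_power_bound\<close> has \<open>1 + \<epsilon> - \<eta>\<close> in place of \<open>1 + \<epsilon>\<close>, which pays for surjectivity.\<close>
    have "(1 + \<epsilon> - \<eta>) / (1 + \<epsilon>) \<le> 1 - \<eta> / 2"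
    proof -
      have "\<eta> * \<epsilon> \<le> \<eta> * 1" using \<eta> \<epsilon> by (intro mult_left_mono) auto
      then show ?thesis using \<epsilon> by (simp add: field_simps)
    qed
    then have r: "(1 + \<epsilon> - \<eta>) / (1 + \<epsilon>) \<le> 1 - u" using u by linarith
    have r0: "0 \<le> (1 + \<epsilon> - \<eta>) / (1 + \<epsilon>)" using \<eta> \<epsilon> by simp
    have "((1 + \<epsilon> - \<eta>) / (1 + \<epsilon>)) ^ k \<le> (1 + \<epsilon> - \<eta>) / (1 + \<epsilon>)"
      using power_decreasing[of 1 k "(1 + \<epsilon> - \<eta>) / (1 + \<epsilon>)"] r0 r u1 assms(4) by (simp add: k_def)
    with r have rk: "((1 + \<epsilon> - \<eta>) / (1 + \<epsilon>)) ^ k \<le> 1 - u" by linarith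
    have "?K = ((1 + \<epsilon> - \<eta>) / (1 + \<epsilon>)) ^ k * first"
      unfolding eq f using \<epsilon> by (simp add: k_def flip: power_mult_distrib)
    also have "\<dots> \<le> (1 - u) * first"
      by (rule mult_right_mono[OF rk]) (use f \<epsilon> \<gamma>0 in simp)
    finally have K: "?K \<le> (1 - u) * first" .
    have K0: "0 \<le> ?K" unfolding eq using \<eta> \<epsilon> \<gamma>0 by simp
    have "real (card U) \<le> 8 / (\<tau>\<^sup>2 * E) * ?K * real (card ?A)"
    proof (rule bound[OF _ K0])
      fix D :: "('f vec \<times> 'f vec) set" assume "D \<subseteq> carrier_vec b \<times> carrier_vec a"
      from kakeya_power_bound[OF this assms(4) \<gamma>0 \<gamma>1 t1[unfolded q_def]]
      show "real (card (rich_shears b a t D)) * real q ^ (b + a)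
         \<le> real (card (carrier_mat b a :: 'f mat set)) * real (card D) * ?K" by (simp only: q_def)
    qed
    also have "\<dots> \<le> 8 / (\<tau>\<^sup>2 * E) * ((1 - u) * first) * real (card ?A)"
      using K pre by (intro mult_right_mono mult_left_mono) auto
    finally show ?thesis .
  qed
  have second_bound: "real (card U) \<le> 8 / (\<tau>\<^sup>2 * E) * ((1 - u) * second) * real (card ?A)"
    if x: "\<gamma> * real q ^ (a - 1) \<ge> 8"
  proof -
    let ?K = "16 / (7 * \<gamma>) * exp (8 * real (b + a) / (\<gamma> * real q ^ (a - 1)))"
    define X where "X = exp (8 * real (b + a) / (\<gamma> * real q ^ (a - 1))) / \<gamma>"
    have X: "?K = 16 / 7 * X" "second = 4 * X" by (simp_all add: X_def second_def)
    \<comment> \<open>Here the constant \<open>16 / 7\<close> against \<open>4\<close> pays for surjectivity, since \<open>u \<le> 1 / 4\<close>.\<close>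
    have "16 / 7 * X \<le> ((1 - u) * 4) * X"
      using u1 \<gamma>0 by (intro mult_right_mono) (auto simp: X_def)
    then have K: "?K \<le> (1 - u) * second" by (simp only: X mult.assoc)
    have K0: "0 \<le> ?K" using \<gamma>0 by simp
    have "real (card U) \<le> 8 / (\<tau>\<^sup>2 * E) * ?K * real (card ?A)"
    proof (rule bound[OF _ K0])
      fix D :: "('f vec \<times> 'f vec) set" assume "D \<subseteq> carrier_vec b \<times> carrier_vec a"
      from kakeya_exponential_bound[OF this assms(4) \<gamma>0 \<gamma>1 t1[unfolded q_def] t2[unfolded q_def] x[unfolded q_def]]
      show "real (card (rich_shears b a t D)) * real q ^ (b + a)
         \<le> real (card (carrier_mat b a :: 'f mat set)) * real (card D) * ?K" by (simp only: q_def)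
    qed
    also have "\<dots> \<le> 8 / (\<tau>\<^sup>2 * E) * ((1 - u) * second) * real (card ?A)"
      using K pre by (intro mult_right_mono mult_left_mono) auto
    finally show ?thesis .
  qed
  have M: "M = (if \<gamma> * real q ^ (a - 1) \<ge> 8 then min first second else first)"
    unfolding assms(11) Let_def first_def second_def ..
  have UM: "real (card U) \<le> 8 / (\<tau>\<^sup>2 * E) * M * ((1 - u) * real (card ?A))"
  proof -
    have "M = first \<or> 8 \<le> \<gamma> * real q ^ (a - 1) \<and> M = second" by (simp add: M min_def)
    then have "real (card U) \<le> 8 / (\<tau>\<^sup>2 * E) * ((1 - u) * M) * real (card ?A)"
      using first_bound second_bound by blast
    then show ?thesis by (simp only: mult_ac)
  qed
  have "0 \<le> first" "0 \<le> second" using \<gamma>0 by (simp_all add: first_def second_def power_int_def)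
  then have M0: "0 \<le> M" by (simp add: M)
  have sur: "(1 - u) * real (card ?A) \<le> real (card ?Sur)"
    using card_surjective_maps_ge[where 'f = 'f, of b n] by (simp add: u_def q_def)
  moreover have "0 < (1 - u) * real (card ?A)" using u1 A0 by simp
  ultimately have sur0: "0 < real (card ?Sur)" by linarith
  have "real (card {L \<in> ?Sur. unbalanced n S b \<tau> L}) \<le> real (card U)"
    using finA by (intro of_nat_mono card_mono) (auto simp: U_def surjective_maps_def)
  also note UM
  also have "8 / (\<tau>\<^sup>2 * E) * M * ((1 - u) * real (card ?A)) \<le> 8 / (\<tau>\<^sup>2 * E) * M * real (card ?Sur)"
    using sur pre M0 by (intro mult_left_mono) auto
  finally have part1: "beta n S b \<tau> \<le> 8 / (\<tau>\<^sup>2 * E) * M"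
    unfolding beta_def using sur0 by (simp add: pos_divide_le_eq)
  have "measure_pmf.prob (pmf_of_set ?A) {L. unbalanced n S b \<tau> L} = real (card U) / real (card ?A)"
    using A0 finA by (subst measure_pmf_of_set) (auto simp: U_def Int_def card_gt_0_iff)
  also have "\<dots> \<le> 8 / (\<tau>\<^sup>2 * E) * M"
  proof -
    have "8 / (\<tau>\<^sup>2 * E) * M * ((1 - u) * real (card ?A)) \<le> 8 / (\<tau>\<^sup>2 * E) * M * (1 * real (card ?A))"
      using u1 pre M0 by (intro mult_left_mono mult_right_mono) auto
    with UM have "real (card U) \<le> 8 / (\<tau>\<^sup>2 * E) * M * real (card ?A)" by simp
    then show ?thesis using A0 by (simp add: pos_divide_le_eq)
  qed
  also have "\<dots> \<le> 9 / (\<tau>\<^sup>2 * E) * M"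
    using E0 M0 by (intro mult_right_mono divide_right_mono) auto
  finally show ?thesis using part1 by blast
qed

end
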